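(* Let $\rho$ be a specialization such that $\sum_{k\ge 1}\frac{\rho(p_k)}{k}z^k$ defines a holomorphic function in a neighborhood of the unit circle $\mathbb{T}$, and let $\mathbb{P}_\alpha$ ($\alpha>0$), $u_{\min},u_{\max}$ and $\mathbb{P}_{\mathcal{S}(u)}$ ($u\in[u_{\min},u_{\max}]$) be the associated point processes on $\mathbb{Z}$ and real numbers defined in the context. For a continuous function $f:\mathbb{R}\to\mathbb{R}$ and a finite set $m\subset\mathbb{Z}$ put $$\Sigma(f,m,\alpha)=\frac1\alpha\sum_{x\in[\alpha u_{\min},\alpha u_{\max}]\cap\mathbb{Z}} f\left(\frac{x}{\alpha}\right)c_{m+x},\qquad I(f,m)=\int_{u_{\min}}^{u_{\max}} f(u)\,\mathbb{E}_{\mathcal{S}(u)}[c_m]\,du .$$ Then for any continuous function $f:\mathbb{R}\to\mathbb{R}$, any finite $m\subset\mathbb{Z}$ and all $\epsilon>0$, $$\lim_{\alpha\to+\infty}\mathbb{P}_\alpha\left(\left|\Sigma(f,m,\alpha)-I(f,m)\right|>\epsilon\right)=0 .$$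
   Context: A point process on $\mathbb{Z}$ is a probability measure on the set $\mathrm{Conf}(\mathbb{Z})=\{0,1\}^{\mathbb{Z}}$ of subsets of $\mathbb{Z}$ (Borel sigma-algebra generated by cylinders). A pattern is a finite set $m\subset\mathbb{Z}$; $c_m(X)=1$ if $m\subset X$ and $c_m(X)=0$ otherwise; for $x\in\mathbb{Z}$, $m+x=\{a+x: a\in m\}$. A point process $\mathbb{P}$ is determinantal with correlation kernel $K$ if $\mathbb{E}_{\mathbb{P}}[c_m]=\det(K(m_i,m_j))_{i,j=1}^l$ for every finite $m=\{m_1,\dots,m_l\}$. Schur measures: let $\Lambda$ be the $\mathbb{C}$-algebra of symmetric functions, $p_k$ the Newton power sums, $s_\lambda$ the Schur functions indexed by partitions $\lambda=(\lambda_1\ge\lambda_2\ge\cdots)$. A specialization is an algebra morphism $\rho:\Lambda\to\mathbb{C}$ (determined by the numbers $\rho(p_k)$). For $\alpha>0$ let $\rho_\alpha=\alpha\rho$ be the specialization with $\rho_\alpha(p_k)=\alpha\rho(p_k)$, and let $\mathbb{S}_\alpha$ be the symmetric Schur measure, i.e. the probability measure on partitions with $\mathbb{S}_\alpha(\lambda)=C_\alpha|\rho_\alpha(s_\lambda)|^2$, $C_\alpha$ the normalizing constant. $\mathbb{P}_\alpha$ is the image of $\mathbb{S}_\alpha$ under $\lambda\mapsto\{\lambda_i-i: i=1,2,\dots\}\in\mathrm{Conf}(\mathbb{Z})$; $\mathbb{E}_\alpha$ is its expectation. Limit processes: set $G(z)=\sum_{k\ge1}\frac{\rho(p_k)}{k}z^k-\sum_{k\ge1}\frac{\overline{\rho(p_k)}}{k}z^{-k}$,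 which is holomorphic near $\mathbb{T}$, purely imaginary on $\mathbb{T}$, and satisfies $zG'(z)\in\mathbb{R}$ for $z\in\mathbb{T}$. $u_{\min}$ and $u_{\max}$ are the minimum and maximum of $zG'(z)$ on $\mathbb{T}$. For $u\in[u_{\min},u_{\max}]$, the set $\{z\in\mathbb{T}: zG'(z)\ge u\}$ is a finite union of arcs $[e^{i\phi_k(u)},e^{i\psi_k(u)}]$, $k=1,\dots,L(u)$ (with $\phi_k(u)\le\psi_k(u)$), and $\mathbb{P}_{\mathcal{S}(u)}$, with expectation $\mathbb{E}_{\mathcal{S}(u)}$, is the determinantal point process on $\mathbb{Z}$ with kernel $$\mathcal{S}(u)(x,y)=\sum_{k=1}^{L(u)}\frac{e^{i\phi_k(u)(y-x)}-e^{i\psi_k(u)(y-x)}}{2i\pi(x-y)}\ (x\ne y),\qquad \mathcal{S}(u)(x,x)=\sum_{k=1}^{L(u)}\frac{\psi_k(u)-\phi_k(u)}{2\pi}.$$ *)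

theory Defs
  imports
    "HOL-Probability.Probability"
    "HOL-Complex_Analysis.Complex_Analysis"
    "HOL-Library.Poly_Mapping"
    "Jordan_Normal_Form.Determinant"
begin

section \<open>Symmetric functions, Schur functions and specializations\<close>

text \<open>
  A formal power series over the complex numbers in the variables
  \<open>x\<^sub>0, x\<^sub>1, \<dots>\<close> is given by its coefficients; monomials are finitely
  supported exponent vectors.
\<close>

type_synonym series = "(nat \<Rightarrow>\<^sub>0 nat) \<Rightarrow> complex"

definition mdegree :: "(nat \<Rightarrow>\<^sub>0 nat) \<Rightarrow> nat" where
  "mdegree \<mu> = (\<Sum>i\<in>Poly_Mapping.keys \<mu>. Poly_Mapping.lookup \<mu> i)"

definition sym_funs :: "series set" where
  "sym_funs = {F. (\<exists>d. \<forall>\<mu>. F \<mu> \<noteq> 0 \<longrightarrow> mdegree \<mu> \<le> d) \<and>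
                  (\<forall>\<pi> \<mu>. bij \<pi> \<longrightarrow> F (Poly_Mapping.map_key \<pi> \<mu>) = F \<mu>)}"

definition ser_one :: series where
  "ser_one \<mu> = (if \<mu> = 0 then 1 else 0)"

definition ser_add :: "series \<Rightarrow> series \<Rightarrow> series" where
  "ser_add F H \<mu> = F \<mu> + H \<mu>"

definition ser_scale :: "complex \<Rightarrow> series \<Rightarrow> series" where
  "ser_scale c F \<mu> = c * F \<mu>"

definition ser_mult :: "series \<Rightarrow> series \<Rightarrow> series" where
  "ser_mult F H \<mu> = (\<Sum>(\<nu>, \<kappa>) | \<nu> + \<kappa> = \<mu>. F \<nu> * H \<kappa>)"

lemma finite_splits: "finite {(\<nu>, \<kappa>). \<nu> + \<kappa> = (\<mu> :: nat \<Rightarrow>\<^sub>0 nat)}"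
proof -
  let ?S = "{(\<nu>, \<kappa>). \<nu> + \<kappa> = \<mu>}"
  let ?D = "Pi\<^sub>E (Poly_Mapping.keys \<mu>) (\<lambda>i. {..Poly_Mapping.lookup \<mu> i})"
  have "inj_on (\<lambda>p. restrict (Poly_Mapping.lookup (fst p)) (Poly_Mapping.keys \<mu>)) ?S"
  proof (rule inj_onI)
    fix p q
    assume p: "p \<in> ?S" and q: "q \<in> ?S"
      and r: "restrict (Poly_Mapping.lookup (fst p)) (Poly_Mapping.keys \<mu>) =
              restrict (Poly_Mapping.lookup (fst q)) (Poly_Mapping.keys \<mu>)"
    from p q have s: "fst p + snd p = \<mu>" "fst q + snd q = \<mu>" by auto
    have "Poly_Mapping.lookup (fst p) i = Poly_Mapping.lookup (fst q) i" for i
    proof (cases "i \<in> Poly_Mapping.keys \<mu>")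
      case True
      then show ?thesis using fun_cong[OF r, of i] by simp
    next
      case False
      then have "Poly_Mapping.lookup (fst p + snd p) i = 0"
        "Poly_Mapping.lookup (fst q + snd q) i = 0"
        using s by (simp_all add: in_keys_iff)
      then show ?thesis by (simp add: Poly_Mapping.lookup_add)
    qed
    then have "fst p = fst q" by (rule poly_mapping_eqI)
    moreover have "snd p = snd q"
      using s calculation by (metis add_left_imp_eq)
    ultimately show "p = q" by (rule prod_eqI)
  qed
  moreover have "(\<lambda>p. restrict (Poly_Mapping.lookup (fst p)) (Poly_Mapping.keys \<mu>)) ` ?S \<subseteq> ?D"
    by (auto simp: Poly_Mapping.lookup_add)
  moreover have "finite ?D"
    by (intro finite_PiE) auto
  ultimately show ?thesis
    using finite_imageD finite_subset by blast
qed

definition power_sum :: "nat \<Rightarrow> series" where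
  "power_sum k \<mu> = (if \<exists>i. \<mu> = Poly_Mapping.single i k then 1 else 0)"

text \<open>
  Parts are indexed from \<open>0\<close>: \<open>l i\<close> is the part usually written
  \<open>\<lambda>\<^bsub>i+1\<^esub>\<close>.
\<close>

definition partitions :: "(nat \<Rightarrow> nat) set" where
  "partitions = {l. antimono l \<and> finite {i. l i \<noteq> 0}}"

definition diagram :: "(nat \<Rightarrow> nat) \<Rightarrow> (nat \<times> nat) set" where
  "diagram l = {(i, j). j < l i}"

text \<open>
  Semistandard tableaux: rows weakly increasing, columns strictly increasing; the
  entries are indices of variables. Extensionality makes a tableau determined by its
  entries on the diagram.
\<close>

definition ssyt :: "(nat \<Rightarrow> nat) \<Rightarrow> (nat \<times> nat \<Rightarrow> nat) set" where
  "ssyt l = {T \<in> extensional (diagram l).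
     (\<forall>i j. (i, Suc j) \<in> diagram l \<longrightarrow> T (i, j) \<le> T (i, Suc j)) \<and>
     (\<forall>i j. (Suc i, j) \<in> diagram l \<longrightarrow> T (i, j) < T (Suc i, j))}"

definition schur :: "(nat \<Rightarrow> nat) \<Rightarrow> series" where
  "schur l \<mu> = of_nat (card {T \<in> ssyt l. \<forall>k. card {c \<in> diagram l. T c = k} = Poly_Mapping.lookup \<mu> k})"

definition specialization :: "(series \<Rightarrow> complex) \<Rightarrow> bool" where
  "specialization \<rho> \<longleftrightarrow>
     \<rho> ser_one = 1 \<and>
     (\<forall>F\<in>sym_funs. \<forall>H\<in>sym_funs. \<rho> (ser_add F H) = \<rho> F + \<rho> H) \<and>
     (\<forall>F\<in>sym_funs. \<forall>H\<in>sym_funs. \<rho> (ser_mult F H) = \<rho> F * \<rho> H) \<and>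
     (\<forall>c. \<forall>F\<in>sym_funs. \<rho> (ser_scale c F) = c * \<rho> F)"


section \<open>Point processes on the integers\<close>

definition conf_algebra :: "int set measure" where
  "conf_algebra = sigma UNIV {{X. X \<inter> W = S} | W S. finite W}"

definition point_process :: "int set measure \<Rightarrow> bool" where
  "point_process P \<longleftrightarrow> prob_space P \<and> sets P = sets conf_algebra"

definition c_pat :: "int set \<Rightarrow> int set \<Rightarrow> real" where
  "c_pat m X = (if m \<subseteq> X then 1 else 0)"

definition shift :: "int set \<Rightarrow> int \<Rightarrow> int set" where
  "shift m x = (\<lambda>a. a + x) ` m"

definition determinantal :: "int set measure \<Rightarrow> (int \<Rightarrow> int \<Rightarrow> complex) \<Rightarrow> bool" where
  "determinantal P K \<longleftrightarrow> point_process P \<and>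
     (\<forall>ms. distinct ms \<longrightarrow>
        complex_of_real (\<integral>X. c_pat (set ms) X \<partial>P) =
        Determinant.det (Matrix.mat (length ms) (length ms) (\<lambda>(i, j). K (ms ! i) (ms ! j))))"


section \<open>Schur measures\<close>

definition schur_measure :: "(series \<Rightarrow> complex) \<Rightarrow> (nat \<Rightarrow> nat) measure" where
  "schur_measure \<rho> = point_measure partitions
     (\<lambda>l. ennreal ((cmod (\<rho> (schur l)))\<^sup>2 /
                   (\<Sum>\<^sub>\<infinity>l'\<in>partitions. (cmod (\<rho> (schur l')))\<^sup>2)))"

text \<open>With parts indexed from \<open>0\<close>, \<open>\<lambda>\<^sub>i - i\<close> for \<open>i \<ge> 1\<close> becomes
  \<open>l i - (i + 1)\<close> for \<open>i \<ge> 0\<close>.\<close>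

definition partition_conf :: "(nat \<Rightarrow> nat) \<Rightarrow> int set" where
  "partition_conf l = {int (l i) - (int i + 1) | i. True}"

definition schur_process :: "(series \<Rightarrow> complex) \<Rightarrow> int set measure" where
  "schur_process \<rho> = distr (schur_measure \<rho>) conf_algebra partition_conf"


section \<open>Limit processes\<close>

definition analytic_near_circle :: "(series \<Rightarrow> complex) \<Rightarrow> bool" where
  "analytic_near_circle \<rho> \<longleftrightarrow> (\<exists>U. open U \<and> sphere 0 1 \<subseteq> U \<and>
     (\<forall>z\<in>U. summable (\<lambda>k. \<rho> (power_sum (Suc k)) / of_nat (Suc k) * z ^ Suc k)) \<and>
     (\<lambda>z. suminf (\<lambda>k. \<rho> (power_sum (Suc k)) / of_nat (Suc k) * z ^ Suc k)) holomorphic_on U)"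

definition G_fun :: "(series \<Rightarrow> complex) \<Rightarrow> complex \<Rightarrow> complex" where
  "G_fun \<rho> z =
     suminf (\<lambda>k. \<rho> (power_sum (Suc k)) / of_nat (Suc k) * z ^ Suc k) -
     suminf (\<lambda>k. cnj (\<rho> (power_sum (Suc k))) / of_nat (Suc k) * inverse z ^ Suc k)"

text \<open>\<open>z G'(z)\<close> is real on the unit circle, so taking the real part loses nothing there.\<close>

definition zG' :: "(series \<Rightarrow> complex) \<Rightarrow> complex \<Rightarrow> real" where
  "zG' \<rho> z = Re (z * deriv (G_fun \<rho>) z)"

definition u_min :: "(series \<Rightarrow> complex) \<Rightarrow> real" where
  "u_min \<rho> = Inf (zG' \<rho> ` sphere 0 1)"

definition u_max :: "(series \<Rightarrow> complex) \<Rightarrow> real" where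
  "u_max \<rho> = Sup (zG' \<rho> ` sphere 0 1)"

text \<open>
  \<open>A\<close> is the disjoint union of the arcs \<open>[e\<^bsup>i\<phi>(k)\<^esup>, e\<^bsup>i\<psi>(k)\<^esup>]\<close>,
  \<open>k = 1, \<dots>, L\<close>. Arcs may degenerate to points, and the full circle is the single arc
  with \<open>\<psi>(1) = \<phi>(1) + 2\<pi>\<close>.
\<close>

definition arcs :: "complex set \<Rightarrow> nat \<Rightarrow> (nat \<Rightarrow> real) \<Rightarrow> (nat \<Rightarrow> real) \<Rightarrow> bool" where
  "arcs A L \<phi> \<psi> \<longleftrightarrow>
     (\<forall>k\<in>{1..L}. \<phi> k \<le> \<psi> k \<and> \<psi> k \<le> \<phi> k + 2 * pi) \<and>
     disjoint_family_on (\<lambda>k. cis ` {\<phi> k..\<psi> k}) {1..L} \<and>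
     A = (\<Union>k\<in>{1..L}. cis ` {\<phi> k..\<psi> k})"

definition S_kernel :: "nat \<Rightarrow> (nat \<Rightarrow> real) \<Rightarrow> (nat \<Rightarrow> real) \<Rightarrow> int \<Rightarrow> int \<Rightarrow> complex" where
  "S_kernel L \<phi> \<psi> x y =
     (if x = y then \<Sum>k=1..L. complex_of_real ((\<psi> k - \<phi> k) / (2 * pi))
      else \<Sum>k=1..L. (exp (\<i> * \<phi> k * of_int (y - x)) - exp (\<i> * \<psi> k * of_int (y - x))) /
                     (2 * \<i> * pi * of_int (x - y)))"


section \<open>The linear statistic and its limit\<close>

definition Sigma_stat ::
    "(series \<Rightarrow> complex) \<Rightarrow> (real \<Rightarrow> real) \<Rightarrow> int set \<Rightarrow> real \<Rightarrow> int set \<Rightarrow> real" where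
  "Sigma_stat \<rho> f m \<alpha> X = 1 / \<alpha> *
     (\<Sum>x\<in>{x::int. \<alpha> * u_min \<rho> \<le> real_of_int x \<and> real_of_int x \<le> \<alpha> * u_max \<rho>}.
        f (real_of_int x / \<alpha>) * c_pat (shift m x) X)"

definition I_lim ::
    "(series \<Rightarrow> complex) \<Rightarrow> (real \<Rightarrow> int set measure) \<Rightarrow> (real \<Rightarrow> real) \<Rightarrow> int set \<Rightarrow> real" where
  "I_lim \<rho> P f m =
     (LINT u:{u_min \<rho>..u_max \<rho>}|lborel. f u * (\<integral>X. c_pat m X \<partial>P u))"

end

theory Submission
  imports Defs
begin

text \<open>
  By the Jacobi-Trudi identity the weight of a partition with at most \<open>N\<close> rows is the squared modulus
  of a determinant in the numbers \<open>\<rho>\<^sub>\<alpha>(h\<^sub>n)\<close>. Restricted to partitions in an \<open>N \<times> N\<close> box, the Schur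
  measure is therefore a determinantal ensemble whose kernel is an orthogonal projection. As
  \<open>N \<rightarrow> \<infinity>\<close> this kernel converges to \<open>\<Sum>\<^sub>k J(k + y) cnj (J(k + x))\<close>, summed over \<open>k > 0\<close>, where
  the \<open>J(n)\<close> are the Fourier coefficients of the unimodular function \<open>exp (\<alpha> G)\<close>.

  By polarization, the sums of \<open>J(k + b) cnj (J(k + a))\<close> over \<open>k > \<alpha> u\<close> are combinations of tails of
  the measures with masses \<open>\<bar>v J(n + a) + w J(n + b)\<bar>\<^sup>2\<close> at \<open>n / \<alpha>\<close>. Their characteristic functions
  converge by Parseval, so Levy's theorem gives convergence of the shifted kernels to the kernel
  \<open>\<S>(u)\<close> at all \<open>u\<close> that are not atoms of the distribution of \<open>z G'(z)\<close>, hence for almost every \<open>u\<close>,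
  and dominated convergence yields the limit of the expectations. The rows of the kernel have norm
  at most one, so the covariances of \<open>c\<^bsub>m+x\<^esub>\<close> and \<open>c\<^bsub>m+y\<^esub>\<close>, summed over \<open>y\<close> in a window of \<open>n\<close>
  points, are \<open>O(\<surd>n)\<close>; the variance of the statistic is then \<open>O(\<alpha>\<^bsup>-1/2\<^esup>)\<close>, and
  Chebyshev's inequality concludes.
\<close>

section \<open>Determinants\<close>

text \<open>The configuration of a partition is infinite, with all far negative sites occupied, so
  determinantal formulas are proved in boxes and carried to the limit. Two facts allow this. The
  Gram determinants that normalize the boxes stay bounded: the coefficients of the inverse of the
  generating series of the h_n give a basis in which the Gram matrix is close to the identity. This
  also yields the summability of the Schur weights. And the inverse Gram matrices need not be
  computed: the orthonormality relation of the translates of J writes a point mass as two half-line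
  sums whose truncations lie in the range and in the kernel of the projection. Power sums enter
  through Newton's recursion, which identifies the generating series with the exponential of the sum
  of p_k z^k / k; this ties the decay of all coefficients to analyticity near the circle. The
  oscillating symbol is treated without steepest descent, which would require control of degenerate
  critical points: only difference quotients of its phase occur, at the price of countably many
  exceptional u.\<close>

definition fdet :: "nat \<Rightarrow> (nat \<Rightarrow> nat \<Rightarrow> 'a::comm_ring_1) \<Rightarrow> 'a" where
  "fdet n F = Determinant.det (Matrix.mat n n (\<lambda>(i, j). F i j))"

lemma fdet_leibniz:
  "fdet n F = (\<Sum>p | p permutes {0..<n}. signof p * (\<Prod>i=0..<n. F i (p i)))"
proof -
  have "(\<Prod>i=0..<n. Matrix.mat n n (\<lambda>(i, j). F i j) $$ (i, p i)) = (\<Prod>i=0..<n. F i (p i))"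
    if "p permutes {0..<n}" for p
    by (intro prod.cong refl) (use permutes_in_image[OF that] in auto)
  then show ?thesis
    unfolding fdet_def Determinant.det_def by simp
qed

lemma fdet_cong:
  assumes "\<And>i j. i < n \<Longrightarrow> j < n \<Longrightarrow> F i j = G i j"
  shows "fdet n F = fdet n G"
  unfolding fdet_def by (intro arg_cong[of _ _ Determinant.det] eq_matI) (auto simp: assms)

lemma fdet_transpose: "fdet n (\<lambda>i j. F j i) = fdet n F"
proof -
  have "fdet n F = Determinant.det (transpose_mat (Matrix.mat n n (\<lambda>(i, j). F i j)))"
    unfolding fdet_def by (subst Determinant.det_transpose) auto
  also have "\<dots> = fdet n (\<lambda>i j. F j i)"
    unfolding fdet_def by (intro arg_cong[of _ _ Determinant.det] eq_matI) auto
  finally show ?thesis ..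
qed

lemma fdet_permute_rows:
  assumes "p permutes {0..<n}"
  shows "fdet n (\<lambda>i. F (p i)) = signof p * fdet n F"
proof -
  have "fdet n (\<lambda>i. F (p i)) =
      Determinant.det (Matrix.mat n n (\<lambda>(i, j). Matrix.mat n n (\<lambda>(i, j). F i j) $$ (p i, j)))"
    unfolding fdet_def
    by (intro arg_cong[of _ _ Determinant.det] eq_matI) (use permutes_in_image[OF assms] in auto)
  also have "\<dots> = signof p * fdet n F"
    unfolding fdet_def by (rule det_permute_rows[OF _ assms]) auto
  finally show ?thesis .
qed

lemma fdet_identical_rows:
  assumes "i \<noteq> i'" "i < n" "i' < n" "\<And>j. j < n \<Longrightarrow> F i j = F i' j"
  shows "fdet n F = 0"
  unfolding fdet_def by (rule det_identical_rows[OF _ assms(1-3)]) (use assms in auto)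

lemma fdet_mult:
  "fdet n (\<lambda>i j. \<Sum>k=0..<n. A i k * B k j) = fdet n A * fdet n B"
proof -
  have "fdet n A * fdet n B =
      Determinant.det (Matrix.mat n n (\<lambda>(i, j). A i j) * Matrix.mat n n (\<lambda>(i, j). B i j))"
    unfolding fdet_def by (subst det_mult) auto
  also have "\<dots> = fdet n (\<lambda>i j. \<Sum>k=0..<n. A i k * B k j)"
    unfolding fdet_def
    by (intro arg_cong[of _ _ Determinant.det] eq_matI) (auto simp: scalar_prod_def)
  finally show ?thesis ..
qed

lemma fdet_upper_unitriangular:
  assumes "\<And>i. i < n \<Longrightarrow> F i i = 1" "\<And>i j. j < i \<Longrightarrow> i < n \<Longrightarrow> F i j = 0"
  shows "fdet n F = 1"
proof -
  have "fdet n F = prod_list (diag_mat (Matrix.mat n n (\<lambda>(i, j). F i j)))"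
    unfolding fdet_def by (rule det_upper_triangular) (auto simp: assms upper_triangular_def)
  also have "\<dots> = (\<Prod>i=0..<n. 1)"
    unfolding prod_list_diag_prod by (intro prod.cong) (auto simp: assms)
  finally show ?thesis by simp
qed

lemma fdet_lower_unitriangular:
  assumes "\<And>i. i < n \<Longrightarrow> F i i = 1" "\<And>i j. i < j \<Longrightarrow> j < n \<Longrightarrow> F i j = 0"
  shows "fdet n F = 1"
  by (subst fdet_transpose[symmetric], rule fdet_upper_unitriangular) (use assms in auto)

lemma fdet_zero_row:
  assumes "i < n" "\<And>j. j < n \<Longrightarrow> F i j = 0"
  shows "fdet n F = 0"
  unfolding fdet_leibniz
proof (intro sum.neutral ballI)
  fix p assume "p \<in> {p. p permutes {0..<n}}"
  then have "F i (p i) = 0" using assms permutes_in_image[of p "{0..<n}" i] by auto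
  then have "(\<Prod>i=0..<n. F i (p i)) = 0"
    using assms by (intro prod_zero) auto
  then show "signof p * (\<Prod>i=0..<n. F i (p i)) = 0" by simp
qed

text \<open>Multilinearity in the rows, with a separate index set for each row. It later turns rows
  that are short geometric sums into a sum over horizontal strips.\<close>

lemma fdet_rows_sum:
  assumes "\<And>i. i < n \<Longrightarrow> finite (S i)"
  shows "fdet n (\<lambda>i j. \<Sum>b\<in>S i. c i b * F i b j) =
    (\<Sum>b\<in>PiE {0..<n} S. (\<Prod>i=0..<n. c i (b i)) * fdet n (\<lambda>i. F i (b i)))"
proof -
  have "(\<Prod>i=0..<n. \<Sum>b\<in>S i. c i b * F i b (p i)) =
      (\<Sum>b\<in>PiE {0..<n} S. (\<Prod>i=0..<n. c i (b i)) * (\<Prod>i=0..<n. F i (b i) (p i)))" for p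
    by (subst prod_sum_PiE) (auto simp: assms prod.distrib)
  then show ?thesis
    unfolding fdet_leibniz
    by (simp add: sum_distrib_left sum.swap[of _ _ "PiE {0..<n} S"] mult_ac)
qed

lemma fdet_block_diagonal:
  fixes F :: "nat \<Rightarrow> nat \<Rightarrow> 'a::idom"
  assumes "\<And>i j. i < n \<Longrightarrow> n \<le> j \<Longrightarrow> j < n + m \<Longrightarrow> F i j = 0"
  shows "fdet (n + m) F = fdet n F * fdet m (\<lambda>i j. F (n + i) (n + j))"
proof -
  have "fdet (n + m) F = Determinant.det (four_block_mat (Matrix.mat n n (\<lambda>(i, j). F i j))
     (0\<^sub>m n m) (Matrix.mat m n (\<lambda>(i, j). F (n + i) j)) (Matrix.mat m m (\<lambda>(i, j). F (n + i) (n + j))))"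
    unfolding fdet_def
    by (intro arg_cong[of _ _ Determinant.det] eq_matI) (auto simp: assms)
  also have "\<dots> = fdet n F * fdet m (\<lambda>i j. F (n + i) (n + j))"
    unfolding fdet_def by (rule det_four_block_mat_upper_right_zero) auto
  finally show ?thesis .
qed

text \<open>Sylvester's identity det(1 + AB) = det(1 + BA). The block matrix \<open>?M\<close> is a
  block triangular matrix with diagonal blocks 1 + AB and 1 times a unitriangular one, and
  multiplying it by a unitriangular one from the left produces the blocks 1 and 1 + BA. The identity
  trades a determinant of the size of the box for one of the size of the pattern.\<close>

lemma fdet_sylvester:
  fixes A :: "nat \<Rightarrow> nat \<Rightarrow> 'a::idom"
  shows "fdet n (\<lambda>i j. (if i = j then 1 else 0) + (\<Sum>k=0..<m. A i k * B k j)) =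
         fdet m (\<lambda>i j. (if i = j then 1 else 0) + (\<Sum>k=0..<n. B i k * A k j))"
proof -
  let ?A = "Matrix.mat n m (\<lambda>(i, j). A i j)" and ?B = "Matrix.mat m n (\<lambda>(i, j). B i j)"
  have A: "?A \<in> carrier_mat n m" and B: "?B \<in> carrier_mat m n" by auto
  have nB: "- ?B \<in> carrier_mat m n" by auto
  let ?M = "four_block_mat (1\<^sub>m n) ?A (- ?B) (1\<^sub>m m)"
  let ?L = "four_block_mat (1\<^sub>m n) (0\<^sub>m n m) (- ?B) (1\<^sub>m m)"
  let ?L' = "four_block_mat (1\<^sub>m n) (0\<^sub>m n m) ?B (1\<^sub>m m)"
  have dL: "Determinant.det ?L = 1" "Determinant.det ?L' = 1"
    by (subst det_four_block_mat_upper_right_zero; auto)+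
  have 1: "four_block_mat (1\<^sub>m n + ?A * ?B) ?A (0\<^sub>m m n) (1\<^sub>m m) * ?L = ?M"
    by (subst mult_four_block_mat[where ?nr1.0=n and ?nr2.0=m and ?n1.0=n and ?n2.0=m and ?nc1.0=n and ?nc2.0=m])
       (auto intro!: arg_cong[of _ _ "\<lambda>x. four_block_mat x _ _ _"] eq_matI simp: scalar_prod_def sum_negf)
  have 2: "?L' * ?M = four_block_mat (1\<^sub>m n) ?A (0\<^sub>m m n) (1\<^sub>m m + ?B * ?A)"
    by (subst mult_four_block_mat[where ?nr1.0=n and ?nr2.0=m and ?n1.0=n and ?n2.0=m and ?nc1.0=n and ?nc2.0=m])
       (auto intro!: arg_cong2[of _ _ _ _ "\<lambda>x y. four_block_mat _ _ x y"] eq_matI simp: scalar_prod_def)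
  have "Determinant.det (1\<^sub>m n + ?A * ?B) =
      Determinant.det (four_block_mat (1\<^sub>m n + ?A * ?B) ?A (0\<^sub>m m n) (1\<^sub>m m))"
    by (subst det_four_block_mat_lower_left_zero) auto
  also have "\<dots> = Determinant.det ?M"
    by (subst 1[symmetric], subst det_mult[where n = "n + m"]) (auto simp: dL)
  also have "\<dots> = Determinant.det (four_block_mat (1\<^sub>m n) ?A (0\<^sub>m m n) (1\<^sub>m m + ?B * ?A))"
    by (subst 2[symmetric], subst det_mult[where n = "n + m"]) (auto simp: dL)
  also have "\<dots> = Determinant.det (1\<^sub>m m + ?B * ?A)"
    by (subst det_four_block_mat_lower_left_zero) auto
  finally have *: "Determinant.det (1\<^sub>m n + ?A * ?B) = Determinant.det (1\<^sub>m m + ?B * ?A)" .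
  have "1\<^sub>m n + ?A * ?B = Matrix.mat n n (\<lambda>(i,j). (if i = j then 1 else 0) + (\<Sum>k=0..<m. A i k * B k j))"
    by (intro eq_matI) (auto simp: scalar_prod_def)
  moreover have "1\<^sub>m m + ?B * ?A = Matrix.mat m m (\<lambda>(i,j). (if i = j then 1 else 0) + (\<Sum>k=0..<n. B i k * A k j))"
    by (intro eq_matI) (auto simp: scalar_prod_def)
  ultimately show ?thesis using * unfolding fdet_def by simp
qed

lemma fdet_inverse:
  fixes F :: "nat \<Rightarrow> nat \<Rightarrow> 'a::field"
  assumes "fdet n F \<noteq> 0"
  obtains Q where
    "\<And>i j. i < n \<Longrightarrow> j < n \<Longrightarrow> (\<Sum>k=0..<n. F i k * Q k j) = (if i = j then 1 else 0)"
    "\<And>i j. i < n \<Longrightarrow> j < n \<Longrightarrow> (\<Sum>k=0..<n. Q i k * F k j) = (if i = j then 1 else 0)"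
proof -
  let ?F = "Matrix.mat n n (\<lambda>(i, j). F i j)"
  have F: "?F \<in> carrier_mat n n" by auto
  note adj = adj_mat[OF F]
  define Q where "Q i j = adj_mat ?F $$ (i, j) / fdet n F" for i j
  have d: "dim_row (adj_mat ?F) = n" "dim_col (adj_mat ?F) = n" using adj(1) by auto
  have "(\<Sum>k=0..<n. F i k * Q k j) = (if i = j then 1 else 0)" if "i < n" "j < n" for i j
  proof -
    have "(\<Sum>k=0..<n. F i k * adj_mat ?F $$ (k, j)) = (?F * adj_mat ?F) $$ (i, j)"
      using that d by (simp add: scalar_prod_def)
    also have "\<dots> = (if i = j then fdet n F else 0)"
      using that by (subst adj(2)) (simp add: fdet_def)
    finally show ?thesis
      using assms by (simp add: Q_def sum_divide_distrib[symmetric] split: if_splits)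
  qed
  moreover have "(\<Sum>k=0..<n. Q i k * F k j) = (if i = j then 1 else 0)" if "i < n" "j < n" for i j
  proof -
    have "(\<Sum>k=0..<n. adj_mat ?F $$ (i, k) * F k j) = (adj_mat ?F * ?F) $$ (i, j)"
      using that d by (simp add: scalar_prod_def)
    also have "\<dots> = (if i = j then fdet n F else 0)"
      using that by (subst adj(3)) (simp add: fdet_def)
    finally show ?thesis
      using assms by (simp add: Q_def sum_divide_distrib[symmetric] split: if_splits)
  qed
  ultimately show ?thesis using that by blast
qed

lemma signof_mult_self: "(signof p :: 'a::comm_ring_1) * signof p = 1"
  by (simp add: sign_def)

lemma cnj_fdet: "cnj (fdet n F) = fdet n (\<lambda>i j. cnj (F i j))"
  by (simp add: fdet_leibniz)

text \<open>Andreief's identity. After both determinants are expanded, the sum over tuples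
  factorizes over positions; for a fixed p the sum over q is the Gram determinant with rows permuted
  by p. The two signs of p cancel, which leaves n! equal terms.\<close>

lemma fdet_andreief:
  fixes f g :: "nat \<Rightarrow> 'x \<Rightarrow> 'a::comm_ring_1"
  assumes "finite X"
  shows "(\<Sum>a\<in>PiE {0..<n} (\<lambda>_. X). (\<Prod>i=0..<n. w (a i)) *
            (fdet n (\<lambda>i j. f j (a i)) * fdet n (\<lambda>i j. g j (a i)))) =
         of_nat (fact n) * fdet n (\<lambda>j k. \<Sum>x\<in>X. w x * f j x * g k x)"
proof -
  let ?P = "{p. p permutes {0..<n}}" and ?M = "\<lambda>j k. \<Sum>x\<in>X. w x * f j x * g k x"
  let ?E = "PiE {0..<n} (\<lambda>_. X)"
  have "(\<Sum>a\<in>?E. (\<Prod>i=0..<n. w (a i)) * (fdet n (\<lambda>i j. f j (a i)) * fdet n (\<lambda>i j. g j (a i)))) =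
     (\<Sum>a\<in>?E. \<Sum>p\<in>?P. \<Sum>q\<in>?P. signof p * signof q * (\<Prod>i=0..<n. w (a i) * f (p i) (a i) * g (q i) (a i)))"
    unfolding fdet_leibniz sum_product
    by (simp add: sum_distrib_left prod.distrib mult_ac)
  also have "\<dots> = (\<Sum>p\<in>?P. \<Sum>q\<in>?P. signof p * signof q * (\<Sum>a\<in>?E. (\<Prod>i=0..<n. w (a i) * f (p i) (a i) * g (q i) (a i))))"
    by (simp add: sum.swap[of _ _ ?E] sum_distrib_left)
  also have "\<dots> = (\<Sum>p\<in>?P. \<Sum>q\<in>?P. signof p * signof q * (\<Prod>i=0..<n. ?M (p i) (q i)))"
    by (subst prod_sum_PiE[symmetric]) (auto simp: assms)
  also have "\<dots> = (\<Sum>p\<in>?P. signof p * fdet n (\<lambda>i. ?M (p i)))"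
    unfolding fdet_leibniz by (simp add: sum_distrib_left mult_ac)
  also have "\<dots> = (\<Sum>p\<in>?P. signof p * (signof p * fdet n ?M))"
    by (intro sum.cong refl arg_cong2[of _ _ _ _ "(*)"] fdet_permute_rows) auto
  also have "\<dots> = of_nat (card ?P) * fdet n ?M"
    by (simp add: mult.assoc[symmetric] signof_mult_self)
  also have "card ?P = fact n" by (simp add: card_permutations)
  finally show ?thesis .
qed

lemma tendsto_fdet [tendsto_intros]:
  fixes f :: "'b \<Rightarrow> nat \<Rightarrow> nat \<Rightarrow> complex"
  assumes "\<And>i j. i < n \<Longrightarrow> j < n \<Longrightarrow> ((\<lambda>x. f x i j) \<longlongrightarrow> g i j) F"
  shows "((\<lambda>x. fdet n (f x)) \<longlongrightarrow> fdet n g) F"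
  unfolding fdet_leibniz
proof (intro tendsto_sum tendsto_mult tendsto_const tendsto_prod)
  fix p i assume "p \<in> {p. p permutes {0..<n}}" "i \<in> {0..<n}"
  then show "((\<lambda>x. f x i (p i)) \<longlongrightarrow> g i (p i)) F"
    using assms[of i "p i"] permutes_in_image[of p "{0..<n}" i] by auto
qed

lemma norm_signof: "norm (signof p :: complex) = 1"
  by (simp add: sign_def)

text \<open>Permutations are among the maps of {0..<n} to itself, and the sum over all maps
  factorizes into row sums. For matrices close to the identity this product stays bounded as n
  grows, which an estimate with a factor n! would not give.\<close>

lemma norm_fdet_le_row_sums:
  fixes F :: "nat \<Rightarrow> nat \<Rightarrow> complex"
  shows "norm (fdet n F) \<le> (\<Prod>i=0..<n. \<Sum>j=0..<n. norm (F i j))"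
proof -
  have "norm (fdet n F) \<le> (\<Sum>p | p permutes {0..<n}. \<Prod>i=0..<n. norm (F i (p i)))"
    unfolding fdet_leibniz
    by (rule order.trans[OF norm_sum]) (simp add: norm_mult norm_signof prod_norm del: norm_of_int)
  \<comment> \<open>Permutations are the identity outside {0..<n} while elements of
    \<open>PiE\<close> are \<open>undefined\<close> there, so they have to be restricted before the
    index sets can be compared.\<close>
  also have "\<dots> = (\<Sum>p\<in>(\<lambda>p. restrict p {0..<n}) ` {p. p permutes {0..<n}}. \<Prod>i=0..<n. norm (F i (p i)))"
  proof (subst sum.reindex)
    show "inj_on (\<lambda>p. restrict p {0..<n}) {p. p permutes {0..<n}}"
    proof (rule inj_onI, rule ext)
      fix p q x assume pq: "p \<in> {p. p permutes {0..<n}}" "q \<in> {p. p permutes {0..<n}}"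
        "restrict p {0..<n} = restrict q {0..<n}"
      show "p x = q x"
      proof (cases "x \<in> {0..<n}")
        case True
        have "restrict p {0..<n} x = restrict q {0..<n} x" by (simp only: pq(3))
        then show ?thesis using True by (simp only: restrict_apply if_True)
      next
        case False
        have "p x = x" "q x = x"
          by (rule permutes_not_in[OF _ False], use pq in blast)+
        then show ?thesis by (rule trans[OF _ sym])
      qed
    qed
  qed simp
  also have "\<dots> \<le> (\<Sum>p\<in>PiE {0..<n} (\<lambda>_. {0..<n}). \<Prod>i=0..<n. norm (F i (p i)))"
  proof (rule sum_mono2)
    show "(\<lambda>p. restrict p {0..<n}) ` {p. p permutes {0..<n}} \<subseteq> PiE {0..<n} (\<lambda>_. {0..<n})"
    proof (rule image_subsetI)
      fix p assume "p \<in> {p. p permutes {0..<n}}"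
      then show "restrict p {0..<n} \<in> PiE {0..<n} (\<lambda>_. {0..<n})"
        using permutes_in_image[of p "{0..<n}"] by auto
    qed
  qed (auto intro!: finite_PiE prod_nonneg)
  also have "\<dots> = (\<Prod>i=0..<n. \<Sum>j=0..<n. norm (F i j))"
    by (subst prod_sum_PiE) auto
  finally show ?thesis .
qed

text \<open>Products of entries in the unit disc differ by at most the sum of the differences of
  their factors, for each of the n! permutations.\<close>

lemma norm_fdet_diff_le:
  fixes F G :: "nat \<Rightarrow> nat \<Rightarrow> complex"
  assumes "\<And>i j. i < n \<Longrightarrow> j < n \<Longrightarrow> norm (F i j) \<le> 1" "\<And>i j. i < n \<Longrightarrow> j < n \<Longrightarrow> norm (G i j) \<le> 1"
  shows "norm (fdet n F - fdet n G) \<le> fact n * (\<Sum>i=0..<n. \<Sum>j=0..<n. norm (F i j - G i j))"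
proof -
  let ?P = "{p. p permutes {0..<n}}"
  have "norm (fdet n F - fdet n G) \<le> (\<Sum>p\<in>?P. norm ((\<Prod>i=0..<n. F i (p i)) - (\<Prod>i=0..<n. G i (p i))))"
    unfolding fdet_leibniz sum_subtractf[symmetric] right_diff_distrib[symmetric]
    by (rule order.trans[OF norm_sum]) (simp add: norm_mult norm_signof del: norm_of_int)
  also have "\<dots> \<le> (\<Sum>p\<in>?P. \<Sum>i=0..<n. \<Sum>j=0..<n. norm (F i j - G i j))"
  proof (rule sum_mono)
    fix p assume p: "p \<in> ?P"
    have "norm ((\<Prod>i=0..<n. F i (p i)) - (\<Prod>i=0..<n. G i (p i))) \<le> (\<Sum>i=0..<n. norm (F i (p i) - G i (p i)))"
      using assms permutes_in_image[of p "{0..<n}"] p by (intro norm_prod_diff) auto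
    also have "\<dots> \<le> (\<Sum>i=0..<n. \<Sum>j=0..<n. norm (F i j - G i j))"
      using permutes_in_image[of p "{0..<n}"] p
      by (intro sum_mono member_le_sum[of _ _ "\<lambda>j. norm (F _ j - G _ j)"]) auto
    finally show "norm ((\<Prod>i=0..<n. F i (p i)) - (\<Prod>i=0..<n. G i (p i))) \<le> \<dots>" .
  qed
  also have "\<dots> = fact n * (\<Sum>i=0..<n. \<Sum>j=0..<n. norm (F i j - G i j))"
    by (simp add: card_permutations)
  finally show ?thesis .
qed

section \<open>Complete symmetric functions and specializations\<close>

lemma lookup_map_key: "bij \<pi> \<Longrightarrow> Poly_Mapping.lookup (Poly_Mapping.map_key \<pi> \<mu>) i = Poly_Mapping.lookup \<mu> (\<pi> i)"
  by (simp add: Poly_Mapping.map_key.rep_eq bij_is_inj)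

lemma mdegree_superset:
  assumes "finite A" "Poly_Mapping.keys \<mu> \<subseteq> A"
  shows "mdegree \<mu> = (\<Sum>i\<in>A. Poly_Mapping.lookup \<mu> i)"
  unfolding mdegree_def by (rule sum.mono_neutral_left) (use assms in \<open>auto simp: in_keys_iff\<close>)

lemma keys_add_nat:
  "Poly_Mapping.keys (\<mu> + \<nu>) = Poly_Mapping.keys \<mu> \<union> Poly_Mapping.keys (\<nu> :: nat \<Rightarrow>\<^sub>0 nat)"
  by (auto simp: in_keys_iff lookup_add)

lemma mdegree_add: "mdegree (\<mu> + \<nu>) = mdegree \<mu> + mdegree \<nu>"
proof -
  let ?A = "Poly_Mapping.keys \<mu> \<union> Poly_Mapping.keys \<nu>"
  have "mdegree (\<mu> + \<nu>) = (\<Sum>i\<in>?A. Poly_Mapping.lookup (\<mu> + \<nu>) i)"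
    by (rule mdegree_superset) (auto simp: keys_add_nat)
  moreover have "mdegree \<mu> = (\<Sum>i\<in>?A. Poly_Mapping.lookup \<mu> i)" "mdegree \<nu> = (\<Sum>i\<in>?A. Poly_Mapping.lookup \<nu> i)"
    by (rule mdegree_superset; auto)+
  ultimately show ?thesis by (simp add: lookup_add sum.distrib)
qed

lemma mdegree_single [simp]: "mdegree (Poly_Mapping.single i k) = k"
  by (subst mdegree_superset[of "{i}"]) (auto simp: keys_single)

lemma mdegree_0 [simp]: "mdegree 0 = 0"
  by (simp add: mdegree_def)

lemma mdegree_eq_0_iff: "mdegree \<mu> = 0 \<longleftrightarrow> \<mu> = 0"
proof
  assume "mdegree \<mu> = 0"
  then show "\<mu> = 0"
    by (intro poly_mapping_eqI) (auto simp: mdegree_def in_keys_iff)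
qed simp

lemma mdegree_map_key:
  assumes "bij \<pi>"
  shows "mdegree (Poly_Mapping.map_key \<pi> \<mu>) = mdegree \<mu>"
proof -
  have "bij_betw \<pi> (\<pi> -` Poly_Mapping.keys \<mu>) (Poly_Mapping.keys \<mu>)"
    using assms by (metis bij_betw_imageI bij_def inj_on_subset subset_UNIV surj_image_vimage_eq)
  then show ?thesis
    unfolding mdegree_def
    using sum.reindex_bij_betw[of \<pi> "\<pi> -` Poly_Mapping.keys \<mu>" "Poly_Mapping.keys \<mu>" "Poly_Mapping.lookup \<mu>"]
    by (simp add: keys_map_key bij_is_inj[OF assms] lookup_map_key[OF assms])
qed

text \<open>The complete homogeneous symmetric function h_n: every monomial of degree n has
  coefficient 1.\<close>

definition hsym :: "nat \<Rightarrow> series" where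
  "hsym n \<mu> = (if mdegree \<mu> = n then 1 else 0)"

lemma hsym_sym: "hsym n \<in> sym_funs"
  unfolding sym_funs_def hsym_def by (auto simp: mdegree_map_key)

lemma hsym_0: "hsym 0 = ser_one"
  by (auto simp: hsym_def ser_one_def mdegree_eq_0_iff)

lemma map_key_map_key_inv:
  fixes \<pi> :: "'a \<Rightarrow> 'a"
  assumes "bij \<pi>"
  shows "Poly_Mapping.map_key \<pi> (Poly_Mapping.map_key (inv_into UNIV \<pi>) \<mu>) = \<mu>"
    "Poly_Mapping.map_key (inv_into UNIV \<pi>) (Poly_Mapping.map_key \<pi> \<mu>) = \<mu>"
  by (rule poly_mapping_eqI, simp add: lookup_map_key assms bij_imp_bij_inv bij_is_inj bij_is_surj surj_f_inv_f)+

lemma power_sum_sym: "power_sum k \<in> sym_funs"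
proof -
  have *: "\<exists>i. \<mu> = Poly_Mapping.single i k" 
    if "bij \<pi>" "Poly_Mapping.map_key \<pi> \<mu> = Poly_Mapping.single i k" for \<pi> :: "nat \<Rightarrow> nat" and \<mu> i
  proof -
    have "\<mu> = Poly_Mapping.map_key (inv_into UNIV \<pi>) (Poly_Mapping.single i k)"
      using that map_key_map_key_inv(2)[of \<pi> \<mu>] by simp
    also have "\<dots> = Poly_Mapping.single (\<pi> i) k"
      using that by (intro poly_mapping_eqI)
        (auto simp: lookup_map_key bij_imp_bij_inv lookup_single when_def bij_inv_eq_iff)
    finally show ?thesis by blast
  qed
  have "\<exists>i. Poly_Mapping.map_key \<pi> (Poly_Mapping.single j k) = Poly_Mapping.single i k" if "bij \<pi>" for \<pi> :: "nat \<Rightarrow> nat" and j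
    using *[of "inv_into UNIV \<pi>" "Poly_Mapping.map_key \<pi> (Poly_Mapping.single j k)" j] that
    by (simp add: map_key_map_key_inv bij_imp_bij_inv)
  then have "(\<exists>i. Poly_Mapping.map_key \<pi> \<mu> = Poly_Mapping.single i k) \<longleftrightarrow> (\<exists>i. \<mu> = Poly_Mapping.single i k)"
    if "bij \<pi>" for \<pi> :: "nat \<Rightarrow> nat" and \<mu>
    using * that by auto
  then have "power_sum k (Poly_Mapping.map_key \<pi> \<mu>) = power_sum k \<mu>"
    if "bij \<pi>" for \<pi> :: "nat \<Rightarrow> nat" and \<mu>
    unfolding power_sum_def by (simp only: that)
  moreover have "\<forall>\<mu>. power_sum k \<mu> \<noteq> 0 \<longrightarrow> mdegree \<mu> \<le> k"
    by (auto simp: power_sum_def)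
  ultimately show ?thesis unfolding sym_funs_def by blast
qed

lemma sym_funsI:
  assumes "\<And>\<mu>. F \<mu> \<noteq> 0 \<Longrightarrow> mdegree \<mu> \<le> d"
    "\<And>\<pi> \<mu>. bij \<pi> \<Longrightarrow> F (Poly_Mapping.map_key \<pi> \<mu>) = F \<mu>"
  shows "F \<in> sym_funs"
  using assms unfolding sym_funs_def by blast

lemma sym_funs_degree:
  assumes "F \<in> sym_funs"
  shows "\<exists>d. \<forall>\<mu>. F \<mu> \<noteq> 0 \<longrightarrow> mdegree \<mu> \<le> d"
  using assms unfolding sym_funs_def by blast

lemma sym_funs_map_key:
  assumes "F \<in> sym_funs" "bij \<pi>"
  shows "F (Poly_Mapping.map_key \<pi> \<mu>) = F \<mu>"
  using assms unfolding sym_funs_def by blast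

lemma ser_mult_degree:
  assumes d: "\<forall>\<mu>. F \<mu> \<noteq> 0 \<longrightarrow> mdegree \<mu> \<le> d" and e: "\<forall>\<mu>. H \<mu> \<noteq> 0 \<longrightarrow> mdegree \<mu> \<le> e"
  and "ser_mult F H \<mu> \<noteq> 0"
  shows "mdegree \<mu> \<le> d + e"
proof -
  have "\<not> (\<forall>x\<in>{(\<nu>, \<kappa>). \<nu> + \<kappa> = \<mu>}. (case x of (\<nu>, \<kappa>) \<Rightarrow> F \<nu> * H \<kappa>) = 0)"
    using assms(3) sum.neutral unfolding ser_mult_def by blast
  then obtain \<nu> \<kappa> where "\<mu> = \<nu> + \<kappa>" "F \<nu> \<noteq> 0" "H \<kappa> \<noteq> 0" by auto
  then show ?thesis using spec[OF d, of \<nu>] spec[OF e, of \<kappa>] by (simp add: mdegree_add)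
qed

lemma ser_mult_sym:
  assumes "F \<in> sym_funs" "H \<in> sym_funs"
  shows "ser_mult F H \<in> sym_funs"
proof -
  have "\<exists>d. \<forall>\<mu>. ser_mult F H \<mu> \<noteq> 0 \<longrightarrow> mdegree \<mu> \<le> d"
    using sym_funs_degree[OF assms(1)] sym_funs_degree[OF assms(2)] ser_mult_degree by metis
  moreover have "ser_mult F H (Poly_Mapping.map_key \<pi> \<mu>) = ser_mult F H \<mu>" if \<pi>: "bij \<pi>" for \<pi> \<mu>
  proof -
    let ?k = "Poly_Mapping.map_key \<pi> :: (nat \<Rightarrow>\<^sub>0 nat) \<Rightarrow> _" and ?l = "Poly_Mapping.map_key (inv_into UNIV \<pi>) :: (nat \<Rightarrow>\<^sub>0 nat) \<Rightarrow> _"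
    have i: "inj \<pi>" "inj (inv_into UNIV \<pi>)" using \<pi> by (simp_all add: bij_is_inj bij_imp_bij_inv)
    have "(\<Sum>(\<nu>, \<kappa>) | \<nu> + \<kappa> = \<mu>. F \<nu> * H \<kappa>) = (\<Sum>(\<nu>, \<kappa>) | \<nu> + \<kappa> = ?k \<mu>. F \<nu> * H \<kappa>)"
    proof (rule sum.reindex_bij_witness[of _ "\<lambda>(a, b). (?l a, ?l b)" "\<lambda>(a, b). (?k a, ?k b)"], goal_cases)
      case (1 a) then show ?case by (auto simp: map_key_map_key_inv[OF \<pi>])
    next
      case (2 a) then show ?case by (auto simp: map_key_plus[OF i(1), symmetric])
    next
      case (3 a) then show ?case by (auto simp: map_key_map_key_inv[OF \<pi>])
    next
      case (4 a) then show ?case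
        by (auto simp: map_key_plus[OF i(2), symmetric] map_key_map_key_inv[OF \<pi>])
    next
      case (5 a)
      have "F (?k \<nu>) = F \<nu>" "H (?k \<nu>) = H \<nu>" for \<nu> using assms \<pi> by (auto intro: sym_funs_map_key)
      then show ?case by (cases a) simp
    qed
    then show ?thesis by (simp add: ser_mult_def)
  qed
  ultimately show ?thesis unfolding sym_funs_def by blast
qed

lemma sum_series_sym:
  assumes "\<And>a. a \<in> A \<Longrightarrow> F a \<in> sym_funs"
  shows "(\<lambda>\<mu>. \<Sum>a\<in>A. c a * F a \<mu>) \<in> sym_funs"
proof (cases "finite A")
  case True
  have "\<forall>a\<in>A. \<exists>d. \<forall>\<mu>. F a \<mu> \<noteq> 0 \<longrightarrow> mdegree \<mu> \<le> d"
    using assms by (intro ballI sym_funs_degree)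
  then obtain d where "\<forall>a\<in>A. \<forall>\<mu>. F a \<mu> \<noteq> 0 \<longrightarrow> mdegree \<mu> \<le> d a"
    by (rule bchoice[THEN exE])
  then have d: "\<And>a \<mu>. a \<in> A \<Longrightarrow> F a \<mu> \<noteq> 0 \<Longrightarrow> mdegree \<mu> \<le> d a" by blast
  have "mdegree \<mu> \<le> (\<Sum>a\<in>A. d a)" if "(\<Sum>a\<in>A. c a * F a \<mu>) \<noteq> 0" for \<mu>
  proof -
    obtain a where "a \<in> A" "c a * F a \<mu> \<noteq> 0" using \<open>(\<Sum>a\<in>A. c a * F a \<mu>) \<noteq> 0\<close> by (meson sum.neutral)
    then have "mdegree \<mu> \<le> d a" using d by auto
    also have "\<dots> \<le> (\<Sum>a\<in>A. d a)" using \<open>a \<in> A\<close> True by (intro member_le_sum) auto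
    finally show ?thesis .
  qed
  moreover have "(\<Sum>a\<in>A. c a * F a (Poly_Mapping.map_key \<pi> \<mu>)) = (\<Sum>a\<in>A. c a * F a \<mu>)" if "bij \<pi>" for \<pi> \<mu>
    using assms that by (intro sum.cong) (auto simp: sym_funs_map_key)
  ultimately show ?thesis by (rule sym_funsI)
qed (auto simp: sym_funs_def)

lemma ser_one_sym: "ser_one \<in> sym_funs"
  using hsym_sym[of 0] by (simp add: hsym_0)

lemma spec_sum:
  assumes \<rho>: "specialization \<rho>" and "finite A" "\<And>a. a \<in> A \<Longrightarrow> F a \<in> sym_funs"
  shows "\<rho> (\<lambda>\<mu>. \<Sum>a\<in>A. c a * F a \<mu>) = (\<Sum>a\<in>A. c a * \<rho> (F a))"
  using assms(2,3)
proof (induction A rule: finite_induct)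
  case empty
  have "(\<lambda>\<mu>. 0) = ser_scale 0 ser_one" by (auto simp: ser_scale_def)
  then have "\<rho> (\<lambda>\<mu>. 0) = 0" using \<rho> ser_one_sym unfolding specialization_def by (metis mult_zero_left)
  then show ?case by simp
next
  case (insert a A)
  have 1: "(\<lambda>\<mu>. \<Sum>a\<in>insert a A. c a * F a \<mu>) = ser_add (ser_scale (c a) (F a)) (\<lambda>\<mu>. \<Sum>a\<in>A. c a * F a \<mu>)"
    using insert by (auto simp: ser_add_def ser_scale_def)
  have 2: "ser_scale (c a) (F a) = (\<lambda>\<mu>. \<Sum>a\<in>{a}. c a * F a \<mu>)" by (auto simp: ser_scale_def)
  have 3: "ser_scale (c a) (F a) \<in> sym_funs" unfolding 2 by (rule sum_series_sym) (use insert in auto)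
  show ?case unfolding 1
    using \<rho> insert 3 sum_series_sym[of A F c] unfolding specialization_def by simp
qed

lemma spec_mult:
  "specialization \<rho> \<Longrightarrow> F \<in> sym_funs \<Longrightarrow> H \<in> sym_funs \<Longrightarrow> \<rho> (ser_mult F H) = \<rho> F * \<rho> H"
  unfolding specialization_def by blast

text \<open>Only splittings whose first part is some \<open>single i k\<close> contribute, one for
  each admissible i. They are distinct because k >= 1; for k = 0 all \<open>single i k\<close> would
  coincide.\<close>

lemma ser_mult_power_sum:
  assumes "k \<ge> 1"
  shows "ser_mult (power_sum k) F \<mu> =
    (\<Sum>i | k \<le> Poly_Mapping.lookup \<mu> i. F (\<mu> - Poly_Mapping.single i k))"
proof -
  let ?s = "\<lambda>i. Poly_Mapping.single i k :: nat \<Rightarrow>\<^sub>0 nat"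
  let ?I = "{i. k \<le> Poly_Mapping.lookup \<mu> i}"
  let ?T = "(\<lambda>i. (?s i, \<mu> - ?s i)) ` ?I"
  have id: "?s i + (\<mu> - ?s i) = \<mu>" if "i \<in> ?I" for i
    using that by (intro poly_mapping_eqI) (auto simp: lookup_add lookup_minus lookup_single when_def)
  have "ser_mult (power_sum k) F \<mu> = (\<Sum>(\<nu>, \<kappa>)\<in>?T. power_sum k \<nu> * F \<kappa>)"
    unfolding ser_mult_def
  proof (rule sum.mono_neutral_right)
    show "finite {(\<nu>, \<kappa>). \<nu> + \<kappa> = \<mu>}" by (rule finite_splits)
    show "?T \<subseteq> {(\<nu>, \<kappa>). \<nu> + \<kappa> = \<mu>}" using id by auto
    show "\<forall>x\<in>{(\<nu>, \<kappa>). \<nu> + \<kappa> = \<mu>} - ?T. (case x of (\<nu>, \<kappa>) \<Rightarrow> power_sum k \<nu> * F \<kappa>) = 0"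
    proof (rule ballI, clarsimp simp: power_sum_def)
      fix i \<kappa> assume "(?s i, \<kappa>) \<notin> (\<lambda>j. (?s j, ?s i + \<kappa> - ?s j)) ` {j. k \<le> Poly_Mapping.lookup (?s i + \<kappa>) j}"
      moreover have "(?s i, \<kappa>) \<in> (\<lambda>j. (?s j, ?s i + \<kappa> - ?s j)) ` {j. k \<le> Poly_Mapping.lookup (?s i + \<kappa>) j}"
        by (rule image_eqI[of _ _ i]) (auto simp: lookup_add)
      ultimately show "F \<kappa> = 0" by blast
    qed
  qed
  also have "\<dots> = (\<Sum>i\<in>?I. F (\<mu> - ?s i))"
    (is "?L = ?R")
  proof (subst sum.reindex)
    show "inj_on (\<lambda>i. (?s i, \<mu> - ?s i)) ?I"
    proof (rule inj_onI)
      fix i j assume "(?s i, \<mu> - ?s i) = (?s j, \<mu> - ?s j)"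
      then have "Poly_Mapping.keys (?s i) = Poly_Mapping.keys (?s j)" by simp
      then show "i = j" using assms by simp
    qed
    have "power_sum k (?s i) = 1" for i by (auto simp: power_sum_def)
    then show "sum ((\<lambda>(\<nu>, \<kappa>). power_sum k \<nu> * F \<kappa>) \<circ> (\<lambda>i. (?s i, \<mu> - ?s i))) ?I = ?R"
      by simp
  qed
  finally show ?thesis .
qed

text \<open>Newton's identity. In the sum, the coefficient of a monomial of degree n counts the
  pairs (i, k) where 1 <= k <= exponent of the variable i, and there are n such pairs.\<close>

lemma hsym_newton:
  "(\<Sum>k=1..n. ser_mult (power_sum k) (hsym (n - k)) \<mu>) = of_nat n * hsym n \<mu>"
proof -
  let ?K = "Poly_Mapping.keys \<mu>"
  have 1: "ser_mult (power_sum k) (hsym (n - k)) \<mu> =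
      (\<Sum>i\<in>?K. if k \<le> Poly_Mapping.lookup \<mu> i \<and> mdegree \<mu> = n then 1 else 0)" if "k \<in> {1..n}" for k
  proof -
    have "hsym (n - k) (\<mu> - Poly_Mapping.single i k) = (if mdegree \<mu> = n then 1 else 0)"
      if "k \<le> Poly_Mapping.lookup \<mu> i" for i
    proof -
      have "\<mu> = (\<mu> - Poly_Mapping.single i k) + Poly_Mapping.single i k"
        using that by (intro poly_mapping_eqI) (auto simp: lookup_add lookup_minus lookup_single when_def)
      then have "mdegree \<mu> = mdegree (\<mu> - Poly_Mapping.single i k) + k"
        by (metis mdegree_add mdegree_single)
      then show ?thesis using \<open>k \<in> {1..n}\<close> by (auto simp: hsym_def)
    qed
    then have "ser_mult (power_sum k) (hsym (n - k)) \<mu> =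
        (\<Sum>i | k \<le> Poly_Mapping.lookup \<mu> i. if mdegree \<mu> = n then 1 else 0)"
      using that by (subst ser_mult_power_sum) (auto intro!: sum.cong)
    also have "\<dots> = (\<Sum>i\<in>?K. if k \<le> Poly_Mapping.lookup \<mu> i \<and> mdegree \<mu> = n then 1 else 0)"
      using that by (intro sum.mono_neutral_cong_left) (auto simp: in_keys_iff)
    finally show ?thesis .
  qed
  have "(\<Sum>k=1..n. ser_mult (power_sum k) (hsym (n - k)) \<mu>) =
      (\<Sum>k=1..n. \<Sum>i\<in>?K. if k \<le> Poly_Mapping.lookup \<mu> i \<and> mdegree \<mu> = n then 1 else 0)"
    by (intro sum.cong refl 1)
  also have "\<dots> = (\<Sum>i\<in>?K. \<Sum>k=1..n. if k \<le> Poly_Mapping.lookup \<mu> i \<and> mdegree \<mu> = n then 1 else 0)"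
    by (rule sum.swap)
  also have "\<dots> = (\<Sum>i\<in>?K. if mdegree \<mu> = n then of_nat (Poly_Mapping.lookup \<mu> i) else 0)"
  proof (intro sum.cong refl)
    fix i assume i: "i \<in> ?K"
    have "Poly_Mapping.lookup \<mu> i \<le> n" if "mdegree \<mu> = n"
      unfolding that[symmetric] mdegree_def using i by (intro member_le_sum) auto
    then have "{1..n} \<inter> {k. k \<le> Poly_Mapping.lookup \<mu> i} = {1..Poly_Mapping.lookup \<mu> i}" if "mdegree \<mu> = n"
      using that by auto
    then show "(\<Sum>k=1..n. if k \<le> Poly_Mapping.lookup \<mu> i \<and> mdegree \<mu> = n then 1 else (0::complex)) =
        (if mdegree \<mu> = n then of_nat (Poly_Mapping.lookup \<mu> i) else 0)"
      by (simp add: sum.If_cases)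
  qed
  also have "\<dots> = of_nat n * hsym n \<mu>"
    by (auto simp: hsym_def mdegree_def)
  finally show ?thesis .
qed

text \<open>The specializations \<rho>s are prescribed on power sums only. This recursion determines
  their values on the h_n and thus, by Jacobi-Trudi, on all Schur functions.\<close>

lemma spec_newton:
  assumes "specialization \<rho>"
  shows "of_nat n * \<rho> (hsym n) = (\<Sum>k=1..n. \<rho> (power_sum k) * \<rho> (hsym (n - k)))"
proof -
  have "(\<lambda>\<mu>. \<Sum>k=1..n. 1 * ser_mult (power_sum k) (hsym (n - k)) \<mu>) = ser_scale (of_nat n) (hsym n)"
    using hsym_newton by (auto simp: ser_scale_def)
  moreover have "\<rho> (ser_scale (of_nat n) (hsym n)) = of_nat n * \<rho> (hsym n)"
    using assms hsym_sym unfolding specialization_def by blast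
  moreover have "\<rho> (\<lambda>\<mu>. \<Sum>k=1..n. 1 * ser_mult (power_sum k) (hsym (n - k)) \<mu>) =
      (\<Sum>k=1..n. 1 * \<rho> (ser_mult (power_sum k) (hsym (n - k))))"
    using assms by (rule spec_sum) (auto intro: ser_mult_sym hsym_sym power_sum_sym)
  ultimately show ?thesis
    using assms by (simp add: spec_mult hsym_sym power_sum_sym)
qed

section \<open>Products of series and their truncations to polynomials, where determinants are
  available\<close>

definition ser_prod :: "series list \<Rightarrow> series" where
  "ser_prod xs = foldr ser_mult xs ser_one"

lemma ser_prod_sym: "set xs \<subseteq> sym_funs \<Longrightarrow> ser_prod xs \<in> sym_funs"
  by (induction xs) (auto simp: ser_prod_def ser_one_sym ser_mult_sym)

lemma spec_ser_prod:
  assumes "specialization \<rho>" "set xs \<subseteq> sym_funs"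
  shows "\<rho> (ser_prod xs) = prod_list (map \<rho> xs)"
  using assms(2)
proof (induction xs)
  case Nil
  then show ?case using assms(1) by (simp add: ser_prod_def specialization_def)
next
  case (Cons F xs)
  then show ?case
    using ser_prod_sym[of xs] by (simp add: ser_prod_def spec_mult[OF assms(1)])
qed

text \<open>\<open>f\<close> is the image of the series \<open>F\<close> when all variables but the first \<open>n\<close> are set to \<open>0\<close>.\<close>

definition truncates :: "nat \<Rightarrow> series \<Rightarrow> ((nat \<Rightarrow>\<^sub>0 nat) \<Rightarrow>\<^sub>0 complex) \<Rightarrow> bool" where
  "truncates n F f \<longleftrightarrow> (\<forall>\<mu>. Poly_Mapping.lookup f \<mu> = (if Poly_Mapping.keys \<mu> \<subseteq> {..<n} then F \<mu> else 0))"

lemma lookup_mult_splits: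
  fixes f g :: "(nat \<Rightarrow>\<^sub>0 nat) \<Rightarrow>\<^sub>0 complex"
  shows "Poly_Mapping.lookup (f * g) \<mu> =
    (\<Sum>(\<nu>, \<kappa>) | \<nu> + \<kappa> = \<mu>. Poly_Mapping.lookup f \<nu> * Poly_Mapping.lookup g \<kappa>)"
proof -
  have "Poly_Mapping.lookup (f * g) \<mu> =
      (\<Sum>(\<nu>, \<kappa>). Poly_Mapping.lookup f \<nu> * Poly_Mapping.lookup g \<kappa> when \<mu> = \<nu> + \<kappa>)"
    by (simp add: times_poly_mapping.rep_eq prod_fun_unfold_prod)
  also have "\<dots> = (\<Sum>(\<nu>, \<kappa>) | \<nu> + \<kappa> = \<mu>. Poly_Mapping.lookup f \<nu> * Poly_Mapping.lookup g \<kappa> when \<mu> = \<nu> + \<kappa>)"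
    by (rule Sum_any.expand_superset[OF finite_splits]) auto
  also have "\<dots> = (\<Sum>(\<nu>, \<kappa>) | \<nu> + \<kappa> = \<mu>. Poly_Mapping.lookup f \<nu> * Poly_Mapping.lookup g \<kappa>)"
    by (intro sum.cong) auto
  finally show ?thesis .
qed

lemma truncates_mult:
  assumes "truncates n F f" "truncates n H h"
  shows "truncates n (ser_mult F H) (f * h)"
  unfolding truncates_def
proof
  fix \<mu>
  have "(\<Sum>(\<nu>, \<kappa>) | \<nu> + \<kappa> = \<mu>. Poly_Mapping.lookup f \<nu> * Poly_Mapping.lookup h \<kappa>) =
      (\<Sum>(\<nu>, \<kappa>) | \<nu> + \<kappa> = \<mu>. if Poly_Mapping.keys \<mu> \<subseteq> {..<n} then F \<nu> * H \<kappa> else 0)"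
    using assms unfolding truncates_def by (intro sum.cong) (auto simp: keys_add_nat)
  then show "Poly_Mapping.lookup (f * h) \<mu> = (if Poly_Mapping.keys \<mu> \<subseteq> {..<n} then ser_mult F H \<mu> else 0)"
    by (auto simp: lookup_mult_splits ser_mult_def intro!: sum.neutral)
qed

lemma truncates_ser_prod:
  assumes "\<And>i. i \<in> set xs \<Longrightarrow> truncates n (F i) (f i)"
  shows "truncates n (ser_prod (map F xs)) (prod_list (map f xs))"
  using assms
proof (induction xs)
  case Nil
  show ?case by (auto simp: truncates_def ser_prod_def lookup_one ser_one_def when_def)
next
  case (Cons a xs)
  then have "truncates n (ser_mult (F a) (ser_prod (map F xs))) (f a * prod_list (map f xs))"
    by (intro truncates_mult) auto
  then show ?case by (simp add: ser_prod_def)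
qed

text \<open>The complete homogeneous polynomial h_r in the variables with index below n. The
  recursion separates the monomials without the last variable from those divisible by it; the same
  recursion drives \<open>jacobi_trudi_branching\<close>.\<close>

fun hpoly :: "nat \<Rightarrow> nat \<Rightarrow> (nat \<Rightarrow>\<^sub>0 nat) \<Rightarrow>\<^sub>0 complex" where
  "hpoly 0 r = (if r = 0 then 1 else 0)"
| "hpoly (Suc n) 0 = 1"
| "hpoly (Suc n) (Suc r) = hpoly n (Suc r) + Poly_Mapping.single (Poly_Mapping.single n 1) 1 * hpoly (Suc n) r"

lemma lookup_monomial_mult:
  fixes f :: "(nat \<Rightarrow>\<^sub>0 nat) \<Rightarrow>\<^sub>0 complex"
  shows "Poly_Mapping.lookup (Poly_Mapping.single (Poly_Mapping.single i k) 1 * f) \<mu> =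
    (if k \<le> Poly_Mapping.lookup \<mu> i then Poly_Mapping.lookup f (\<mu> - Poly_Mapping.single i k) else 0)"
proof -
  let ?s = "Poly_Mapping.single i k"
  have eq: "\<nu> + \<kappa> = \<mu> \<Longrightarrow> \<nu> = ?s \<Longrightarrow> k \<le> Poly_Mapping.lookup \<mu> i \<and> \<kappa> = \<mu> - ?s" for \<nu> \<kappa>
    by (auto simp: lookup_add)
  have id: "?s + (\<mu> - ?s) = \<mu>" if "k \<le> Poly_Mapping.lookup \<mu> i"
    using that by (intro poly_mapping_eqI) (auto simp: lookup_add lookup_minus lookup_single when_def)
  have "Poly_Mapping.lookup (Poly_Mapping.single ?s 1 * f) \<mu> =
      (\<Sum>(\<nu>, \<kappa>)\<in>(if k \<le> Poly_Mapping.lookup \<mu> i then {(?s, \<mu> - ?s)} else {}).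
        Poly_Mapping.lookup (Poly_Mapping.single ?s 1) \<nu> * Poly_Mapping.lookup f \<kappa>)"
    unfolding lookup_mult_splits
  proof (rule sum.mono_neutral_right[OF finite_splits])
    show "(if k \<le> Poly_Mapping.lookup \<mu> i then {(?s, \<mu> - ?s)} else {}) \<subseteq> {(\<nu>, \<kappa>). \<nu> + \<kappa> = \<mu>}"
      using id by simp
    show "\<forall>x\<in>{(\<nu>, \<kappa>). \<nu> + \<kappa> = \<mu>} - (if k \<le> Poly_Mapping.lookup \<mu> i then {(?s, \<mu> - ?s)} else {}).
        (case x of (\<nu>, \<kappa>) \<Rightarrow> Poly_Mapping.lookup (Poly_Mapping.single ?s 1) \<nu> * Poly_Mapping.lookup f \<kappa>) = 0"
    proof (rule ballI, clarify)
      fix \<nu> \<kappa> assume a: "(\<nu>, \<kappa>) \<notin> (if k \<le> Poly_Mapping.lookup (\<nu> + \<kappa>) i then {(?s, \<nu> + \<kappa> - ?s)} else {})" "\<mu> = \<nu> + \<kappa>"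
      have "\<nu> \<noteq> ?s"
      proof
        assume "\<nu> = ?s"
        with a(1) show False by (simp add: lookup_add)
      qed
      then show "Poly_Mapping.lookup (Poly_Mapping.single ?s (1::complex)) \<nu> * Poly_Mapping.lookup f \<kappa> = 0"
        by (simp add: lookup_single when_def)
    qed
  qed
  then show ?thesis by simp
qed

lemma truncates_hsym: "truncates n (hsym r) (hpoly n r)"
proof (induction n r rule: hpoly.induct)
  case (1 r)
  then show ?case
    by (auto simp: truncates_def hsym_def lookup_one when_def keys_eq_empty)
next
  case (2 n)
  show ?case
    by (auto simp: truncates_def hsym_def lookup_one when_def mdegree_eq_0_iff)
next
  case (3 n r)
  show ?case unfolding truncates_def
  proof
    fix \<mu>
    let ?s = "Poly_Mapping.single n (1::nat)"
    have L: "Poly_Mapping.lookup (hpoly (Suc n) (Suc r)) \<mu> =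
       (if Poly_Mapping.keys \<mu> \<subseteq> {..<n} then hsym (Suc r) \<mu> else 0) +
       (if 1 \<le> Poly_Mapping.lookup \<mu> n then
          (if Poly_Mapping.keys (\<mu> - ?s) \<subseteq> {..<Suc n} then hsym r (\<mu> - ?s) else 0) else 0)"
      using 3 unfolding truncates_def by (simp add: lookup_add lookup_monomial_mult)
    show "Poly_Mapping.lookup (hpoly (Suc n) (Suc r)) \<mu> =
        (if Poly_Mapping.keys \<mu> \<subseteq> {..<Suc n} then hsym (Suc r) \<mu> else 0)"
    proof (cases "1 \<le> Poly_Mapping.lookup \<mu> n")
      case True
      then have id: "?s + (\<mu> - ?s) = \<mu>"
        by (intro poly_mapping_eqI) (auto simp: lookup_add lookup_minus lookup_single when_def)
      have k: "Poly_Mapping.keys \<mu> = insert n (Poly_Mapping.keys (\<mu> - ?s))"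
        by (subst id[symmetric], subst keys_add_nat) simp
      have "mdegree \<mu> = Suc (mdegree (\<mu> - ?s))"
        by (subst id[symmetric], subst mdegree_add) simp
      then show ?thesis using True unfolding L k hsym_def by simp
    next
      case False
      then have "n \<notin> Poly_Mapping.keys \<mu>" by (simp add: in_keys_iff)
      then have "Poly_Mapping.keys \<mu> \<subseteq> {..<n} \<longleftrightarrow> Poly_Mapping.keys \<mu> \<subseteq> {..<Suc n}"
        by (auto simp: less_Suc_eq)
      then show ?thesis using False unfolding L by simp
    qed
  qed
qed

section \<open>The Jacobi-Trudi identity\<close>

definition tableaux :: "(nat \<Rightarrow> nat) \<Rightarrow> (nat \<Rightarrow>\<^sub>0 nat) \<Rightarrow> (nat \<times> nat \<Rightarrow> nat) set" where
  "tableaux l \<mu> = {T \<in> ssyt l. \<forall>k. card {c \<in> diagram l. T c = k} = Poly_Mapping.lookup \<mu> k}"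

lemma finite_diagram:
  assumes "\<And>i. i \<ge> N \<Longrightarrow> l i = 0"
  shows "finite (diagram l)"
proof (rule finite_subset)
  show "diagram l \<subseteq> Sigma {..<N} (\<lambda>i. {..<l i})"
    using assms by (force simp: diagram_def not_less[symmetric])
qed auto

lemma tableaux_entry:
  assumes "finite (diagram l)" "T \<in> tableaux l \<mu>" "c \<in> diagram l"
  shows "T c \<in> Poly_Mapping.keys \<mu>"
proof -
  have "c \<in> {c' \<in> diagram l. T c' = T c}" using assms by simp
  moreover have "finite {c' \<in> diagram l. T c' = T c}" using assms by simp
  ultimately have "card {c' \<in> diagram l. T c' = T c} \<noteq> 0"
    by (metis card_0_eq empty_iff)
  moreover have "card {c' \<in> diagram l. T c' = T c} = Poly_Mapping.lookup \<mu> (T c)"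
    using assms(2) by (simp add: tableaux_def)
  ultimately show ?thesis by (simp add: in_keys_iff)
qed

lemma finite_tableaux:
  assumes "finite (diagram l)"
  shows "finite (tableaux l \<mu>)"
proof (rule finite_subset)
  show "tableaux l \<mu> \<subseteq> PiE (diagram l) (\<lambda>_. Poly_Mapping.keys \<mu>)"
    using tableaux_entry[OF assms] by (auto simp: tableaux_def ssyt_def PiE_iff extensional_def)
  show "finite (PiE (diagram l) (\<lambda>_. Poly_Mapping.keys \<mu>))"
    using assms by (intro finite_PiE) auto
qed

text \<open>The partitions \<open>\<nu>\<close> for which \<open>l/\<nu>\<close> is a horizontal strip.\<close>

definition interlacing :: "nat \<Rightarrow> (nat \<Rightarrow> nat) \<Rightarrow> (nat \<Rightarrow> nat) set" where
  "interlacing N l = {\<nu>. (\<forall>i<N. l (Suc i) \<le> \<nu> i \<and> \<nu> i \<le> l i) \<and> (\<forall>i\<ge>N. \<nu> i = 0)}"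

lemma finite_interlacing: "finite (interlacing N l)"
proof (rule finite_subset)
  show "interlacing N l \<subseteq> (\<lambda>f i. if i < N then f i else 0) ` PiE {..<N} (\<lambda>i. {..l i})"
  proof
    fix \<nu> assume "\<nu> \<in> interlacing N l"
    then show "\<nu> \<in> (\<lambda>f i. if i < N then f i else 0) ` PiE {..<N} (\<lambda>i. {..l i})"
      by (intro image_eqI[of _ _ "restrict \<nu> {..<N}"]) (auto simp: interlacing_def fun_eq_iff)
  qed
qed (intro finite_imageI finite_PiE; auto)

text \<open>The cells of l/\<nu> receive the new largest entry n; \<open>undefined\<close> outside
  the diagram matches the extensionality demanded in \<open>ssyt\<close>.\<close>

definition extend_tableau where
  "extend_tableau l n \<nu> T = (\<lambda>c. if c \<in> diagram \<nu> then T c else if c \<in> diagram l then n else undefined)"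

lemma interlacing_diagram_subset: "\<nu> \<in> interlacing N l \<Longrightarrow> diagram \<nu> \<subseteq> diagram l"
proof clarsimp
  fix i j assume a: "\<nu> \<in> interlacing N l" "(i, j) \<in> diagram \<nu>"
  then have "i < N" by (cases "i < N") (auto simp: interlacing_def diagram_def)
  then show "(i, j) \<in> diagram l" using a by (auto simp: interlacing_def diagram_def intro: less_le_trans)
qed

lemma card_diagram:
  assumes "\<And>i. i \<ge> N \<Longrightarrow> l i = 0"
  shows "card (diagram l) = (\<Sum>i<N. l i)"
proof -
  have "diagram l = Sigma {..<N} (\<lambda>i. {..<l i})"
    using assms by (force simp: diagram_def not_less[symmetric])
  then show ?thesis by simp
qed

lemma content_extend_tableau:
  assumes "finite (diagram l)" "diagram \<nu> \<subseteq> diagram l"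
  shows "card {c \<in> diagram l. extend_tableau l n \<nu> T c = k} =
    card {c \<in> diagram \<nu>. T c = k} + (if k = n then card (diagram l) - card (diagram \<nu>) else 0)"
proof -
  have "{c \<in> diagram l. extend_tableau l n \<nu> T c = k} =
      {c \<in> diagram \<nu>. T c = k} \<union> (if k = n then diagram l - diagram \<nu> else {})"
    using assms by (auto simp: extend_tableau_def)
  moreover have "card (diagram l - diagram \<nu>) = card (diagram l) - card (diagram \<nu>)"
    using assms finite_subset by (intro card_Diff_subset) auto
  moreover have "finite (diagram \<nu>)" using assms finite_subset by auto
  ultimately show ?thesis
    using assms by (simp only:, subst card_Un_disjoint) auto
qed

lemma inj_on_extend_tableau: "inj_on (extend_tableau l n \<nu>) (tableaux \<nu> \<mu>)"
proof (rule inj_onI)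
  fix T1 T2 assume a: "T1 \<in> tableaux \<nu> \<mu>" "T2 \<in> tableaux \<nu> \<mu>"
    "extend_tableau l n \<nu> T1 = extend_tableau l n \<nu> T2"
  have e: "T1 \<in> extensional (diagram \<nu>)" "T2 \<in> extensional (diagram \<nu>)"
    using a(1,2) by (simp_all add: tableaux_def ssyt_def)
  show "T1 = T2"
  proof (rule extensionalityI[OF e])
    fix c assume c: "c \<in> diagram \<nu>"
    have "extend_tableau l n \<nu> T1 c = extend_tableau l n \<nu> T2 c" by (simp only: a(3))
    then show "T1 c = T2 c" using c by (simp only: extend_tableau_def if_True)
  qed
qed

text \<open>The branching rule. Deleting the cells with the largest possible entry n leaves a
  tableau of a smaller shape \<nu>; since columns increase strictly, the deleted cells form a
  horizontal strip, of size equal to the exponent of the variable n.\<close>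

lemma card_tableaux_Suc:
  assumes l: "antimono l" "\<And>i. i \<ge> N \<Longrightarrow> l i = 0" and \<mu>: "Poly_Mapping.keys \<mu> \<subseteq> {..<Suc n}"
  shows "card (tableaux l \<mu>) =
    (\<Sum>\<nu> | \<nu> \<in> interlacing N l \<and> (\<Sum>i<N. l i - \<nu> i) = Poly_Mapping.lookup \<mu> n.
       card (tableaux \<nu> (\<mu> - Poly_Mapping.single n (Poly_Mapping.lookup \<mu> n))))"
proof -
  let ?\<mu>' = "\<mu> - Poly_Mapping.single n (Poly_Mapping.lookup \<mu> n)"
  let ?V = "{\<nu>. \<nu> \<in> interlacing N l \<and> (\<Sum>i<N. l i - \<nu> i) = Poly_Mapping.lookup \<mu> n}"
  let ?ext = "extend_tableau l n"
  have fl: "finite (diagram l)" by (rule finite_diagram[OF l(2)])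
  have look': "Poly_Mapping.lookup ?\<mu>' k = (if k = n then 0 else Poly_Mapping.lookup \<mu> k)" for k
    by (auto simp: lookup_minus lookup_single when_def)
  have sub: "diagram \<nu> \<subseteq> diagram l" if "\<nu> \<in> interlacing N l" for \<nu>
    using interlacing_diagram_subset[OF that] .
  have f\<nu>: "finite (diagram \<nu>)" if "\<nu> \<in> interlacing N l" for \<nu>
    using sub[OF that] fl finite_subset by auto
  have cd: "card (diagram l) - card (diagram \<nu>) = (\<Sum>i<N. l i - \<nu> i)" if "\<nu> \<in> interlacing N l" for \<nu>
  proof -
    have "card (diagram l) = (\<Sum>i<N. l i)" by (rule card_diagram[OF l(2)])
    moreover have "card (diagram \<nu>) = (\<Sum>i<N. \<nu> i)" by (rule card_diagram) (use that in \<open>auto simp: interlacing_def\<close>)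
    moreover have "(\<Sum>i<N. l i - \<nu> i) = (\<Sum>i<N. l i) - (\<Sum>i<N. \<nu> i)"
      by (rule sum_subtractf_nat) (use that in \<open>auto simp: interlacing_def\<close>)
    ultimately show ?thesis by simp
  qed
  have entry: "T c < n" if "\<nu> \<in> ?V" "T \<in> tableaux \<nu> ?\<mu>'" "c \<in> diagram \<nu>" for \<nu> T c
  proof -
    have "T c \<in> Poly_Mapping.keys ?\<mu>'" using tableaux_entry[OF f\<nu> that(2,3)] that(1) by auto
    then have "T c \<noteq> n" "T c \<in> Poly_Mapping.keys \<mu>" by (auto simp: in_keys_iff look' split: if_splits)
    then show ?thesis using \<mu> by auto
  qed
  \<comment> \<open>\<nu> is recovered from the extended tableau as the set of cells with entries
    below n, so different \<nu> have disjoint images.\<close>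
  have shape: "{c \<in> diagram l. ?ext \<nu> T c < n} = diagram \<nu>" if "\<nu> \<in> ?V" "T \<in> tableaux \<nu> ?\<mu>'" for \<nu> T
    using entry[OF that] sub[of \<nu>] that(1) by (auto simp: extend_tableau_def)
  have shape_inj: "\<nu> = \<nu>'" if "diagram \<nu> = diagram \<nu>'" for \<nu> \<nu>'
  proof
    fix i
    have "{..<\<nu> i} = {j. (i, j) \<in> diagram \<nu>}" "{..<\<nu>' i} = {j. (i, j) \<in> diagram \<nu>'}"
      by (auto simp: diagram_def)
    then show "\<nu> i = \<nu>' i" using that by (metis card_lessThan)
  qed
  have into: "?ext \<nu> T \<in> tableaux l \<mu>" if "\<nu> \<in> ?V" "T \<in> tableaux \<nu> ?\<mu>'" for \<nu> T
  proof -
    have \<nu>: "\<nu> \<in> interlacing N l" using that by auto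
    have T: "T \<in> ssyt \<nu>" using that by (auto simp: tableaux_def)
    note entry' = entry[OF that]
    have row: "?ext \<nu> T (i, j) \<le> ?ext \<nu> T (i, Suc j)" if a: "(i, Suc j) \<in> diagram l" for i j
    proof (cases "(i, Suc j) \<in> diagram \<nu>")
      case True
      then have "(i, j) \<in> diagram \<nu>" by (auto simp: diagram_def)
      with True T show ?thesis by (auto simp: extend_tableau_def ssyt_def)
    next
      case False
      have "(i, j) \<in> diagram l" using a by (auto simp: diagram_def)
      with False show ?thesis using a entry'[of "(i, j)"]
        by (auto simp: extend_tableau_def)
    qed
    have col: "?ext \<nu> T (i, j) < ?ext \<nu> T (Suc i, j)" if a: "(Suc i, j) \<in> diagram l" for i j
    proof -
      have "i < N" using l(2)[of "Suc i"] a by (cases "i < N") (auto simp: diagram_def)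
      then have "(i, j) \<in> diagram \<nu>" using a \<nu> by (auto simp: diagram_def interlacing_def intro: less_le_trans)
      then show ?thesis using T a entry'[of "(i, j)"]
        by (auto simp: extend_tableau_def ssyt_def)
    qed
    have "?ext \<nu> T \<in> ssyt l"
      using row col sub[OF \<nu>] by (auto simp: ssyt_def extensional_def extend_tableau_def)
    moreover have "card {c \<in> diagram l. ?ext \<nu> T c = k} = Poly_Mapping.lookup \<mu> k" for k
      unfolding content_extend_tableau[OF fl sub[OF \<nu>]] using that cd[OF \<nu>]
      by (auto simp: tableaux_def look')
    ultimately show ?thesis by (simp add: tableaux_def)
  qed
  have onto: "\<exists>\<nu>\<in>?V. \<exists>T'\<in>tableaux \<nu> ?\<mu>'. T = ?ext \<nu> T'" if T: "T \<in> tableaux l \<mu>" for T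
  proof -
    have le: "T c \<le> n" if "c \<in> diagram l" for c
      using tableaux_entry[OF fl T that] \<mu> by (auto simp: less_Suc_eq_le)
    have T': "T \<in> ssyt l" using T by (simp add: tableaux_def)
    have mono: "T (i, j) \<le> T (i, j')" if "j \<le> j'" "j' < l i" for i j j'
      using that
    proof (induction j' rule: dec_induct)
      case (step k)
      then have "T (i, k) \<le> T (i, Suc k)" using T' by (auto simp: ssyt_def diagram_def)
      with step show ?case by auto
    qed simp
    \<comment> \<open>The length of the initial segment of row i with entries below n. The minimum
      exists because j = l i always qualifies.\<close>
    define \<nu> where "\<nu> i = (LEAST j. \<not> (j < l i \<and> T (i, j) < n))" for i
    have \<nu>_not: "\<not> (\<nu> i < l i \<and> T (i, \<nu> i) < n)" for i
      unfolding \<nu>_def by (rule LeastI[of _ "l i"]) simp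
    have \<nu>_iff: "j < \<nu> i \<longleftrightarrow> j < l i \<and> T (i, j) < n" for i j
    proof
      assume "j < \<nu> i"
      then show "j < l i \<and> T (i, j) < n" unfolding \<nu>_def using not_less_Least by blast
    next
      assume j: "j < l i \<and> T (i, j) < n"
      show "j < \<nu> i"
      proof (rule ccontr)
        assume "\<not> j < \<nu> i"
        then have "\<nu> i \<le> j" by simp
        then have "T (i, \<nu> i) \<le> T (i, j)" "\<nu> i < l i" using mono[of "\<nu> i" j i] j by auto
        then show False using \<nu>_not[of i] j by auto
      qed
    qed
    have d\<nu>: "c \<in> diagram \<nu> \<longleftrightarrow> c \<in> diagram l \<and> T c < n" for c
      using \<nu>_iff by (cases c) (auto simp: diagram_def)
    have \<nu>: "\<nu> \<in> interlacing N l"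
      unfolding interlacing_def
    proof (intro CollectI conjI allI impI)
      fix i
      \<comment> \<open>Otherwise the entry at (i, \<nu> i) is at least n, and the strictly larger
        entry below it would exceed n.\<close>
      show "l (Suc i) \<le> \<nu> i"
      proof (rule ccontr)
        assume a: "\<not> l (Suc i) \<le> \<nu> i"
        have "l (Suc i) \<le> l i" using l(1) by (simp add: antimono_def)
        then have "T (i, \<nu> i) \<ge> n" using \<nu>_not[of i] a by auto
        moreover have "(Suc i, \<nu> i) \<in> diagram l" using a by (simp add: diagram_def)
        then have "T (i, \<nu> i) < T (Suc i, \<nu> i)" "T (Suc i, \<nu> i) \<le> n"
          using T' le by (auto simp: ssyt_def)
        ultimately show False by simp
      qed
      show "\<nu> i \<le> l i" using \<nu>_iff[of _ i] by (metis leI less_irrefl)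
      show "\<nu> i = 0" if "i \<ge> N" using \<nu>_iff[of _ i] l(2)[OF that] by (metis not_gr_zero not_less0)
    qed
    define T2 where "T2 = restrict T (diagram \<nu>)"
    have T_eq: "T = ?ext \<nu> T2"
    proof
      fix c
      show "T c = ?ext \<nu> T2 c"
      proof (cases "c \<in> diagram l")
        case True
        then show ?thesis using le[OF True] d\<nu>[of c] by (auto simp: extend_tableau_def T2_def)
      next
        case False
        moreover have "T c = undefined"
          using T' False unfolding ssyt_def by (blast intro: extensional_arb)
        ultimately show ?thesis using d\<nu>[of c] by (simp add: extend_tableau_def)
      qed
    qed
    have cont: "Poly_Mapping.lookup \<mu> k =
        card {c \<in> diagram \<nu>. T2 c = k} + (if k = n then (\<Sum>i<N. l i - \<nu> i) else 0)" for k
    proof -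
      have "Poly_Mapping.lookup \<mu> k = card {c \<in> diagram l. ?ext \<nu> T2 c = k}"
        using T unfolding T_eq[symmetric] by (simp add: tableaux_def)
      then show ?thesis using content_extend_tableau[OF fl sub[OF \<nu>], of n T2 k] cd[OF \<nu>] by simp
    qed
    have none: "{c \<in> diagram \<nu>. T2 c = n} = {}" using d\<nu> by (auto simp: T2_def)
    have \<nu>V: "\<nu> \<in> ?V" using \<nu> cont[of n] none by simp
    have below: "(i, j) \<in> diagram \<nu>" if "(Suc i, j) \<in> diagram \<nu>" for i j
    proof -
      have "Suc i < N" using that \<nu> by (cases "Suc i < N") (auto simp: interlacing_def diagram_def)
      then have "\<nu> (Suc i) \<le> l (Suc i)" "l (Suc i) \<le> \<nu> i" using \<nu> by (auto simp: interlacing_def)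
      then show ?thesis using that by (auto simp: diagram_def)
    qed
    have left: "(i, j) \<in> diagram \<nu>" if "(i, Suc j) \<in> diagram \<nu>" for i j
      using that by (auto simp: diagram_def)
    have "T2 \<in> ssyt \<nu>"
    proof -
      have r1: "T (i, j) \<le> T (i, Suc j)" if "(i, Suc j) \<in> diagram l" for i j
        using T' that unfolding ssyt_def by blast
      have r2: "T (i, j) < T (Suc i, j)" if "(Suc i, j) \<in> diagram l" for i j
        using T' that unfolding ssyt_def by blast
      have T2: "T2 c = T c" if "c \<in> diagram \<nu>" for c using that by (simp add: T2_def)
      have "T2 (i, j) \<le> T2 (i, Suc j)" if a: "(i, Suc j) \<in> diagram \<nu>" for i j
        unfolding T2[OF a] T2[OF left[OF a]] using r1 a d\<nu> by blast
      moreover have "T2 (i, j) < T2 (Suc i, j)" if a: "(Suc i, j) \<in> diagram \<nu>" for i j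
        unfolding T2[OF a] T2[OF below[OF a]] using r2 a d\<nu> by blast
      moreover have "T2 \<in> extensional (diagram \<nu>)" by (simp add: T2_def)
      ultimately show ?thesis unfolding ssyt_def by blast
    qed
    moreover have "card {c \<in> diagram \<nu>. T2 c = k} = Poly_Mapping.lookup ?\<mu>' k" for k
    proof (cases "k = n")
      case True
      show ?thesis unfolding True none look' by simp
    next
      case False
      then show ?thesis using cont[of k] by (simp add: look')
    qed
    ultimately have "T2 \<in> tableaux \<nu> ?\<mu>'" by (simp add: tableaux_def)
    then show ?thesis using \<nu>V T_eq by blast
  qed
  have U: "tableaux l \<mu> = (\<Union>\<nu>\<in>?V. ?ext \<nu> ` tableaux \<nu> ?\<mu>')"
  proof (rule equalityI; rule subsetI)
    fix T assume "T \<in> tableaux l \<mu>"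
    then obtain \<nu> T' where "\<nu> \<in> ?V" "T' \<in> tableaux \<nu> ?\<mu>'" "T = ?ext \<nu> T'"
      using onto by meson
    then show "T \<in> (\<Union>\<nu>\<in>?V. ?ext \<nu> ` tableaux \<nu> ?\<mu>')" by blast
  next
    fix T assume "T \<in> (\<Union>\<nu>\<in>?V. ?ext \<nu> ` tableaux \<nu> ?\<mu>')"
    then obtain \<nu> T' where "\<nu> \<in> ?V" "T' \<in> tableaux \<nu> ?\<mu>'" "T = ?ext \<nu> T'" by blast
    then show "T \<in> tableaux l \<mu>" using into by simp
  qed
  have C: "card (\<Union>\<nu>\<in>?V. ?ext \<nu> ` tableaux \<nu> ?\<mu>') = (\<Sum>\<nu>\<in>?V. card (?ext \<nu> ` tableaux \<nu> ?\<mu>'))"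
  proof (rule card_UN_disjoint)
    show "finite ?V" using finite_interlacing[of N l] by (rule finite_subset[rotated]) auto
    show "\<forall>\<nu>\<in>?V. finite (?ext \<nu> ` tableaux \<nu> ?\<mu>')" using f\<nu> finite_tableaux by blast
    show "\<forall>\<nu>\<in>?V. \<forall>\<nu>'\<in>?V. \<nu> \<noteq> \<nu>' \<longrightarrow> ?ext \<nu> ` tableaux \<nu> ?\<mu>' \<inter> ?ext \<nu>' ` tableaux \<nu>' ?\<mu>' = {}"
    proof (intro ballI impI equals0I)
      fix \<nu> \<nu>' S assume a: "\<nu> \<in> ?V" "\<nu>' \<in> ?V" "\<nu> \<noteq> \<nu>'"
        "S \<in> ?ext \<nu> ` tableaux \<nu> ?\<mu>' \<inter> ?ext \<nu>' ` tableaux \<nu>' ?\<mu>'"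
      then obtain T1 T2 where T: "T1 \<in> tableaux \<nu> ?\<mu>'" "S = ?ext \<nu> T1" "T2 \<in> tableaux \<nu>' ?\<mu>'" "S = ?ext \<nu>' T2"
        by blast
      have "diagram \<nu> = {c \<in> diagram l. S c < n}" using shape[OF a(1) T(1)] T(2) by simp
      also have "\<dots> = diagram \<nu>'" using shape[OF a(2) T(3)] T(4) by simp
      finally have "\<nu> = \<nu>'" by (rule shape_inj)
      with a(3) show False by simp
    qed
  qed
  have D: "card (?ext \<nu> ` tableaux \<nu> ?\<mu>') = card (tableaux \<nu> ?\<mu>')" for \<nu>
    by (rule card_image[OF inj_on_extend_tableau])
  show ?thesis unfolding U C D ..
qed

section \<open>Branching of the Jacobi-Trudi determinant\<close>

lemma geometric_recurrence_telescope:
  fixes A B :: "int \<Rightarrow> 'a::comm_ring_1"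
  assumes "\<And>n. A n = B n + x * A (n - 1)"
  shows "A n - x ^ d * A (n - int d) = (\<Sum>t<d. x ^ t * B (n - int t))"
proof (induction d)
  case (Suc d)
  have "A (n - int d) = B (n - int d) + x * A (n - int (Suc d))"
    using assms[of "n - int d"] by (simp add: algebra_simps)
  then show ?case using Suc by (simp add: algebra_simps)
qed simp

text \<open>Passing from the complete homogeneous functions \<open>B\<close> to the functions \<open>A\<close> with one more
  variable \<open>x\<close>: subtracting a multiple of the next row turns each row of the determinant into a
  short geometric sum, and expanding these sums produces exactly the horizontal strips.\<close>

lemma jacobi_trudi_branching:
  fixes A B :: "int \<Rightarrow> 'a::comm_ring_1"
  assumes rec: "\<And>n. A n = B n + x * A (n - 1)" and neg: "\<And>n. n < 0 \<Longrightarrow> A n = 0"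
    and l: "antimono l" "l N = (0::nat)"
  shows "fdet N (\<lambda>i j. A (int (l i) - int i + int j)) =
    (\<Sum>\<nu>\<in>interlacing N l. x ^ (\<Sum>i<N. l i - \<nu> i) * fdet N (\<lambda>i j. B (int (\<nu> i) - int i + int j)))"
proof -
  define d where "d i = l i - l (Suc i) + 1" for i
  \<comment> \<open>\<open>U\<close> subtracts x^(d i) times row i + 1 from row i. The number
    \<open>d i\<close> is the difference of the arguments of A in these rows: (l i - i) - (l (i + 1)
    - i - 1).\<close>
  define U where "U i k = (if k = i then 1 else if k = Suc i then - (x ^ d i) else 0)" for i k
  let ?R = "\<lambda>i j. A (int (l i) - int i + int j)"
  have dec: "l (Suc i) \<le> l i" for i using l(1) by (simp add: antimono_def)
  have row: "(\<Sum>k=0..<N. U i k * ?R k j) =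
      (\<Sum>b\<in>{l (Suc i)..l i}. x ^ (l i - b) * B (int b - int i + int j))" if ij: "i < N" "j < N" for i j
  proof -
    have "(\<Sum>k=0..<N. U i k * ?R k j) =
        (\<Sum>k=0..<N. (if k = i then ?R i j else 0) + (if k = Suc i then - (x ^ d i * ?R (Suc i) j) else 0))"
      by (intro sum.cong) (auto simp: U_def)
    also have "\<dots> = ?R i j + (if Suc i < N then - (x ^ d i * ?R (Suc i) j) else 0)"
      using ij by (simp add: sum.distrib)
    also have "\<dots> = ?R i j - x ^ d i * ?R (Suc i) j"
    proof (cases "Suc i < N")
      case False
      \<comment> \<open>The last row has no successor, but the term to be subtracted is zero anyway:
        its argument is j - N < 0 because l N = 0.\<close>
      then have "Suc i = N" using ij by simp
      then show ?thesis using neg l ij by simp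
    qed simp
    also have "?R (Suc i) j = A (int (l i) - int i + int j - int (d i))"
      using dec[of i] by (simp add: d_def of_nat_diff algebra_simps)
    also have "?R i j - x ^ d i * \<dots> = (\<Sum>t<d i. x ^ t * B (int (l i) - int i + int j - int t))"
      by (rule geometric_recurrence_telescope[of A B x, OF rec])
    also have "\<dots> = (\<Sum>b\<in>{l (Suc i)..l i}. x ^ (l i - b) * B (int b - int i + int j))"
      using dec[of i]
      by (intro sum.reindex_bij_witness[of _ "\<lambda>b. l i - b" "\<lambda>t. l i - t"])
         (auto simp: d_def of_nat_diff algebra_simps)
    finally show ?thesis .
  qed
  have "fdet N U = 1"
    by (rule fdet_upper_unitriangular) (auto simp: U_def)
  then have "fdet N ?R = fdet N (\<lambda>i j. \<Sum>k=0..<N. U i k * ?R k j)"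
    by (subst fdet_mult) simp
  also have "\<dots> = fdet N (\<lambda>i j. \<Sum>b\<in>{l (Suc i)..l i}. x ^ (l i - b) * B (int b - int i + int j))"
    by (rule fdet_cong) (rule row)
  also have "\<dots> = (\<Sum>b\<in>PiE {0..<N} (\<lambda>i. {l (Suc i)..l i}).
      (\<Prod>i=0..<N. x ^ (l i - b i)) * fdet N (\<lambda>i j. B (int (b i) - int i + int j)))"
    by (rule fdet_rows_sum) simp
  also have "\<dots> = (\<Sum>\<nu>\<in>interlacing N l. x ^ (\<Sum>i<N. l i - \<nu> i) * fdet N (\<lambda>i j. B (int (\<nu> i) - int i + int j)))"
  proof (rule sum.reindex_bij_witness[of _ "\<lambda>\<nu>. restrict \<nu> {0..<N}" "\<lambda>b i. if i < N then b i else 0"], goal_cases)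
    case (1 b) then show ?case by (auto simp: PiE_def extensional_def restrict_def)
  next
    case (2 b) then show ?case by (auto simp: interlacing_def PiE_iff)
  next
    case (3 \<nu>) then show ?case by (auto simp: interlacing_def)
  next
    case (4 \<nu>) then show ?case by (auto simp: interlacing_def PiE_iff)
  next
    case (5 b)
    have "fdet N (\<lambda>i j. B (int (b i) - int i + int j)) =
        fdet N (\<lambda>i j. B (int (if i < N then b i else 0) - int i + int j))"
      by (rule fdet_cong) simp
    moreover have "(\<Prod>i=0..<N. x ^ (l i - b i)) = x ^ (\<Sum>i<N. l i - (if i < N then b i else 0))"
      by (simp add: power_sum[symmetric] lessThan_atLeast0)
    ultimately show ?case by simp
  qed
  finally show ?thesis .
qed

definition hpoly_int :: "nat \<Rightarrow> int \<Rightarrow> (nat \<Rightarrow>\<^sub>0 nat) \<Rightarrow>\<^sub>0 complex" where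
  "hpoly_int n r = (if r < 0 then 0 else hpoly n (nat r))"

lemma hpoly_int_Suc:
  "hpoly_int (Suc n) r = hpoly_int n r + Poly_Mapping.single (Poly_Mapping.single n 1) 1 * hpoly_int (Suc n) (r - 1)"
proof (cases "r > 0")
  case True
  then obtain k where "r = int (Suc k)" by (metis Suc_pred' pos_int_cases)
  then show ?thesis by (simp add: hpoly_int_def nat_add_distrib)
next
  case False
  then show ?thesis by (cases n) (auto simp: hpoly_int_def)
qed

lemma single_power:
  "(Poly_Mapping.single (Poly_Mapping.single n (1::nat)) (1::complex)) ^ e = Poly_Mapping.single (Poly_Mapping.single n e) 1"
proof (induction e)
  case (Suc e)
  then show ?case by (simp add: mult_single single_add[symmetric])
qed simp

lemma antimono_interlacing:
  assumes "antimono l" "\<nu> \<in> interlacing N l"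
  shows "antimono \<nu>"
  unfolding antimono_iff_le_Suc
proof
  fix i
  show "\<nu> (Suc i) \<le> \<nu> i"
  proof (cases "Suc i < N")
    case True
    then have "\<nu> (Suc i) \<le> l (Suc i)" "l (Suc i) \<le> \<nu> i" using assms(2) by (auto simp: interlacing_def)
    then show ?thesis by simp
  next
    case False
    then show ?thesis using assms(2) by (simp add: interlacing_def)
  qed
qed

text \<open>Induction on the number n of variables: tableaux and determinants obey the same
  branching over horizontal strips. With no variables both sides are 1 for the empty partition with
  the trivial monomial and 0 otherwise.\<close>

lemma lookup_jacobi_trudi:
  assumes "antimono l" "\<And>i. i \<ge> N \<Longrightarrow> l i = 0"
  shows "Poly_Mapping.lookup (fdet N (\<lambda>i j. hpoly_int n (int (l i) - int i + int j))) \<mu> =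
    (if Poly_Mapping.keys \<mu> \<subseteq> {..<n} then of_nat (card (tableaux l \<mu>)) else 0)"
  using assms
proof (induction n arbitrary: l \<mu>)
  case (0 l)
  have h0: "hpoly_int 0 r = (if r = 0 then 1 else 0)" for r by (simp add: hpoly_int_def)
  show ?case
  proof (cases "l 0 = 0")
    case True
    then have l0: "l i = 0" for i using \<open>antimono l\<close> by (metis antimonoD le0 le_zero_eq)
    have "fdet N (\<lambda>i j. hpoly_int 0 (int (l i) - int i + int j)) = 1"
      by (rule fdet_upper_unitriangular) (auto simp: h0 l0)
    moreover have "tableaux l 0 = {\<lambda>_. undefined}"
      by (auto simp: tableaux_def ssyt_def diagram_def l0)
    ultimately show ?thesis by (auto simp: lookup_one when_def)
  next
    case False
    then have "N > 0" using 0 by (metis gr0I le_refl)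
    then have "fdet N (\<lambda>i j. hpoly_int 0 (int (l i) - int i + int j)) = 0"
      by (rule fdet_zero_row) (use False in \<open>auto simp: h0\<close>)
    moreover have "tableaux l 0 = {}"
    proof (rule equals0I)
      fix T assume "T \<in> tableaux l 0"
      moreover have "(0, 0) \<in> diagram l" using False by (simp add: diagram_def)
      ultimately have "T (0, 0) \<in> Poly_Mapping.keys (0 :: nat \<Rightarrow>\<^sub>0 nat)"
        by (intro tableaux_entry finite_diagram[of N]) (use 0 in auto)
      then show False by simp
    qed
    ultimately show ?thesis by auto
  qed
next
  case (Suc n l)
  let ?D = "\<lambda>\<nu>. fdet N (\<lambda>i j. hpoly_int n (int (\<nu> i) - int i + int j))"
  let ?e = "\<lambda>\<nu>. \<Sum>i<N. l i - \<nu> i"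
  let ?m = "Poly_Mapping.lookup \<mu> n"
  let ?\<mu>' = "\<mu> - Poly_Mapping.single n ?m"
  have k: "Poly_Mapping.keys ?\<mu>' \<subseteq> {..<n} \<longleftrightarrow> Poly_Mapping.keys \<mu> \<subseteq> {..<Suc n}"
    by (auto simp: in_keys_iff lookup_minus lookup_single when_def less_Suc_eq subset_eq)
  \<comment> \<open>If the strip has fewer cells than the exponent of the variable n, that variable
    survives in the remaining monomial, whose coefficient in a polynomial in the first n variables
    is 0.\<close>
  have k': "\<not> Poly_Mapping.keys (\<mu> - Poly_Mapping.single n e) \<subseteq> {..<n}" if "e < ?m" for e
    using that by (auto simp: in_keys_iff lookup_minus lookup_single subset_eq intro!: exI[of _ n])
  have "fdet N (\<lambda>i j. hpoly_int (Suc n) (int (l i) - int i + int j)) =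
      (\<Sum>\<nu>\<in>interlacing N l. Poly_Mapping.single (Poly_Mapping.single n 1) 1 ^ ?e \<nu> * ?D \<nu>)"
    by (rule jacobi_trudi_branching[of "hpoly_int (Suc n)" "hpoly_int n", OF hpoly_int_Suc]) (use Suc.prems in \<open>auto simp: hpoly_int_def\<close>)
  then have "Poly_Mapping.lookup (fdet N (\<lambda>i j. hpoly_int (Suc n) (int (l i) - int i + int j))) \<mu> =
      (\<Sum>\<nu>\<in>interlacing N l. if ?e \<nu> \<le> ?m then Poly_Mapping.lookup (?D \<nu>) (\<mu> - Poly_Mapping.single n (?e \<nu>)) else 0)"
    by (simp only: single_power lookup_sum lookup_monomial_mult)
  also have "\<dots> = (\<Sum>\<nu>\<in>interlacing N l. if ?e \<nu> = ?m then
      (if Poly_Mapping.keys \<mu> \<subseteq> {..<Suc n} then of_nat (card (tableaux \<nu> ?\<mu>')) else 0) else 0)"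
  proof (intro sum.cong refl)
    fix \<nu> assume \<nu>: "\<nu> \<in> interlacing N l"
    have IH: "Poly_Mapping.lookup (?D \<nu>) \<kappa> =
        (if Poly_Mapping.keys \<kappa> \<subseteq> {..<n} then of_nat (card (tableaux \<nu> \<kappa>)) else 0)" for \<kappa>
      by (rule Suc.IH) (use \<nu> antimono_interlacing[OF Suc.prems(1) \<nu>] in \<open>auto simp: interlacing_def\<close>)
    show "(if ?e \<nu> \<le> ?m then Poly_Mapping.lookup (?D \<nu>) (\<mu> - Poly_Mapping.single n (?e \<nu>)) else 0) =
      (if ?e \<nu> = ?m then
      (if Poly_Mapping.keys \<mu> \<subseteq> {..<Suc n} then of_nat (card (tableaux \<nu> ?\<mu>')) else 0) else 0)"
    proof (cases "?e \<nu> < ?m")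
      case True
      then show ?thesis unfolding IH using k'[OF True] by simp
    next
      case False
      show ?thesis
      proof (cases "?e \<nu> = ?m")
        case True
        then show ?thesis unfolding IH True k by simp
      qed (use False in auto)
    qed
  qed
  also have "\<dots> = (\<Sum>\<nu>\<in>{\<nu> \<in> interlacing N l. ?e \<nu> = ?m}.
      (if Poly_Mapping.keys \<mu> \<subseteq> {..<Suc n} then of_nat (card (tableaux \<nu> ?\<mu>')) else 0))"
    by (rule sum.inter_filter[symmetric, OF finite_interlacing])
  also have "\<dots> = (if Poly_Mapping.keys \<mu> \<subseteq> {..<Suc n} then of_nat (card (tableaux l \<mu>)) else 0)"
  proof (cases "Poly_Mapping.keys \<mu> \<subseteq> {..<Suc n}")
    case True
    then show ?thesis using card_tableaux_Suc[OF Suc.prems True] by simp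
  qed simp
  finally show ?case .
qed

lemma prod_list_upt: "prod_list (map f [0..<N]) = prod f {0..<N}"
  using prod.distinct_set_conv_list[of "[0..<N]" f] by simp

definition spec_h :: "(series \<Rightarrow> complex) \<Rightarrow> int \<Rightarrow> complex" where
  "spec_h \<rho> r = (if r < 0 then 0 else \<rho> (hsym (nat r)))"

lemma lookup_signof_mult:
  "Poly_Mapping.lookup (signof p * f) \<mu> = signof p * Poly_Mapping.lookup (f :: (nat \<Rightarrow>\<^sub>0 nat) \<Rightarrow>\<^sub>0 complex) \<mu>"
  by (simp add: sign_def)

text \<open>The Jacobi-Trudi expansion is first proved for the series itself, one coefficient at a
  time: a monomial involves finitely many variables, so a sufficiently large truncation decides it.
  Then \<rho> is applied to the resulting finite combination of products of h_n. Any N not smaller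
  than the number of rows may be used.\<close>

theorem spec_schur:
  assumes \<rho>: "specialization \<rho>" and l: "l \<in> partitions" "\<And>i. i \<ge> N \<Longrightarrow> l i = 0"
  shows "\<rho> (schur l) = fdet N (\<lambda>i j. spec_h \<rho> (int (l i) - int i + int j))"
proof -
  define hs :: "int \<Rightarrow> series" where "hs r = (if r < 0 then (\<lambda>_. 0) else hsym (nat r))" for r
  let ?a = "\<lambda>i j. int (l i) - int i + int j"
  let ?F = "\<lambda>p. ser_prod (map (\<lambda>i. hs (?a i (p i))) [0..<N])"
  let ?P = "{p. p permutes {0..<N}}"
  have z: "(\<lambda>_. 0) \<in> sym_funs" "\<rho> (\<lambda>_. 0) = 0"
    using sum_series_sym[of "{}"] spec_sum[OF \<rho>, of "{}"] by auto
  have hs: "hs r \<in> sym_funs" "\<rho> (hs r) = spec_h \<rho> r" for r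
    using z by (auto simp: hs_def spec_h_def hsym_sym)
  have tr: "truncates n (hs r) (hpoly_int n r)" for n r
    using truncates_hsym[of n "nat r"] by (auto simp: hs_def hpoly_int_def truncates_def)
  have "schur l = (\<lambda>\<mu>. \<Sum>p\<in>?P. signof p * ?F p \<mu>)"
  proof
    fix \<mu> :: "nat \<Rightarrow>\<^sub>0 nat"
    obtain n where n: "Poly_Mapping.keys \<mu> \<subseteq> {..<n}"
      using finite_nat_bounded[OF finite_keys[of \<mu>]] by blast
    have "schur l \<mu> = of_nat (card (tableaux l \<mu>))" by (simp add: schur_def tableaux_def)
    also have "\<dots> = Poly_Mapping.lookup (fdet N (\<lambda>i j. hpoly_int n (?a i j))) \<mu>"
      using n l by (subst lookup_jacobi_trudi) (auto simp: partitions_def)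
    also have "\<dots> = (\<Sum>p\<in>?P. signof p * Poly_Mapping.lookup (\<Prod>i=0..<N. hpoly_int n (?a i (p i))) \<mu>)"
      unfolding fdet_leibniz lookup_sum lookup_signof_mult ..
    also have "\<dots> = (\<Sum>p\<in>?P. signof p * ?F p \<mu>)"
    proof (intro sum.cong refl arg_cong2[of _ _ _ _ "(*)"])
      fix p
      have "truncates n (?F p) (prod_list (map (\<lambda>i. hpoly_int n (?a i (p i))) [0..<N]))"
        by (rule truncates_ser_prod) (rule tr)
      then show "Poly_Mapping.lookup (\<Prod>i=0..<N. hpoly_int n (?a i (p i))) \<mu> = ?F p \<mu>"
        using n by (simp add: truncates_def prod_list_upt)
    qed
    finally show "schur l \<mu> = (\<Sum>p\<in>?P. signof p * ?F p \<mu>)" .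
  qed
  then have "\<rho> (schur l) = \<rho> (\<lambda>\<mu>. \<Sum>p\<in>?P. signof p * ?F p \<mu>)" by simp
  also have "\<dots> = (\<Sum>p\<in>?P. signof p * \<rho> (?F p))"
    by (rule spec_sum[OF \<rho>]) (auto intro!: ser_prod_sym hs finite_permutations)
  also have "\<dots> = (\<Sum>p\<in>?P. signof p * (\<Prod>i=0..<N. spec_h \<rho> (?a i (p i))))"
  proof (intro sum.cong refl arg_cong2[of _ _ _ _ "(*)"])
    fix p
    have "\<rho> (?F p) = prod_list (map \<rho> (map (\<lambda>i. hs (?a i (p i))) [0..<N]))"
      by (rule spec_ser_prod[OF \<rho>]) (auto intro: hs)
    then show "\<rho> (?F p) = (\<Prod>i=0..<N. spec_h \<rho> (?a i (p i)))"
      by (simp add: o_def hs prod_list_upt)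
  qed
  finally show ?thesis unfolding fdet_leibniz .
qed

section \<open>Decay of the specialized symmetric functions\<close>

text \<open>F = exp A satisfies F' = A' F, and comparing coefficients gives a recursion of Newton's
  form. This is what identifies the numbers \<rho>(h_n) with the coefficients of an analytic
  function.\<close>

lemma has_fps_expansion_exp_eval_fps:
  fixes A :: "complex fps"
  assumes R: "0 < R" "ereal R \<le> fps_conv_radius A"
  defines "F \<equiv> fps_expansion (\<lambda>z. exp (eval_fps A z)) 0"
  shows "(\<lambda>z. exp (eval_fps A z)) has_fps_expansion F"
    and "\<And>n. of_nat n * fps_nth F n = (\<Sum>k=1..n. of_nat k * fps_nth A k * fps_nth F (n - k))"
    and "fps_nth F 0 = exp (fps_nth A 0)"
    and "\<And>z. norm z < R \<Longrightarrow> (\<lambda>n. fps_nth F n * z ^ n) sums exp (eval_fps A z)"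
proof -
  let ?f = "\<lambda>z. exp (eval_fps A z)"
  have hol: "?f holomorphic_on eball 0 (ereal R)"
    by (intro holomorphic_intros) (auto simp: eball_def intro: less_le_trans[OF _ R(2)])
  show F: "?f has_fps_expansion F"
    unfolding F_def by (rule has_fps_expansion_fps_expansion[OF _ _ hol]) (use R in auto)
  show "(\<lambda>n. fps_nth F n * z ^ n) sums ?f z" if "norm z < R" for z
    by (rule has_fps_expansion_imp_sums_complex[OF F hol]) (use that in auto)
  have "?f 0 = fps_nth F 0" by (rule has_fps_expansion_imp_0_eq_fps_nth_0[OF F])
  then show F0: "fps_nth F 0 = exp (fps_nth A 0)" by (simp add: eval_fps_at_0)
  have "0 < fps_conv_radius A" using R by (metis ereal_less(2) order_less_le_trans zero_ereal_def)
  then have A: "eval_fps A has_fps_expansion A" by (simp add: has_fps_expansion_def)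
  have "deriv (eval_fps A) has_fps_expansion fps_deriv A" by (rule has_fps_expansion_deriv[OF A])
  then have 1: "(\<lambda>z. deriv (eval_fps A) z * ?f z) has_fps_expansion fps_deriv A * F"
    by (rule has_fps_expansion_mult[OF _ F])
  have ev: "eventually (\<lambda>z. deriv ?f z = deriv (eval_fps A) z * ?f z) (nhds 0)"
    unfolding eventually_nhds
  proof (intro exI[of _ "ball 0 R"] conjI ballI)
    fix z assume "z \<in> ball (0::complex) R"
    then have z: "ereal (norm z) < fps_conv_radius A" by (intro less_le_trans[OF _ R(2)]) simp
    have d: "(eval_fps A has_field_derivative eval_fps (fps_deriv A) z) (at z)"
      by (rule has_field_derivative_eval_fps[OF z])
    have "(?f has_field_derivative (?f z * eval_fps (fps_deriv A) z)) (at z)"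
      by (rule DERIV_chain2[OF DERIV_exp d, simplified])
    then show "deriv ?f z = deriv (eval_fps A) z * ?f z"
      using DERIV_imp_deriv[OF d] by (simp add: DERIV_imp_deriv mult.commute)
  qed (use R in auto)
  have "deriv ?f has_fps_expansion fps_deriv F" by (rule has_fps_expansion_deriv[OF F])
  then have 2: "(\<lambda>z. deriv (eval_fps A) z * ?f z) has_fps_expansion fps_deriv F"
    using has_fps_expansion_cong[OF ev refl] by simp
  have eq: "fps_deriv F = fps_deriv A * F" by (rule fps_expansion_unique_complex[OF 2 1])
  show "of_nat n * fps_nth F n = (\<Sum>k=1..n. of_nat k * fps_nth A k * fps_nth F (n - k))" for n
  proof (cases n)
    case (Suc m)
    have "of_nat n * fps_nth F n = fps_nth (fps_deriv F) m" by (simp add: Suc)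
    also have "\<dots> = (\<Sum>i=0..m. of_nat (Suc i) * fps_nth A (Suc i) * fps_nth F (m - i))"
      unfolding eq fps_mult_nth by simp
    also have "\<dots> = (\<Sum>k=1..n. of_nat k * fps_nth A k * fps_nth F (n - k))"
      by (rule sum.reindex_bij_witness[of _ "\<lambda>k. k - 1" Suc]) (auto simp: Suc)
    finally show ?thesis .
  qed simp
qed

lemma newton_recursion_unique:
  fixes a F G :: "nat \<Rightarrow> complex"
  assumes "F 0 = G 0" "\<And>n. of_nat n * F n = (\<Sum>k=1..n. a k * F (n - k))"
    "\<And>n. of_nat n * G n = (\<Sum>k=1..n. a k * G (n - k))"
  shows "F n = G n"
proof (induction n rule: less_induct)
  case (less n)
  show ?case
  proof (cases "n = 0")
    case False
    have "of_nat n * F n = of_nat n * G n"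
      unfolding assms(2,3) by (intro sum.cong refl) (use less False in auto)
    then show ?thesis using False by simp
  qed (use assms in simp)
qed

lemma summable_imp_geometric_bound:
  fixes f :: "nat \<Rightarrow> complex"
  assumes "summable (\<lambda>n. f n * of_real t ^ n)" "t > 0"
  obtains C where "\<And>n. norm (f n) \<le> C * (1 / t) ^ n" "C > 0"
proof -
  have "Bseq (\<lambda>n. f n * of_real t ^ n)"
    using summable_LIMSEQ_zero[OF assms(1)] convergentI by (intro convergent_imp_Bseq) blast
  then obtain C where C: "C > 0" "\<And>n. norm (f n * of_real t ^ n) \<le> C" by (auto elim: BseqE)
  have "norm (f n) \<le> C * (1 / t) ^ n" for n
    using C(2)[of n] assms(2) by (simp add: norm_mult norm_power field_simps power_divide)
  then show ?thesis using that C by blast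
qed

text \<open>\<open>s\<close> is chosen so that the coefficients decay like \<open>s\<^sup>2\<^sup>n\<close>; half of the rate is spent later on
  extracting decay in the truncation parameter.\<close>

lemma exp_newton_coefficients:
  fixes A :: "complex fps" and hs :: "nat \<Rightarrow> complex"
  assumes R: "1 < R" "ereal R \<le> fps_conv_radius A" and A0: "fps_nth A 0 = 0"
    and hs: "hs 0 = 1" "\<And>n. of_nat n * hs n = (\<Sum>k=1..n. of_nat k * fps_nth A k * hs (n - k))"
  obtains c C s where "0 < s" "s < 1" "0 < C"
    "\<And>n. norm (hs n) \<le> C * s ^ (2 * n)" "\<And>n. norm (c n) \<le> C * s ^ (2 * n)" "c 0 = 1"
    "\<And>n. n > 0 \<Longrightarrow> (\<Sum>k=0..n. c k * hs (n - k)) = 0"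
    "\<And>z. norm z = 1 \<Longrightarrow> (\<lambda>n. hs n * z ^ n) sums exp (eval_fps A z)"
    "\<And>z. norm z = 1 \<Longrightarrow> (\<lambda>n. c n * z ^ n) sums exp (- eval_fps A z)"
proof -
  have R0: "0 < R" using R by simp
  have Rm: "ereal R \<le> fps_conv_radius (- A)" using R by simp
  note P = has_fps_expansion_exp_eval_fps[OF R0 R(2)]
  note M = has_fps_expansion_exp_eval_fps[OF R0 Rm]
  define F where "F = fps_expansion (\<lambda>z. exp (eval_fps A z)) 0"
  define H where "H = fps_expansion (\<lambda>z. exp (eval_fps (- A) z)) 0"
  have evm: "eval_fps (- A) z = - eval_fps A z" if "norm z < R" for z
    by (rule eval_fps_minus) (rule less_le_trans[OF _ R(2)], use that in simp)
  have Fh: "fps_nth F n = hs n" for n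
  proof (rule newton_recursion_unique[where a = "\<lambda>k. of_nat k * fps_nth A k"])
    show "fps_nth F 0 = hs 0" using P(3) hs(1) A0 by (simp add: F_def)
  qed (use P(2) hs(2) in \<open>auto simp: F_def\<close>)
  have "(\<lambda>z. exp (eval_fps A z) * exp (eval_fps (- A) z)) has_fps_expansion F * H"
    unfolding F_def H_def by (rule has_fps_expansion_mult[OF P(1) M(1)])
  moreover have "eventually (\<lambda>z. exp (eval_fps A z) * exp (eval_fps (- A) z) = 1) (nhds 0)"
    unfolding eventually_nhds
    by (intro exI[of _ "ball 0 R"]) (use R0 in \<open>auto simp: evm exp_minus\<close>)
  ultimately have "(\<lambda>z. 1) has_fps_expansion F * H"
    by (subst (asm) has_fps_expansion_cong[OF _ refl])
  then have FH: "F * H = 1" by (rule fps_expansion_unique_complex) (rule has_fps_expansion_1)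
  \<comment> \<open>Any point strictly between 1 and R would do: convergence at t bounds the
    coefficients by a multiple of t^(-n).\<close>
  define t where "t = (1 + R) / 2"
  have t: "1 < t" "t < R" using R by (auto simp: t_def)
  have nt: "norm (of_real t :: complex) < R" using t by simp
  obtain C1 where C1: "\<And>n. norm (fps_nth F n) \<le> C1 * (1 / t) ^ n" "C1 > 0"
    using summable_imp_geometric_bound[OF sums_summable[OF P(4)[OF nt]]] t unfolding F_def by auto
  obtain C2 where C2: "\<And>n. norm (fps_nth H n) \<le> C2 * (1 / t) ^ n" "C2 > 0"
    using summable_imp_geometric_bound[OF sums_summable[OF M(4)[OF nt]]] t unfolding H_def by auto
  define s where "s = sqrt (1 / t)"
  have s2: "s ^ (2 * n) = (1 / t) ^ n" for n using t by (simp add: s_def power_mult)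
  have s: "0 < s" "s < 1" using t by (auto simp: s_def)
  show ?thesis
  proof (rule that[of s "max C1 C2" "fps_nth H"])
    show "norm (hs n) \<le> max C1 C2 * s ^ (2 * n)" for n
      unfolding s2 Fh[symmetric] by (rule order.trans[OF C1(1)]) (use t in \<open>auto intro: mult_right_mono\<close>)
    show "norm (fps_nth H n) \<le> max C1 C2 * s ^ (2 * n)" for n
      unfolding s2 by (rule order.trans[OF C2(1)]) (use t in \<open>auto intro: mult_right_mono\<close>)
    show "fps_nth H 0 = 1" using M(3) A0 by (simp add: H_def)
    show "(\<Sum>k=0..n. fps_nth H k * hs (n - k)) = 0" if "n > 0" for n
    proof -
      have "(\<Sum>k=0..n. fps_nth H k * hs (n - k)) = fps_nth (H * F) n"
        by (simp add: fps_mult_nth Fh)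
      also have "H * F = 1" using FH by (simp add: mult.commute)
      finally show ?thesis using that by simp
    qed
    fix z :: complex assume z: "norm z = 1"
    show "(\<lambda>n. hs n * z ^ n) sums exp (eval_fps A z)"
      using P(4)[of z] z R by (simp add: Fh[symmetric] F_def)
    show "(\<lambda>n. fps_nth H n * z ^ n) sums exp (- eval_fps A z)"
      using M(4)[of z] evm[of z] z R by (simp add: H_def)
  qed (use s C1 C2 in auto)
qed

section \<open>Finite projection ensembles\<close>

lemma fdet_scale: "fdet n (\<lambda>i j. c * F i j) = c ^ n * fdet n F"
  by (simp add: fdet_leibniz prod.distrib sum_distrib_left mult_ac)

section \<open>Partitions in a box and their tuples of positions\<close>

definition boxed :: "nat \<Rightarrow> nat \<Rightarrow> (nat \<Rightarrow> nat) set" where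
  "boxed N M = {l. antimono l \<and> (\<forall>i\<ge>N. l i = 0) \<and> l 0 \<le> M}"

text \<open>For a partition in \<open>boxed N M\<close> the first N positions range over {-N..<M};
  the remaining ones are frozen at the sites below -N.\<close>

definition pos :: "(nat \<Rightarrow> nat) \<Rightarrow> nat \<Rightarrow> int" where
  "pos l i = int (l i) - int i - 1"

lemma pos_strict: "antimono l \<Longrightarrow> i < j \<Longrightarrow> pos l j < pos l i"
  using antimonoD[of l i j] by (simp add: pos_def)

lemma inj_pos: "antimono l \<Longrightarrow> inj (pos l)"
  by (metis injI linorder_neqE_nat order_less_irrefl pos_strict)

lemma finite_boxed: "finite (boxed N M)"
proof (rule finite_subset)
  show "boxed N M \<subseteq> (\<lambda>f i. if i < N then f i else 0) ` PiE {..<N} (\<lambda>i. {..M})"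
  proof
    fix l assume l: "l \<in> boxed N M"
    then have "l i \<le> M" for i by (auto simp: boxed_def dest: antimonoD[of l 0 i])
    then show "l \<in> (\<lambda>f i. if i < N then f i else 0) ` PiE {..<N} (\<lambda>i. {..M})"
      using l by (intro image_eqI[of _ _ "restrict l {..<N}"]) (auto simp: boxed_def fun_eq_iff)
  qed
qed (intro finite_imageI finite_PiE; auto)

lemma pos_rank:
  assumes "antimono l" "i < N"
  shows "card {y \<in> pos l ` {0..<N}. y > pos l i} = i"
proof -
  have "{y \<in> pos l ` {0..<N}. y > pos l i} = pos l ` {0..<i}"
  proof (rule equalityI; rule subsetI)
    fix y assume "y \<in> {y \<in> pos l ` {0..<N}. y > pos l i}"
    then obtain k where k: "y = pos l k" "pos l i < pos l k" by auto
    then have "k < i" using pos_strict[OF assms(1), of i k] by (cases k i rule: linorder_cases) auto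
    with k show "y \<in> pos l ` {0..<i}" by auto
  qed (use assms pos_strict in auto)
  also have "card \<dots> = i"
    by (subst card_image) (auto intro: inj_on_subset[OF inj_pos[OF assms(1)]])
  finally show ?thesis .
qed

lemma boxed_permutation_inj:
  assumes "l \<in> boxed N M" "l' \<in> boxed N M" "p permutes {0..<N}" "p' permutes {0..<N}"
    and eq: "\<And>i. i < N \<Longrightarrow> pos l (p i) = pos l' (p' i)"
  shows "l = l' \<and> p = p'"
proof -
  have a: "antimono l" "antimono l'" using assms by (auto simp: boxed_def)
  have im: "pos l ` {0..<N} = pos l' ` {0..<N}"
  proof -
    have "pos l ` {0..<N} = pos l ` p ` {0..<N}" using permutes_image[OF assms(3)] by simp
    also have "\<dots> = pos l' ` p' ` {0..<N}" using eq by (force simp: image_image)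
    also have "\<dots> = pos l' ` {0..<N}" using permutes_image[OF assms(4)] by simp
    finally show ?thesis .
  qed
  have pe: "pos l i = pos l' i" if "i < N" for i
  proof -
    have "pos l i \<in> pos l' ` {0..<N}" using that im[symmetric] by auto
    then obtain k where k: "pos l i = pos l' k" "k < N" by auto
    have "i = card {y \<in> pos l ` {0..<N}. y > pos l i}" using pos_rank[OF a(1) that] ..
    also have "\<dots> = card {y \<in> pos l' ` {0..<N}. y > pos l' k}" by (simp only: im k(1))
    also have "\<dots> = k" by (rule pos_rank[OF a(2) k(2)])
    finally show ?thesis using k by simp
  qed
  have "l = l'"
  proof
    fix i show "l i = l' i"
    proof (cases "i < N")
      case True
      then show ?thesis using pe[of i] by (simp add: pos_def)
    next
      case False
      then have "l i = 0" "l' i = 0" using assms(1,2) by (simp_all add: boxed_def)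
      then show ?thesis by simp
    qed
  qed
  moreover have "p = p'"
  proof
    fix i show "p i = p' i"
    proof (cases "i < N")
      case True
      then have "pos l (p i) = pos l (p' i)" using eq[of i] \<open>l = l'\<close> by simp
      then show ?thesis by (rule injD[OF inj_pos[OF a(1)]])
    next
      case False
      then have "i \<notin> {0..<N}" by simp
      then have "p i = i" "p' i = i"
        by (rule permutes_not_in[OF assms(3)], rule permutes_not_in[OF assms(4)])
      then show ?thesis by (rule trans[OF _ sym])
    qed
  qed
  ultimately show ?thesis ..
qed

text \<open>Sorting. \<open>r i\<close> counts the larger entries, so it is the place of
  \<open>a i\<close> in decreasing order, and \<open>q\<close> inverts it. Adding i + 1 turns the
  strictly decreasing list \<open>b\<close> into weakly decreasing parts that fit in the
  box.\<close>

lemma injective_tuple_sorted: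
  fixes a :: "nat \<Rightarrow> int"
  assumes inj: "inj_on a {0..<N}" and ran: "\<And>i. i < N \<Longrightarrow> - int N \<le> a i \<and> a i < int M"
  shows "\<exists>l p. l \<in> boxed N M \<and> p permutes {0..<N} \<and> (\<forall>i<N. a i = pos l (p i))"
proof -
  define r where "r i = (if i < N then card {j \<in> {0..<N}. a j > a i} else i)" for i
  have r_less: "r i < N" if "i < N" for i
  proof -
    have "i \<in> {0..<N}" "i \<notin> {j \<in> {0..<N}. a j > a i}" using that by simp_all
    then have "{j \<in> {0..<N}. a j > a i} \<subset> {0..<N}" by blast
    then have "card {j \<in> {0..<N}. a j > a i} < card {0..<N}" by (rule psubset_card_mono[rotated]) simp
    then show ?thesis using that by (simp add: r_def)
  qed
  have r_mono: "r i < r j" if "i < N" "j < N" "a i > a j" for i j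
  proof -
    have "{k \<in> {0..<N}. a k > a i} \<subseteq> {k \<in> {0..<N}. a k > a j}" using that(3) by force
    moreover have "i \<in> {k \<in> {0..<N}. a k > a j}" "i \<notin> {k \<in> {0..<N}. a k > a i}" using that by simp_all
    ultimately have "{k \<in> {0..<N}. a k > a i} \<subset> {k \<in> {0..<N}. a k > a j}" by blast
    then show ?thesis using that by (simp add: r_def psubset_card_mono)
  qed
  have r_inj: "inj_on r {0..<N}"
  proof (rule inj_onI)
    fix i j assume ij: "i \<in> {0..<N}" "j \<in> {0..<N}" "r i = r j"
    then have "a i = a j" using r_mono[of i j] r_mono[of j i] by (cases "a i" "a j" rule: linorder_cases) auto
    then show "i = j" using inj ij by (auto dest: inj_onD)
  qed
  have r_perm: "r permutes {0..<N}"
  proof (rule bij_imp_permutes)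
    have "r ` {0..<N} = {0..<N}" by (rule endo_inj_surj) (use r_less r_inj in auto)
    then show "bij_betw r {0..<N} {0..<N}" using r_inj by (simp add: bij_betw_def)
  qed (auto simp: r_def)
  define q where "q = inv_into UNIV r"
  have q_perm: "q permutes {0..<N}" unfolding q_def by (rule permutes_inv[OF r_perm])
  have qr: "q (r i) = i" "r (q i) = i" for i
    unfolding q_def by (simp_all add: permutes_inverses[OF r_perm])
  have q_less: "q i < N" if "i < N" for i using permutes_in_image[OF q_perm, of i] that by simp
  define b where "b i = a (q i)" for i
  have b_dec: "b (Suc i) < b i" if "Suc i < N" for i
  proof (rule ccontr)
    assume "\<not> b (Suc i) < b i"
    then consider "b i = b (Suc i)" | "b i < b (Suc i)" by linarith
    then show False
    proof cases
      case 1
      then have "q i = q (Suc i)" unfolding b_def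
        by (intro inj_onD[OF inj]) (use q_less that in auto)
      then show False using qr(2) by (metis n_not_Suc_n)
    next
      case 2
      then have "r (q (Suc i)) < r (q i)" unfolding b_def
        by (intro r_mono) (use q_less that in auto)
      then show False using qr by simp
    qed
  qed
  have b_mono: "b j + int j \<le> b i + int i" if "i \<le> j" "j < N" for i j
    using that
  proof (induction j rule: dec_induct)
    case (step k)
    then show ?case using b_dec[of k] by simp
  qed simp
  have b_ge: "b i + int i + 1 \<ge> 0" if "i < N" for i
  proof -
    have "b (N - 1) + int (N - 1) \<le> b i + int i" by (rule b_mono) (use that in auto)
    moreover have "b (N - 1) \<ge> - int N" unfolding b_def using ran q_less[of "N - 1"] that by auto
    ultimately show ?thesis using that by (auto simp: of_nat_diff)
  qed
  define l where "l i = (if i < N then nat (b i + int i + 1) else 0)" for i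
  have "antimono l"
    unfolding antimono_iff_le_Suc
  proof
    fix i show "l (Suc i) \<le> l i"
      using b_mono[of i "Suc i"] by (auto simp: l_def nat_le_iff)
  qed
  moreover have "l 0 \<le> M"
    using ran[OF q_less[of 0]] by (auto simp: l_def b_def nat_le_iff)
  ultimately have "l \<in> boxed N M" by (auto simp: boxed_def l_def)
  moreover have "a i = pos l (r i)" if "i < N" for i
    using that r_less[OF that] b_ge[of "r i"] by (simp add: pos_def l_def b_def qr)
  ultimately show ?thesis using r_perm by blast
qed

text \<open>A tuple without repetitions lists the positions of exactly one boxed partition, in
  exactly one order. A symmetric F that vanishes on repetitions thus counts every partition N!
  times.\<close>

lemma sum_tuples_eq_sum_boxed:
  fixes F :: "(nat \<Rightarrow> int) \<Rightarrow> complex"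
  assumes cong: "\<And>a b. (\<And>i. i < N \<Longrightarrow> a i = b i) \<Longrightarrow> F a = F b"
    and sym: "\<And>a p. p permutes {0..<N} \<Longrightarrow> F (\<lambda>i. a (p i)) = F a"
    and ninj: "\<And>a. \<not> inj_on a {0..<N} \<Longrightarrow> F a = 0"
  shows "(\<Sum>a\<in>PiE {0..<N} (\<lambda>_. {- int N..<int M}). F a) = of_nat (fact N) * (\<Sum>l\<in>boxed N M. F (pos l))"
proof -
  let ?E = "PiE {0..<N} (\<lambda>_. {- int N..<int M})" and ?P = "{p. p permutes {0..<N}}"
  let ?T = "\<lambda>(l, p). restrict (\<lambda>i. pos l (p i)) {0..<N}"
  have im: "?T ` (boxed N M \<times> ?P) = {a \<in> ?E. inj_on a {0..<N}}"
  proof (rule equalityI; rule subsetI)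
    fix a assume "a \<in> ?T ` (boxed N M \<times> ?P)"
    then obtain l p where lp: "l \<in> boxed N M" "p permutes {0..<N}" "a = restrict (\<lambda>i. pos l (p i)) {0..<N}"
      by auto
    have pN: "p i < N" if "i < N" for i using permutes_in_image[OF lp(2), of i] that by simp
    have "- int N \<le> pos l i \<and> pos l i < int M" if "i < N" for i
    proof -
      have "l i \<le> l 0" using lp(1) by (auto simp: boxed_def dest: antimonoD[of l 0 i])
      then show ?thesis using that lp(1) by (auto simp: boxed_def pos_def)
    qed
    then have "a \<in> ?E" using pN lp(3) by auto
    moreover have "inj_on a {0..<N}"
    proof (rule inj_onI)
      fix i j assume "i \<in> {0..<N}" "j \<in> {0..<N}" "a i = a j"
      then have "pos l (p i) = pos l (p j)" using lp(3) by simp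
      then have "p i = p j" using inj_pos lp(1) by (auto simp: boxed_def dest: injD)
      then show "i = j" using permutes_inj[OF lp(2)] by (auto dest: injD)
    qed
    ultimately show "a \<in> {a \<in> ?E. inj_on a {0..<N}}" by simp
  next
    fix a assume "a \<in> {a \<in> ?E. inj_on a {0..<N}}"
    then have a: "a \<in> ?E" "inj_on a {0..<N}" by auto
    obtain l p where lp: "l \<in> boxed N M" "p permutes {0..<N}" "\<forall>i<N. a i = pos l (p i)"
      using injective_tuple_sorted[OF a(2), of M] a(1) by (auto simp: PiE_iff)
    have "a = restrict (\<lambda>i. pos l (p i)) {0..<N}"
      using a(1) lp(3) by (intro extensionalityI[of _ "{0..<N}"]) (auto simp: PiE_iff)
    with lp show "a \<in> ?T ` (boxed N M \<times> ?P)" by auto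
  qed
  have inj: "inj_on ?T (boxed N M \<times> ?P)"
  proof (rule inj_onI)
    fix x y assume xy: "x \<in> boxed N M \<times> ?P" "y \<in> boxed N M \<times> ?P" "?T x = ?T y"
    obtain l p where x: "x = (l, p)" by (cases x)
    obtain l' p' where y: "y = (l', p')" by (cases y)
    have "pos l (p i) = pos l' (p' i)" if "i < N" for i
      using fun_cong[OF xy(3), of i] that x y by simp
    then show "x = y" using boxed_permutation_inj[of l N M l' p p'] xy x y by auto
  qed
  have "(\<Sum>a\<in>?E. F a) = (\<Sum>a\<in>{a \<in> ?E. inj_on a {0..<N}}. F a)"
    by (rule sum.mono_neutral_right) (use ninj in \<open>auto intro!: finite_PiE\<close>)
  also have "\<dots> = (\<Sum>x\<in>boxed N M \<times> ?P. F (?T x))"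
    unfolding im[symmetric] by (subst sum.reindex[OF inj]) (simp add: o_def)
  also have "\<dots> = (\<Sum>x\<in>boxed N M \<times> ?P. F (pos (fst x)))"
  proof (intro sum.cong refl)
    fix x assume x: "x \<in> boxed N M \<times> ?P"
    have "F (?T x) = F (\<lambda>i. pos (fst x) (snd x i))"
      by (rule cong) (auto split: prod.splits)
    also have "\<dots> = F (pos (fst x))" by (rule sym) (use x in auto)
    finally show "F (?T x) = F (pos (fst x))" .
  qed
  also have "\<dots> = (\<Sum>l\<in>boxed N M. \<Sum>p\<in>?P. F (pos l))"
    by (subst sum.cartesian_product) (simp add: case_prod_beta)
  also have "\<dots> = of_nat (fact N) * (\<Sum>l\<in>boxed N M. F (pos l))"
    by (simp add: card_permutations sum_distrib_left)
  finally show ?thesis .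
qed

text \<open>Andreief's identity after removal of the ordering; the factor N! cancels. The weight g
  makes this a generating function of multiplicative statistics, from which correlations are
  extracted.\<close>

lemma sum_boxed_gram:
  fixes \<phi> :: "nat \<Rightarrow> int \<Rightarrow> complex"
  shows "(\<Sum>l\<in>boxed N M. (\<Prod>i=0..<N. g (pos l i)) *
      (fdet N (\<lambda>i j. \<phi> j (pos l i)) * cnj (fdet N (\<lambda>i j. \<phi> j (pos l i))))) =
    fdet N (\<lambda>j k. \<Sum>x\<in>{- int N..<int M}. g x * \<phi> j x * cnj (\<phi> k x))"
    (is "?L = ?R")
proof -
  let ?F = "\<lambda>a. (\<Prod>i=0..<N. g (a i)) * (fdet N (\<lambda>i j. \<phi> j (a i)) * fdet N (\<lambda>i j. cnj (\<phi> j (a i))))"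
  have "of_nat (fact N) * (\<Sum>l\<in>boxed N M. ?F (pos l)) =
      (\<Sum>a\<in>PiE {0..<N} (\<lambda>_. {- int N..<int M}). ?F a)"
  proof (rule sum_tuples_eq_sum_boxed[symmetric])
    fix a b :: "nat \<Rightarrow> int" assume ab: "\<And>i. i < N \<Longrightarrow> a i = b i"
    have "fdet N (\<lambda>i j. \<phi> j (a i)) = fdet N (\<lambda>i j. \<phi> j (b i))"
      "fdet N (\<lambda>i j. cnj (\<phi> j (a i))) = fdet N (\<lambda>i j. cnj (\<phi> j (b i)))"
      by (rule fdet_cong, simp add: ab)+
    then show "?F a = ?F b" using ab by simp
  next
    fix a :: "nat \<Rightarrow> int" and p assume p: "p permutes {0..<N}"
    have "(\<Prod>i=0..<N. g (a (p i))) = (\<Prod>i=0..<N. g (a i))"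
      using prod.permute[OF p, of "\<lambda>i. g (a i)"] by (simp add: o_def)
    moreover have "fdet N (\<lambda>i j. \<phi> j (a (p i))) = signof p * fdet N (\<lambda>i j. \<phi> j (a i))"
      by (rule fdet_permute_rows[OF p])
    moreover have "fdet N (\<lambda>i j. cnj (\<phi> j (a (p i)))) = signof p * fdet N (\<lambda>i j. cnj (\<phi> j (a i)))"
      by (rule fdet_permute_rows[OF p])
    ultimately show "?F (\<lambda>i. a (p i)) = ?F a"
      using signof_mult_self[of p, where 'a=complex] by (simp add: mult_ac)
  next
    fix a :: "nat \<Rightarrow> int" assume "\<not> inj_on a {0..<N}"
    then obtain i j where "i \<noteq> j" "i < N" "j < N" "a i = a j" by (auto simp: inj_on_def)
    then have "fdet N (\<lambda>i j. \<phi> j (a i)) = 0"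
      by (intro fdet_identical_rows[of i j]) auto
    then show "?F a = 0" by simp
  qed
  also have "\<dots> = of_nat (fact N) * ?R"
    by (rule fdet_andreief) simp
  finally have "(\<Sum>l\<in>boxed N M. ?F (pos l)) = ?R" by (simp del: of_nat_fact)
  then show ?thesis by (simp add: cnj_fdet)
qed

section \<open>Orthogonal projections built from an inverse Gram matrix\<close>

lemma sum_mult_delta:
  fixes f :: "nat \<Rightarrow> complex"
  assumes "i < N"
  shows "(\<Sum>k=0..<N. f k * (if k = i then 1 else 0)) = f i"
    "(\<Sum>k=0..<N. f k * (if i = k then 1 else 0)) = f i"
    "(\<Sum>k=0..<N. (if k = i then 1 else 0) * f k) = f i"
    "(\<Sum>k=0..<N. (if i = k then 1 else 0) * f k) = f i"
  using assms
  by (simp_all add: if_distrib[of "\<lambda>x. _ * x"] if_distrib[of "\<lambda>x. x * _"] cong: if_cong)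

lemma sum_product_assoc:
  "(\<Sum>k\<in>A. a k * (\<Sum>r\<in>B. b k r * c r)) = (\<Sum>r\<in>B. (\<Sum>k\<in>A. a k * b k r) * (c r :: complex))"
  unfolding sum_distrib_left sum_distrib_right by (subst sum.swap) (simp add: mult.assoc)

lemma sum_product_rearrange:
  "c * (\<Sum>i\<in>I. (\<Sum>r\<in>R. g r * S r i) * b i) = (\<Sum>r\<in>R. \<Sum>i\<in>I. g r * ((c * S r i) * (b i :: complex)))"
  unfolding sum_distrib_left sum_distrib_right by (subst sum.swap) (simp add: mult_ac)

locale gram_projection =
  fixes W :: "'x set" and N :: nat and \<phi> :: "nat \<Rightarrow> 'x \<Rightarrow> complex"
    and Q :: "nat \<Rightarrow> nat \<Rightarrow> complex"
  assumes fin: "finite W"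
    and GQ: "\<And>i j. i < N \<Longrightarrow> j < N \<Longrightarrow>
      (\<Sum>k=0..<N. (\<Sum>x\<in>W. \<phi> i x * cnj (\<phi> k x)) * Q k j) = (if i = j then 1 else 0)"
    and QG: "\<And>i j. i < N \<Longrightarrow> j < N \<Longrightarrow>
      (\<Sum>k=0..<N. Q i k * (\<Sum>x\<in>W. \<phi> k x * cnj (\<phi> j x))) = (if i = j then 1 else 0)"
begin

abbreviation "G i k \<equiv> \<Sum>x\<in>W. \<phi> i x * cnj (\<phi> k x)"

text \<open>The orthogonal projection onto the span of the functions cnj (\<phi> k), k < N. The
  conjugate sits on the first argument, which fixes the orientation of all later kernels.\<close>

definition P :: "'x \<Rightarrow> 'x \<Rightarrow> complex" where
  "P x y = (\<Sum>k=0..<N. \<Sum>j=0..<N. cnj (\<phi> k x) * Q k j * \<phi> j y)"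

text \<open>The Gram matrix is Hermitian, so the adjoint of \<open>Q\<close> is a right inverse of
  it, and a left inverse equals every right inverse.\<close>

lemma Q_hermitian:
  assumes "i < N" "j < N"
  shows "cnj (Q i j) = Q j i"
proof -
  have G: "cnj (G i k) = G k i" for i k by (simp add: mult.commute)
  have GQ': "(\<Sum>k=0..<N. G i k * cnj (Q j k)) = (if i = j then 1 else 0)" if "i < N" "j < N" for i j
  proof -
    have "cnj (\<Sum>k=0..<N. Q j k * G k i) = (\<Sum>k=0..<N. cnj (Q j k * G k i))"
      by (rule cnj_sum)
    also have "\<dots> = (\<Sum>k=0..<N. G i k * cnj (Q j k))"
      by (rule sum.cong[OF refl], subst complex_cnj_mult, subst G, rule mult.commute)
    finally have "(\<Sum>k=0..<N. G i k * cnj (Q j k)) = cnj (\<Sum>k=0..<N. Q j k * G k i)" ..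
    then show ?thesis using QG[OF that(2,1)] by (simp split: if_splits)
  qed
  have "Q j i = (\<Sum>k=0..<N. Q j k * (if k = i then 1 else 0))" using assms by (simp only: sum_mult_delta)
  also have "\<dots> = (\<Sum>k=0..<N. Q j k * (\<Sum>r=0..<N. G k r * cnj (Q i r)))"
    by (intro sum.cong refl) (use GQ' assms in auto)
  also have "\<dots> = (\<Sum>r=0..<N. (\<Sum>k=0..<N. Q j k * G k r) * cnj (Q i r))"
    by (rule sum_product_assoc)
  also have "\<dots> = (\<Sum>r=0..<N. (if j = r then 1 else 0) * cnj (Q i r))"
    by (intro sum.cong refl) (use QG assms in auto)
  also have "\<dots> = cnj (Q i j)" using assms by (simp only: sum_mult_delta)
  finally show ?thesis ..
qed

lemma P_apply:
  "(\<Sum>y\<in>W. P x y * u y) = (\<Sum>k=0..<N. \<Sum>j=0..<N. cnj (\<phi> k x) * Q k j * (\<Sum>y\<in>W. \<phi> j y * u y))"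
  unfolding P_def sum_distrib_right sum_distrib_left
  by (subst sum.swap, rule sum.cong[OF refl], subst sum.swap) (simp add: mult_ac)

lemma P_reproduces:
  assumes "i < N"
  shows "(\<Sum>y\<in>W. P x y * cnj (\<phi> i y)) = cnj (\<phi> i x)"
proof -
  have "(\<Sum>y\<in>W. P x y * cnj (\<phi> i y)) = (\<Sum>k=0..<N. cnj (\<phi> k x) * (\<Sum>j=0..<N. Q k j * G j i))"
    unfolding P_apply by (simp only: sum_distrib_left mult.assoc)
  also have "\<dots> = (\<Sum>k=0..<N. cnj (\<phi> k x) * (if k = i then 1 else 0))"
    by (intro sum.cong refl) (use QG assms in auto)
  finally show ?thesis using assms by (simp only: sum_mult_delta)
qed

lemma P_annihilates:
  assumes "\<And>j. j < N \<Longrightarrow> (\<Sum>y\<in>W. \<phi> j y * u y) = 0"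
  shows "(\<Sum>y\<in>W. P x y * u y) = 0"
  unfolding P_apply by (intro sum.neutral ballI) (use assms in auto)

lemma P_hermitian: "cnj (P x y) = P y x"
proof -
  have "cnj (P x y) = (\<Sum>k=0..<N. \<Sum>j=0..<N. cnj (\<phi> j y) * Q j k * \<phi> k x)"
    unfolding P_def cnj_sum by (intro sum.cong refl) (simp add: Q_hermitian)
  also have "\<dots> = P y x" unfolding P_def by (rule sum.swap)
  finally show ?thesis .
qed

lemma P_idem: "(\<Sum>y\<in>W. P x y * P y z) = P x z"
proof -
  have "(\<Sum>y\<in>W. P x y * P y z) =
      (\<Sum>y\<in>W. \<Sum>k=0..<N. P x y * cnj (\<phi> k y) * (\<Sum>j=0..<N. Q k j * \<phi> j z))"
    unfolding P_def[of _ z] by (simp only: sum_distrib_left mult.assoc)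
  also have "\<dots> = (\<Sum>k=0..<N. (\<Sum>y\<in>W. P x y * cnj (\<phi> k y)) * (\<Sum>j=0..<N. Q k j * \<phi> j z))"
    by (subst sum.swap) (simp only: sum_distrib_right)
  also have "\<dots> = (\<Sum>k=0..<N. cnj (\<phi> k x) * (\<Sum>j=0..<N. Q k j * \<phi> j z))"
    by (intro sum.cong refl) (simp add: P_reproduces)
  also have "\<dots> = P x z"
    unfolding P_def by (simp only: sum_distrib_left mult.assoc)
  finally show ?thesis .
qed

lemma sum_norm_P: "(\<Sum>y\<in>W. (norm (P x y))\<^sup>2) = Re (P x x)"
proof -
  have "complex_of_real (\<Sum>y\<in>W. (norm (P x y))\<^sup>2) = (\<Sum>y\<in>W. P x y * P y x)"
    unfolding of_real_sum by (rule sum.cong[OF refl]) (simp only: complex_norm_square P_hermitian)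
  also have "\<dots> = P x x" by (rule P_idem)
  finally show ?thesis by (metis Re_complex_of_real)
qed

text \<open>The diagonal entry is the squared norm of its row, and that row contains the entry
  itself.\<close>

lemma P_diag_le_1:
  assumes "x \<in> W"
  shows "Re (P x x) \<le> 1"
proof -
  have "(Re (P x x))\<^sup>2 \<le> (norm (P x x))\<^sup>2"
    by (rule abs_le_square_iff[THEN iffD1]) (simp add: abs_Re_le_cmod)
  also have "\<dots> \<le> (\<Sum>y\<in>W. (norm (P x y))\<^sup>2)"
    by (rule member_le_sum[of x]) (use assms fin in auto)
  also have "\<dots> = Re (P x x)" by (rule sum_norm_P)
  finally have "Re (P x x) * Re (P x x) \<le> 1 * Re (P x x)" by (simp add: power2_eq_square)
  then show ?thesis by (cases "Re (P x x) > 0") (auto dest: mult_right_le_imp_le)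
qed

lemma sum_norm_P_le_1: "x \<in> W \<Longrightarrow> (\<Sum>y\<in>W. (norm (P x y))\<^sup>2) \<le> 1"
  using sum_norm_P P_diag_le_1 by simp

lemma P_contractive:
  assumes "x \<in> W"
  shows "(norm (\<Sum>y\<in>W. P x y * u y))\<^sup>2 \<le> (\<Sum>y\<in>W. (norm (u y))\<^sup>2)"
proof -
  have "(norm (\<Sum>y\<in>W. P x y * u y))\<^sup>2 \<le> (\<Sum>y\<in>W. norm (P x y) * norm (u y))\<^sup>2"
    by (intro power_mono order.trans[OF norm_sum]) (auto simp: norm_mult)
  also have "\<dots> \<le> (\<Sum>y\<in>W. (norm (P x y))\<^sup>2) * (\<Sum>y\<in>W. (norm (u y))\<^sup>2)"
    by (rule Cauchy_Schwarz_ineq_sum)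
  also have "\<dots> \<le> 1 * (\<Sum>y\<in>W. (norm (u y))\<^sup>2)"
    by (intro mult_right_mono sum_norm_P_le_1 assms sum_nonneg) auto
  finally show ?thesis by simp
qed

end

lemma prod_marked_points:
  fixes a :: "nat \<Rightarrow> 'x"
  assumes "inj_on a {0..<N}"
  shows "(\<Prod>i=0..<N. if a i \<in> D then t else (1::complex)) = t ^ card (a ` {0..<N} \<inter> D)"
proof -
  have "(\<Prod>i=0..<N. if a i \<in> D then t else (1::complex)) = (\<Prod>x\<in>a ` {0..<N}. if x \<in> D then t else 1)"
    using assms by (simp add: prod.reindex)
  also have "\<dots> = (\<Prod>x\<in>a ` {0..<N} \<inter> {x. x \<in> D}. t) * (\<Prod>x\<in>a ` {0..<N} \<inter> - {x. x \<in> D}. 1)"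
    by (rule prod.If_cases) simp
  also have "\<dots> = t ^ card (a ` {0..<N} \<inter> D)" by simp
  finally show ?thesis .
qed

text \<open>Giving the points of \<open>ms\<close> the weight
  \<open>1/s\<close> and letting \<open>s \<rightarrow> 0\<close> isolates the configurations containing all of them.\<close>

lemma finite_correlation:
  fixes \<phi> :: "nat \<Rightarrow> int \<Rightarrow> complex"
  assumes gp: "gram_projection {- int N..<int M} N \<phi> Q"
    and ms: "distinct ms" "set ms \<subseteq> {- int N..<int M}"
  shows "(\<Sum>l | l \<in> boxed N M \<and> set ms \<subseteq> pos l ` {0..<N}.
      fdet N (\<lambda>i j. \<phi> j (pos l i)) * cnj (fdet N (\<lambda>i j. \<phi> j (pos l i)))) =
    fdet N (\<lambda>j k. \<Sum>x\<in>{- int N..<int M}. \<phi> j x * cnj (\<phi> k x)) *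
    fdet (length ms) (\<lambda>i j. gram_projection.P N \<phi> Q (ms ! i) (ms ! j))"
proof -
  interpret gram_projection "{- int N..<int M}" N \<phi> Q by (rule gp)
  let ?W = "{- int N..<int M}" and ?n = "length ms"
  define w where "w l = fdet N (\<lambda>i j. \<phi> j (pos l i)) * cnj (fdet N (\<lambda>i j. \<phi> j (pos l i)))" for l
  define c where "c l = card (pos l ` {0..<N} \<inter> set ms)" for l
  have c_le: "c l \<le> ?n" for l
    unfolding c_def using card_mono[of "set ms" "pos l ` {0..<N} \<inter> set ms"] distinct_card[OF ms(1)] by simp
  have c_eq: "c l = ?n \<longleftrightarrow> set ms \<subseteq> pos l ` {0..<N}" for l
  proof
    assume "c l = ?n"
    then have "pos l ` {0..<N} \<inter> set ms = set ms"
      unfolding c_def by (intro card_subset_eq) (auto simp: distinct_card[OF ms(1)])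
    then show "set ms \<subseteq> pos l ` {0..<N}" by blast
  next
    assume "set ms \<subseteq> pos l ` {0..<N}"
    then have "pos l ` {0..<N} \<inter> set ms = set ms" by blast
    then show "c l = ?n" by (simp add: c_def distinct_card[OF ms(1)])
  qed
  \<comment> \<open>Multiplying by s^n clears all denominators, so both sides are polynomials in s
    and the limit s -> 0 makes sense.\<close>
  have main: "(\<Sum>l\<in>boxed N M. s ^ (?n - c l) * w l) =
      fdet N G * fdet ?n (\<lambda>i j. (if i = j then s else 0) + (1 - s) * P (ms ! i) (ms ! j))"
    if s: "s \<noteq> 0" for s :: complex
  proof -
    let ?g = "\<lambda>x. if x \<in> set ms then 1 / s else 1"
    \<comment> \<open>Reweighting the points of \<open>ms\<close> changes the Gram matrix G into G
      (1 + AB), where AB factors through n dimensions, n being the number of points. Sylvester's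
      identity then replaces the N x N determinant of 1 + AB by an n x n one whose entries are
      values of \<open>P\<close>.\<close>
    let ?A = "\<lambda>r i. (1 / s - 1) * (\<Sum>q=0..<N. Q r q * \<phi> q (ms ! i))"
    let ?B = "\<lambda>i k. cnj (\<phi> k (ms ! i))"
    have "(\<Sum>l\<in>boxed N M. s ^ (?n - c l) * w l) = s ^ ?n * (\<Sum>l\<in>boxed N M. (\<Prod>i=0..<N. ?g (pos l i)) * w l)"
      unfolding sum_distrib_left
    proof (intro sum.cong refl)
      fix l assume "l \<in> boxed N M"
      then have "(\<Prod>i=0..<N. ?g (pos l i)) = (1 / s) ^ c l"
        unfolding c_def by (intro prod_marked_points inj_on_subset[OF inj_pos]) (auto simp: boxed_def)
      moreover have "s ^ (?n - c l) = s ^ ?n * (1 / s) ^ c l"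
        using s c_le[of l] by (simp add: power_diff power_one_over divide_simps)
      ultimately show "s ^ (?n - c l) * w l = s ^ ?n * ((\<Prod>i=0..<N. ?g (pos l i)) * w l)" by simp
    qed
    also have "(\<Sum>l\<in>boxed N M. (\<Prod>i=0..<N. ?g (pos l i)) * w l) =
        fdet N (\<lambda>j k. \<Sum>x\<in>?W. ?g x * \<phi> j x * cnj (\<phi> k x))"
      unfolding w_def by (rule sum_boxed_gram)
    also have "\<dots> = fdet N (\<lambda>j k. \<Sum>r=0..<N. G j r * ((if r = k then 1 else 0) + (\<Sum>i=0..<?n. ?A r i * ?B i k)))"
    proof (rule fdet_cong)
      fix j k assume jk: "j < N" "k < N"
      have "(\<Sum>x\<in>?W. ?g x * \<phi> j x * cnj (\<phi> k x)) =
          (\<Sum>x\<in>?W. \<phi> j x * cnj (\<phi> k x) + (if x \<in> set ms then (1 / s - 1) * (\<phi> j x * cnj (\<phi> k x)) else 0))"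
        by (intro sum.cong refl) (simp add: algebra_simps)
      also have "\<dots> = G j k + (1 / s - 1) * (\<Sum>x\<in>set ms. \<phi> j x * cnj (\<phi> k x))"
        using ms(2) by (simp add: sum.distrib sum.If_cases Int_absorb1 sum_distrib_left)
      also have "(\<Sum>x\<in>set ms. \<phi> j x * cnj (\<phi> k x)) = (\<Sum>i=0..<?n. \<phi> j (ms ! i) * cnj (\<phi> k (ms ! i)))"
        using ms(1) by (intro sum.reindex_bij_betw[symmetric] bij_betw_nth) (auto simp: lessThan_atLeast0)
      also have "\<dots> = (\<Sum>i=0..<?n. (\<Sum>r=0..<N. G j r * (\<Sum>q=0..<N. Q r q * \<phi> q (ms ! i))) * ?B i k)"
      proof (intro sum.cong refl arg_cong2[of _ _ _ _ "(*)"])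
        fix i
        have "(\<Sum>r=0..<N. G j r * (\<Sum>q=0..<N. Q r q * \<phi> q (ms ! i))) =
            (\<Sum>q=0..<N. (\<Sum>r=0..<N. G j r * Q r q) * \<phi> q (ms ! i))"
          by (rule sum_product_assoc)
        also have "\<dots> = (\<Sum>q=0..<N. (if j = q then 1 else 0) * \<phi> q (ms ! i))"
          by (intro sum.cong refl) (use GQ jk in auto)
        also have "\<dots> = \<phi> j (ms ! i)" using jk by (simp only: sum_mult_delta)
        finally show "\<phi> j (ms ! i) = (\<Sum>r=0..<N. G j r * (\<Sum>q=0..<N. Q r q * \<phi> q (ms ! i)))" ..
      qed
      also have "G j k + (1 / s - 1) * \<dots> = (\<Sum>r=0..<N. G j r * (if r = k then 1 else 0)) +
          (\<Sum>r=0..<N. \<Sum>i=0..<?n. G j r * (?A r i * ?B i k))"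
        unfolding sum_product_rearrange sum_mult_delta(1)[OF jk(2)] ..
      finally show "(\<Sum>x\<in>?W. ?g x * \<phi> j x * cnj (\<phi> k x)) =
          (\<Sum>r=0..<N. G j r * ((if r = k then 1 else 0) + (\<Sum>i=0..<?n. ?A r i * ?B i k)))"
        by (simp only: distrib_left sum.distrib sum_distrib_left)
    qed
    also have "\<dots> = fdet N G * fdet N (\<lambda>r k. (if r = k then 1 else 0) + (\<Sum>i=0..<?n. ?A r i * ?B i k))"
      by (rule fdet_mult)
    also have "fdet N (\<lambda>r k. (if r = k then 1 else 0) + (\<Sum>i=0..<?n. ?A r i * ?B i k)) =
        fdet ?n (\<lambda>i j. (if i = j then 1 else 0) + (\<Sum>r=0..<N. ?B i r * ?A r j))"
      by (rule fdet_sylvester)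
    also have "(\<lambda>i j. \<Sum>r=0..<N. ?B i r * ?A r j) = (\<lambda>i j. (1 / s - 1) * P (ms ! i) (ms ! j))"
      by (intro ext) (simp add: P_def sum_distrib_left mult_ac)
    then have "fdet ?n (\<lambda>i j. (if i = j then 1 else 0) + (\<Sum>r=0..<N. ?B i r * ?A r j)) =
        fdet ?n (\<lambda>i j. (if i = j then 1 else 0) + (1 / s - 1) * P (ms ! i) (ms ! j))"
      by (intro fdet_cong arg_cong2[of _ _ _ _ "(+)"] refl) (metis)
    also have "s ^ ?n * (fdet N G * \<dots>) = fdet N G * fdet ?n (\<lambda>i j. s * ((if i = j then 1 else 0) + (1 / s - 1) * P (ms ! i) (ms ! j)))"
      by (simp add: fdet_scale)
    also have "(\<lambda>i j. s * ((if i = j then 1 else 0) + (1 / s - 1) * P (ms ! i) (ms ! j))) =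
        (\<lambda>i j. (if i = j then s else 0) + (1 - s) * P (ms ! i) (ms ! j))"
      using s by (intro ext) (simp add: field_simps)
    finally show ?thesis .
  qed
  \<comment> \<open>At s = 0 the factor 0 ^ (n - c l) is 1 exactly when c l = n, that is, when the
    configuration contains all of \<open>ms\<close>.\<close>
  have L: "((\<lambda>s. \<Sum>l\<in>boxed N M. s ^ (?n - c l) * w l) \<longlongrightarrow> (\<Sum>l\<in>boxed N M. 0 ^ (?n - c l) * w l)) (at 0)"
    by (intro tendsto_intros)
  have "((\<lambda>s. fdet N G * fdet ?n (\<lambda>i j. (if i = j then s else 0) + (1 - s) * P (ms ! i) (ms ! j))) \<longlongrightarrow>
      fdet N G * fdet ?n (\<lambda>i j. (if i = j then 0 else 0) + (1 - 0) * P (ms ! i) (ms ! j))) (at 0)"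
  proof (intro tendsto_mult tendsto_const tendsto_fdet tendsto_add tendsto_diff tendsto_ident_at)
    show "((\<lambda>s::complex. if i = j then s else 0) \<longlongrightarrow> (if i = j then 0 else 0)) (at 0)" for i j :: nat
      by (cases "i = j") auto
  qed
  then have R: "((\<lambda>s::complex. \<Sum>l\<in>boxed N M. s ^ (?n - c l) * w l) \<longlongrightarrow> fdet N G * fdet ?n (\<lambda>i j. P (ms ! i) (ms ! j))) (at 0)"
  proof -
    assume lim: "((\<lambda>s. fdet N G * fdet ?n (\<lambda>i j. (if i = j then s else 0) + (1 - s) * P (ms ! i) (ms ! j))) \<longlongrightarrow>
      fdet N G * fdet ?n (\<lambda>i j. (if i = j then 0 else 0) + (1 - 0) * P (ms ! i) (ms ! j))) (at 0)"
    have "eventually (\<lambda>s. fdet N G * fdet ?n (\<lambda>i j. (if i = j then s else 0) + (1 - s) * P (ms ! i) (ms ! j)) =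
        (\<Sum>l\<in>boxed N M. s ^ (?n - c l) * w l)) (at 0)"
      using main by (auto simp: eventually_at intro!: exI[of _ 1])
    from Lim_transform_eventually[OF lim this] show ?thesis by simp
  qed
  have "(\<Sum>l\<in>boxed N M. 0 ^ (?n - c l) * w l) = fdet N G * fdet ?n (\<lambda>i j. P (ms ! i) (ms ! j))"
    by (rule tendsto_unique[OF _ L R]) simp
  moreover have "(\<Sum>l\<in>boxed N M. 0 ^ (?n - c l) * w l) =
      (\<Sum>l | l \<in> boxed N M \<and> set ms \<subseteq> pos l ` {0..<N}. w l)"
  proof -
    have "0 ^ (?n - c l) * w l = (if set ms \<subseteq> pos l ` {0..<N} then w l else 0)" for l
      using c_le[of l] unfolding c_eq[symmetric] by (auto simp: power_0_left)
    then show ?thesis by (simp add: sum.inter_filter[OF finite_boxed, symmetric])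
  qed
  ultimately show ?thesis by (simp add: w_def)
qed

section \<open>The limit kernel\<close>

text \<open>On the discarded terms k + l >= N the decay q^(2(k+l)) is split in halves: one yields
  the factor q^N, the other is summed as a double geometric series.\<close>

lemma suminf_double_truncation:
  fixes t :: "nat \<Rightarrow> nat \<Rightarrow> complex"
  assumes q: "0 < q" "q < 1" and D: "\<And>k l. norm (t k l) \<le> D * q ^ (2 * (k + l))"
  shows "norm ((suminf (\<lambda>k. suminf (\<lambda>l. t k l))) - (\<Sum>k=0..<N. \<Sum>l=0..<N - k. t k l)) \<le> D / (1 - q)\<^sup>2 * q ^ N"
proof -
  have D0: "0 \<le> D" using order.trans[OF norm_ge_zero D[of 0 0]] by simp
  have q2: "q ^ (2 * n) \<le> q ^ n" for n using q by (intro power_decreasing) auto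
  have t1: "norm (t k l) \<le> D * q ^ k * q ^ l" for k l
    by (rule order.trans[OF D]) (use D0 q2[of "k + l"] in \<open>simp add: power_add mult.assoc mult_left_mono\<close>)
  define u where "u k l = (if k + l < N then t k l else 0)" for k l
  define v where "v k l = (if k + l < N then 0 else t k l)" for k l
  have geo: "summable (\<lambda>l. B * q ^ l)" "(suminf (\<lambda>l. B * q ^ l)) = B / (1 - q)" for B
    using q by (auto intro!: summable_mult summable_geometric simp: suminf_mult suminf_geometric summable_geometric)
  have bnd: "summable (\<lambda>l. f l)" "norm (suminf (\<lambda>l. f l)) \<le> B / (1 - q)"
    if "\<And>l. norm (f l) \<le> B * q ^ l" for f :: "nat \<Rightarrow> complex" and B
  proof -
    have sn: "summable (\<lambda>l. norm (f l))"
      by (rule summable_comparison_test'[OF geo(1)[of B], of 0]) (use that in simp)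
    then show "summable (\<lambda>l. f l)" by (rule summable_norm_cancel)
    have "norm (suminf (\<lambda>l. f l)) \<le> (suminf (\<lambda>l. norm (f l)))" by (rule summable_norm[OF sn])
    also have "\<dots> \<le> (suminf (\<lambda>l. B * q ^ l))" by (rule suminf_le[OF that sn geo(1)])
    finally show "norm (suminf (\<lambda>l. f l)) \<le> B / (1 - q)" by (simp add: geo(2))
  qed
  have vb: "norm (v k l) \<le> (D * q ^ N * q ^ k) * q ^ l" for k l
  proof (cases "k + l < N")
    case False
    have "norm (t k l) \<le> D * q ^ (k + l + (k + l))" using D[of k l] unfolding mult_2 .
    also have "\<dots> \<le> D * q ^ (N + (k + l))"
      using False q D0 by (intro mult_left_mono power_decreasing) auto
    finally show ?thesis using False by (simp add: v_def power_add mult_ac)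
  qed (use q D0 in \<open>simp add: v_def\<close>)
  have ub: "norm (u k l) \<le> (D * q ^ k) * q ^ l" for k l
    using t1[of k l] q D0 by (auto simp: u_def)
  have u_fin: "(suminf (\<lambda>l. u k l)) = (\<Sum>l=0..<N - k. t k l)" for k
  proof -
    have "(suminf (\<lambda>l. u k l)) = (\<Sum>l=0..<N - k. u k l)" by (rule suminf_finite) (auto simp: u_def)
    also have "\<dots> = (\<Sum>l=0..<N - k. t k l)" by (rule sum.cong) (auto simp: u_def)
    finally show ?thesis .
  qed
  have split: "(suminf (\<lambda>l. t k l)) = (suminf (\<lambda>l. u k l)) + (suminf (\<lambda>l. v k l))" for k
    by (subst suminf_add[OF bnd(1)[OF ub] bnd(1)[OF vb]]) (auto simp: u_def v_def intro!: arg_cong[of _ _ suminf])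
  have uk: "norm (suminf (\<lambda>l. u k l)) \<le> (D / (1 - q)) * q ^ k" for k
    using bnd(2)[OF ub[of k]] by (simp add: field_simps)
  have vk: "norm (suminf (\<lambda>l. v k l)) \<le> (D * q ^ N / (1 - q)) * q ^ k" for k
    using bnd(2)[OF vb[of k]] by (simp add: field_simps)
  have "(suminf (\<lambda>k. suminf (\<lambda>l. t k l))) = (suminf (\<lambda>k. suminf (\<lambda>l. u k l))) + (suminf (\<lambda>k. suminf (\<lambda>l. v k l)))"
    by (subst suminf_add[OF bnd(1)[OF uk] bnd(1)[OF vk]]) (simp add: split)
  moreover have "(suminf (\<lambda>k. suminf (\<lambda>l. u k l))) = (\<Sum>k=0..<N. \<Sum>l=0..<N - k. t k l)"
    by (subst suminf_finite[of "{0..<N}"]) (auto simp: u_fin)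
  moreover have "norm (suminf (\<lambda>k. suminf (\<lambda>l. v k l))) \<le> (D * q ^ N / (1 - q)) / (1 - q)"
    by (rule bnd(2)[OF vk])
  ultimately show ?thesis by (simp add: power2_eq_square field_simps)
qed

text \<open>\<open>h\<close> and \<open>c\<close> are the coefficients of two mutually inverse power series \<open>H\<close>, \<open>1/H\<close>. The numbers
  \<open>J n\<close> are the Fourier coefficients of \<open>H(z) / cnj (H(z))\<close>, which is unimodular on the circle; this is
  the content of the assumption \<open>J_orth\<close>.\<close>

locale inverse_pair =
  fixes h c :: "int \<Rightarrow> complex" and C s :: real
  assumes s: "0 < s" "s < 1" and C: "0 < C"
    and h_neg: "\<And>n. n < 0 \<Longrightarrow> h n = 0" and c_neg: "\<And>n. n < 0 \<Longrightarrow> c n = 0"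
    and h0: "h 0 = 1" and c0: "c 0 = 1"
    and h_bound: "\<And>n. n \<ge> 0 \<Longrightarrow> norm (h n) \<le> C * s ^ (2 * nat n)"
    and c_bound: "\<And>n. n \<ge> 0 \<Longrightarrow> norm (c n) \<le> C * s ^ (2 * nat n)"
    and conv: "\<And>n. n > 0 \<Longrightarrow> (\<Sum>k=0..n. c (int k) * h (int n - int k)) = 0"
begin

lemma h_le: "norm (h n) \<le> C" and c_le: "norm (c n) \<le> C"
proof -
  have "C * s ^ k \<le> C" for k using s C by (simp add: power_le_one mult_left_le)
  then show "norm (h n) \<le> C" "norm (c n) \<le> C"
    using h_bound[of n] c_bound[of n] h_neg[of n] c_neg[of n] C
    by (cases "n < 0"; force intro: order.trans)+
qed

definition J :: "int \<Rightarrow> complex" where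
  "J n = (suminf (\<lambda>l. h (n + int l) * cnj (c (int l))))"

lemma J_term_bound: "norm (h (n + int l) * cnj (c (int l))) \<le> C\<^sup>2 * s ^ nat \<bar>n\<bar> * s ^ l"
proof (cases "n + int l < 0")
  case True
  then show ?thesis using s by (simp add: h_neg)
next
  case False
  have "norm (h (n + int l) * cnj (c (int l))) \<le> (C * s ^ (2 * nat (n + int l))) * (C * s ^ (2 * l))"
    unfolding norm_mult using h_bound[of "n + int l"] c_bound[of "int l"] False C s
    by (intro mult_mono) auto
  also have "\<dots> = C\<^sup>2 * s ^ (2 * nat (n + int l) + 2 * l)"
    by (simp add: power2_eq_square power_add mult_ac)
  also have "\<dots> \<le> C\<^sup>2 * s ^ (nat \<bar>n\<bar> + l)"
    using s False by (intro mult_left_mono power_decreasing) auto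
  finally show ?thesis by (simp add: power_add mult.assoc)
qed

lemma J_term_summable: "summable (\<lambda>l. norm (h (n + int l) * cnj (c (int l))))"
  by (rule summable_comparison_test'[of "\<lambda>l. C\<^sup>2 * s ^ nat \<bar>n\<bar> * s ^ l" 0])
     (use s J_term_bound in \<open>auto intro!: summable_mult summable_geometric\<close>)

lemma J_bound: "norm (J n) \<le> C\<^sup>2 / (1 - s) * s ^ nat \<bar>n\<bar>"
proof -
  have "norm (J n) \<le> (suminf (\<lambda>l. norm (h (n + int l) * cnj (c (int l)))))"
    unfolding J_def by (rule summable_norm[OF J_term_summable])
  also have "\<dots> \<le> (suminf (\<lambda>l. C\<^sup>2 * s ^ nat \<bar>n\<bar> * s ^ l))"
    by (rule suminf_le[OF J_term_bound J_term_summable])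
       (use s in \<open>auto intro!: summable_mult summable_geometric\<close>)
  also have "\<dots> = C\<^sup>2 * s ^ nat \<bar>n\<bar> * (1 / (1 - s))"
    using s by (subst suminf_mult) (auto simp: suminf_geometric summable_geometric)
  finally show ?thesis by (simp add: mult_ac)
qed

text \<open>The defining series reindexed by the argument of \<open>h\<close>; added or dropped
  terms vanish because \<open>h\<close> and \<open>c\<close> are zero at negative arguments. The
  defining form displays combinations of translates of \<open>h\<close>, this one combinations of
  translates of \<open>c\<close>; \<open>PN_estimate\<close> needs both.\<close>

lemma J_alt: "(\<lambda>n. h (int n) * cnj (c (int n - m))) sums J m"
proof (cases "m \<ge> 0")
  case True
  have eq: "h (m + int l) * cnj (c (int l)) = h (int (l + nat m)) * cnj (c (int (l + nat m) - m))" for l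
    using True by (simp add: add.commute)
  have "summable (\<lambda>l. h (m + int l) * cnj (c (int l)))"
    using J_term_summable by (rule summable_norm_cancel)
  then have "(\<lambda>l. h (int (l + nat m)) * cnj (c (int (l + nat m) - m))) sums J m"
    unfolding J_def eq[symmetric] by (rule summable_sums)
  then have "(\<lambda>n. h (int n) * cnj (c (int n - m))) sums (J m + (\<Sum>i<nat m. h (int i) * cnj (c (int i - m))))"
    by (subst (asm) sums_iff_shift)
  moreover have "(\<Sum>i<nat m. h (int i) * cnj (c (int i - m))) = 0"
    by (intro sum.neutral ballI) (auto simp: c_neg)
  ultimately show ?thesis by simp
next
  case False
  let ?g = "\<lambda>l. h (m + int l) * cnj (c (int l))"
  have eq: "?g (n + nat (- m)) = h (int n) * cnj (c (int n - m))" for n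
    using False by simp
  have "summable ?g" using J_term_summable by (rule summable_norm_cancel)
  then have "?g sums J m" unfolding J_def by (rule summable_sums)
  then have 1: "(\<lambda>n. ?g (n + nat (- m))) sums (J m - (\<Sum>i<nat (- m). ?g i))"
    by (rule sums_split_initial_segment)
  have 2: "(\<Sum>i<nat (- m). ?g i) = 0"
    by (intro sum.neutral ballI) (auto simp: h_neg)
  show ?thesis using 1 unfolding eq 2 by simp
qed

section \<open>The ensembles in N x N boxes and uniform bounds for their normalization\<close>

definition phi :: "nat \<Rightarrow> int \<Rightarrow> complex" where
  "phi j x = h (x + 1 + int j)"

definition gram :: "nat \<Rightarrow> nat \<Rightarrow> nat \<Rightarrow> complex" where
  "gram N j k = (\<Sum>x\<in>{- int N..<int N}. phi j x * cnj (phi k x))"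

text \<open>If h is \<open>spec_h\<close> of a specialization, this is the Jacobi-Trudi determinant
  written through positions: pos l i + 1 + j = l i - i + j.\<close>

definition weight :: "nat \<Rightarrow> (nat \<Rightarrow> nat) \<Rightarrow> complex" where
  "weight N l = fdet N (\<lambda>i j. phi j (pos l i))"

definition Z :: "nat \<Rightarrow> real" where
  "Z N = (\<Sum>l\<in>boxed N N. (norm (weight N l))\<^sup>2)"

lemma Z_gram: "complex_of_real (Z N) = fdet N (gram N)"
proof -
  have "complex_of_real (Z N) = (\<Sum>l\<in>boxed N N. (\<Prod>i=0..<N. 1) * (weight N l * cnj (weight N l)))"
    unfolding Z_def of_real_sum by (intro sum.cong refl) (simp only: complex_norm_square prod.neutral_const mult_1)
  also have "\<dots> = fdet N (\<lambda>j k. \<Sum>x\<in>{- int N..<int N}. 1 * phi j x * cnj (phi k x))"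
    unfolding weight_def by (rule sum_boxed_gram)
  finally show ?thesis by (simp add: gram_def[abs_def])
qed

text \<open>The empty partition alone has weight 1. Since \<open>Z N\<close> is the Gram
  determinant, the Gram matrix is invertible for every N.\<close>

lemma Z_ge_1: "Z N \<ge> 1"
proof -
  have "(\<lambda>_. 0) \<in> boxed N N" by (simp add: boxed_def antimono_def)
  then have "(norm (weight N (\<lambda>_. 0)))\<^sup>2 \<le> Z N"
    unfolding Z_def by (intro member_le_sum) (auto simp: finite_boxed)
  moreover have "weight N (\<lambda>_. 0) = 1"
    unfolding weight_def by (rule fdet_upper_unitriangular) (auto simp: phi_def pos_def h0 h_neg)
  ultimately show ?thesis by simp
qed

text \<open>A unitriangular change of basis turns the functions \<open>phi j\<close> into
  perturbations of point masses at \<open>-1-j\<close>.\<close>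

definition gfun :: "nat \<Rightarrow> int \<Rightarrow> complex" where
  "gfun j x = (\<Sum>k=0..j. c (int k) * phi (j - k) x)"

lemma gfun_neg:
  assumes "x \<le> -1"
  shows "gfun j x = (if x = - 1 - int j then 1 else 0)"
proof -
  define n where "n = x + 1 + int j"
  have g: "gfun j x = (\<Sum>k=0..j. c (int k) * h (n - int k))"
    unfolding gfun_def phi_def n_def by (intro sum.cong refl) (auto simp: algebra_simps of_nat_diff)
  consider "n < 0" | "n = 0" | "n > 0" by linarith
  then show ?thesis
  proof cases
    case 1
    then show ?thesis unfolding g by (auto simp: n_def h_neg intro!: sum.neutral)
  next
    case 2
    have "gfun j x = (\<Sum>k\<in>{0::nat}. c (int k) * h (n - int k))"
      unfolding g by (rule sum.mono_neutral_right) (auto simp: 2 h_neg)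
    then show ?thesis using 2 by (simp add: h0 c0 n_def)
  next
    case 3
    \<comment> \<open>Because x <= -1, the sum up to j contains the whole convolution of c and h at
      n, which vanishes for n > 0.\<close>
    have "nat n \<le> j" using assms by (simp add: n_def)
    have "gfun j x = (\<Sum>k=0..nat n. c (int k) * h (n - int k))"
      unfolding g by (rule sum.mono_neutral_right) (use 3 \<open>nat n \<le> j\<close> in \<open>auto simp: h_neg\<close>)
    also have "\<dots> = 0" using conv[of "nat n"] 3 by simp
    finally show ?thesis using 3 by (simp add: n_def)
  qed
qed

lemma gfun_nonneg:
  assumes "x \<ge> 0"
  shows "norm (gfun j x) \<le> C\<^sup>2 * (real j + 1) * s ^ (2 * j) * s ^ nat x"
proof -
  have "norm (gfun j x) \<le> (\<Sum>k=0..j. norm (c (int k) * phi (j - k) x))"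
    unfolding gfun_def by (rule norm_sum)
  also have "\<dots> \<le> (\<Sum>k=0..j. C\<^sup>2 * s ^ (2 * j) * s ^ nat x)"
  proof (rule sum_mono)
    fix k assume k: "k \<in> {0..j}"
    have "norm (c (int k) * phi (j - k) x) \<le> (C * s ^ (2 * k)) * (C * s ^ (2 * nat (x + 1 + int (j - k))))"
      unfolding norm_mult phi_def using c_bound[of "int k"] h_bound[of "x + 1 + int (j - k)"] C s assms
      by (intro mult_mono) auto
    also have "\<dots> = C\<^sup>2 * s ^ (2 * k + 2 * nat (x + 1 + int (j - k)))"
      by (simp add: power2_eq_square power_add mult_ac)
    also have "\<dots> \<le> C\<^sup>2 * s ^ (2 * j + nat x)"
      using s k assms by (intro mult_left_mono power_decreasing) auto
    finally show "norm (c (int k) * phi (j - k) x) \<le> C\<^sup>2 * s ^ (2 * j) * s ^ nat x"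
      by (simp add: power_add mult.assoc)
  qed
  also have "\<dots> = C\<^sup>2 * (real j + 1) * s ^ (2 * j) * s ^ nat x" by (simp add: algebra_simps)
  finally show ?thesis .
qed

text \<open>The matrix that expresses \<open>gfun\<close> through \<open>phi\<close> is lower
  triangular with diagonal c 0 = 1, so the Gram determinant does not change.\<close>

lemma fdet_gfun_gram:
  "fdet N (\<lambda>j k. \<Sum>x\<in>{- int N..<int N}. gfun j x * cnj (gfun k x)) = fdet N (gram N)"
proof -
  let ?W = "{- int N..<int N}"
  define U where "U j i = (if i \<le> j then c (int (j - i)) else 0)" for j i
  have g: "gfun j x = (\<Sum>i=0..<N. U j i * phi i x)" if "j < N" for j x
  proof -
    have "gfun j x = (\<Sum>i=0..j. c (int (j - i)) * phi i x)"
      unfolding gfun_def by (rule sum.reindex_bij_witness[of _ "\<lambda>i. j - i" "\<lambda>i. j - i"]) auto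
    also have "\<dots> = (\<Sum>i=0..<N. U j i * phi i x)"
      by (rule sum.mono_neutral_cong_left) (use that in \<open>auto simp: U_def\<close>)
    finally show ?thesis .
  qed
  have U: "fdet N U = 1"
    by (rule fdet_lower_unitriangular) (auto simp: U_def c0)
  have U': "fdet N (\<lambda>i k. cnj (U k i)) = 1"
    using U fdet_transpose[of N "\<lambda>i k. cnj (U i k)"] by (simp flip: cnj_fdet)
  have "fdet N (\<lambda>j k. \<Sum>x\<in>?W. gfun j x * cnj (gfun k x)) =
      fdet N (\<lambda>j k. \<Sum>a=0..<N. U j a * (\<Sum>b=0..<N. gram N a b * cnj (U k b)))"
  proof (rule fdet_cong)
    fix j k assume jk: "j < N" "k < N"
    have "(\<Sum>x\<in>?W. gfun j x * cnj (gfun k x)) =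
        (\<Sum>x\<in>?W. \<Sum>a=0..<N. \<Sum>b=0..<N. U j a * (phi a x * cnj (phi b x) * cnj (U k b)))"
      by (simp add: g jk sum_product mult_ac)
    also have "\<dots> = (\<Sum>a=0..<N. \<Sum>b=0..<N. \<Sum>x\<in>?W. U j a * (phi a x * cnj (phi b x) * cnj (U k b)))"
      by (subst sum.swap, rule sum.cong[OF refl], rule sum.swap)
    also have "\<dots> = (\<Sum>a=0..<N. U j a * (\<Sum>b=0..<N. gram N a b * cnj (U k b)))"
      by (simp only: gram_def sum_distrib_left sum_distrib_right)
    finally show "(\<Sum>x\<in>?W. gfun j x * cnj (gfun k x)) =
        (\<Sum>a=0..<N. U j a * (\<Sum>b=0..<N. gram N a b * cnj (U k b)))" .
  qed
  also have "\<dots> = fdet N U * fdet N (\<lambda>a k. \<Sum>b=0..<N. gram N a b * cnj (U k b))"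
    by (rule fdet_mult)
  also have "\<dots> = fdet N U * (fdet N (gram N) * fdet N (\<lambda>b k. cnj (U k b)))"
    by (subst fdet_mult) simp
  finally show ?thesis by (simp add: U U')
qed

text \<open>In the basis \<open>gfun\<close> the Gram matrix is the identity up to entries of order
  s^(j+k). Row j then sums to at most 1 + E2 s^j <= exp(E2 s^j), and the product of these bounds
  converges.\<close>

lemma Z_bounded: "\<exists>B. \<forall>N. Z N \<le> B"
proof -
  \<comment> \<open>Half of the decay s^(2j) in \<open>gfun_nonneg\<close> absorbs the linear factor
    j + 1.\<close>
  have "(\<lambda>j. real j * s ^ j) \<longlonglongrightarrow> 0"
    using s by (intro powser_times_n_limit_0) auto
  then have "Bseq (\<lambda>j. real j * s ^ j)" using convergentI by (intro convergent_imp_Bseq) blast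
  then obtain D1 where D1: "\<And>j. norm (real j * s ^ j) \<le> D1"
    unfolding Bseq_def by blast
  define E where "E = C\<^sup>2 * (D1 + 1)"
  have gb: "norm (gfun j x) \<le> E * s ^ j * s ^ nat x" if "x \<ge> 0" for j x
  proof -
    have "norm (gfun j x) \<le> C\<^sup>2 * ((real j + 1) * s ^ j) * s ^ j * s ^ nat x"
      using gfun_nonneg[OF that, of j] unfolding mult_2 power_add by (simp add: mult_ac)
    also have "(real j + 1) * s ^ j \<le> D1 + 1"
      using D1[of j] s power_le_one[of s j] by (simp add: algebra_simps)
    finally show ?thesis using s by (simp add: E_def mult_left_mono mult_right_mono)
  qed
  have E0: "E \<ge> 0" using order.trans[OF norm_ge_zero D1[of 0]] by (simp add: E_def)
  have geo: "(\<Sum>k=0..<n. s ^ k) \<le> 1 / (1 - s)" for n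
    using s by (subst atLeast0LessThan, subst sum_gp_strict) (auto simp: field_simps)
  define E' where "E' = E\<^sup>2 / (1 - s)"
  have E'0: "E' \<ge> 0" using s by (simp add: E'_def)
  have entry: "norm (\<Sum>x\<in>{- int N..<int N}. gfun j x * cnj (gfun k x)) \<le> (if j = k then 1 else 0) + E' * s ^ j * s ^ k"
    for j k N
  proof -
    have "norm (\<Sum>x\<in>{- int N..<int N}. gfun j x * cnj (gfun k x)) =
        norm ((\<Sum>x\<in>{- int N..<0}. gfun j x * cnj (gfun k x)) + (\<Sum>x\<in>{0..<int N}. gfun j x * cnj (gfun k x)))"
      by (subst sum.union_disjoint[symmetric]) (auto simp: ivl_disj_un)
    also have "\<dots> \<le> norm (\<Sum>x\<in>{- int N..<0}. gfun j x * cnj (gfun k x)) + norm (\<Sum>x\<in>{0..<int N}. gfun j x * cnj (gfun k x))"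
      by (rule norm_triangle_ineq)
    also have "(\<Sum>x\<in>{- int N..<0}. gfun j x * cnj (gfun k x)) =
        (\<Sum>x\<in>{- int N..<0}. if x = - 1 - int j then (if j = k then 1 else 0) else 0)"
      by (intro sum.cong refl) (auto simp: gfun_neg)
    also have "norm \<dots> \<le> (if j = k then 1 else 0)" by simp
    also have "norm (\<Sum>x\<in>{0..<int N}. gfun j x * cnj (gfun k x)) \<le> (\<Sum>x\<in>{0..<int N}. E\<^sup>2 * s ^ j * s ^ k * s ^ nat x)"
    proof (rule order.trans[OF norm_sum], rule sum_mono)
      fix x assume "x \<in> {0..<int N}"
      then have "norm (gfun j x * cnj (gfun k x)) \<le> (E * s ^ j * s ^ nat x) * (E * s ^ k * s ^ nat x)"
        unfolding norm_mult complex_mod_cnj using E0 s by (intro mult_mono gb) auto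
      also have "\<dots> = (E\<^sup>2 * s ^ j * s ^ k * s ^ nat x) * s ^ nat x" by (simp add: power2_eq_square mult_ac)
      also have "\<dots> \<le> (E\<^sup>2 * s ^ j * s ^ k * s ^ nat x) * 1"
        using s by (intro mult_left_mono power_le_one) auto
      finally show "norm (gfun j x * cnj (gfun k x)) \<le> E\<^sup>2 * s ^ j * s ^ k * s ^ nat x" by simp
    qed
    also have "\<dots> = E\<^sup>2 * s ^ j * s ^ k * (\<Sum>i=0..<N. s ^ i)"
      unfolding sum_distrib_left
      by (rule sum.reindex_bij_witness[of _ int nat]) auto
    also have "\<dots> \<le> E\<^sup>2 * s ^ j * s ^ k * (1 / (1 - s))"
      using s by (intro mult_left_mono geo) auto
    finally show ?thesis by (simp add: E'_def mult_ac)
  qed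
  define E2 where "E2 = E' / (1 - s)"
  have E20: "E2 \<ge> 0" using E'0 s by (simp add: E2_def)
  have "Z N \<le> exp (E2 / (1 - s))" for N
  proof -
    have "Z N = norm (fdet N (gram N))"
      unfolding Z_gram[symmetric] using Z_ge_1[of N] by simp
    also have "\<dots> \<le> (\<Prod>j=0..<N. \<Sum>k=0..<N. norm (\<Sum>x\<in>{- int N..<int N}. gfun j x * cnj (gfun k x)))"
      unfolding fdet_gfun_gram[symmetric] by (rule norm_fdet_le_row_sums)
    also have "\<dots> \<le> (\<Prod>j=0..<N. exp (E2 * s ^ j))"
    proof (intro prod_mono conjI sum_nonneg)
      fix j assume j: "j \<in> {0..<N}"
      have "(\<Sum>k=0..<N. norm (\<Sum>x\<in>{- int N..<int N}. gfun j x * cnj (gfun k x))) \<le>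
          (\<Sum>k=0..<N. (if j = k then 1 else 0) + E' * s ^ j * s ^ k)"
        by (rule sum_mono) (rule entry)
      also have "\<dots> = 1 + E' * s ^ j * (\<Sum>k=0..<N. s ^ k)"
        using j by (simp add: sum.distrib sum_distrib_left)
      also have "\<dots> \<le> 1 + E' * s ^ j * (1 / (1 - s))"
        using E'0 s by (intro add_left_mono mult_left_mono geo) auto
      also have "\<dots> = 1 + E2 * s ^ j" by (simp add: E2_def)
      also have "\<dots> \<le> exp (E2 * s ^ j)" by (rule exp_ge_add_one_self)
      finally show "(\<Sum>k=0..<N. norm (\<Sum>x\<in>{- int N..<int N}. gfun j x * cnj (gfun k x))) \<le> exp (E2 * s ^ j)" .
    qed auto
    also have "\<dots> = exp (E2 * (\<Sum>j=0..<N. s ^ j))"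
      by (simp add: exp_sum sum_distrib_left)
    also have "\<dots> \<le> exp (E2 / (1 - s))"
      using mult_left_mono[OF geo E20, of N] by simp
    finally show ?thesis .
  qed
  then show ?thesis by blast
qed

lemma J_sums: "(\<lambda>l. h (n + int l) * cnj (c (int l))) sums J n"
  unfolding J_def by (rule summable_sums[OF summable_norm_cancel[OF J_term_summable]])

lemma gram_nonzero: "fdet N (gram N) \<noteq> 0"
  using Z_ge_1[of N] unfolding Z_gram[symmetric] by auto

lemma gram_projection_ex: "\<exists>Q. gram_projection {- int N..<int N} N phi Q"
proof -
  obtain Q where "\<And>i j. i < N \<Longrightarrow> j < N \<Longrightarrow> (\<Sum>k=0..<N. gram N i k * Q k j) = (if i = j then 1 else 0)"
    "\<And>i j. i < N \<Longrightarrow> j < N \<Longrightarrow> (\<Sum>k=0..<N. Q i k * gram N k j) = (if i = j then 1 else 0)"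
    using fdet_inverse[OF gram_nonzero] by blast
  then have "gram_projection {- int N..<int N} N phi Q"
    by unfold_locales (simp_all only: gram_def finite_atLeastLessThan_int)
  then show ?thesis by (rule exI[of _ Q])
qed

definition Qinv :: "nat \<Rightarrow> nat \<Rightarrow> nat \<Rightarrow> complex" where
  "Qinv N = (SOME Q. gram_projection {- int N..<int N} N phi Q)"

lemma gram_projection_Qinv: "gram_projection {- int N..<int N} N phi (Qinv N)"
  unfolding Qinv_def by (rule someI_ex[OF gram_projection_ex])

definition PN :: "nat \<Rightarrow> int \<Rightarrow> int \<Rightarrow> complex" where
  "PN N = gram_projection.P N phi (Qinv N)"

definition ker :: "int \<Rightarrow> int \<Rightarrow> complex" where
  "ker y x = suminf (\<lambda>k. J (x + 1 + int k) * cnj (J (y + 1 + int k)))"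

text \<open>The full convolution of c and h at m + 1 + j > 0. The window cuts nothing off, since
  \<open>phi j\<close> vanishes below -1-j >= -N and c (m - z) vanishes for z > m, where m <
  N.\<close>

lemma conv_window:
  assumes "j < N" "m < N"
  shows "(\<Sum>z\<in>{- int N..<int N}. phi j z * c (int m - z)) = 0"
proof -
  have "(\<Sum>z\<in>{- int N..<int N}. phi j z * c (int m - z)) = (\<Sum>z\<in>{- int (j + 1)..int m}. phi j z * c (int m - z))"
    by (rule sum.mono_neutral_right) (use assms in \<open>auto simp: phi_def h_neg c_neg\<close>)
  also have "\<dots> = (\<Sum>k=0..m + 1 + j. c (int k) * h (int (m + 1 + j) - int k))"
    by (rule sum.reindex_bij_witness[of _ "\<lambda>k. int m - int k" "\<lambda>z. nat (int m - z)"])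
       (auto simp: phi_def algebra_simps)
  also have "\<dots> = 0" by (rule conv) simp
  finally show ?thesis .
qed

end

section \<open>Convergence of the finite projections to the limit kernel\<close>

locale unimodular_pair = inverse_pair +
  assumes J_orth: "\<And>x z. suminf (\<lambda>k. J (x + 1 + int k) * cnj (J (z + 1 + int k))) +
    suminf (\<lambda>k. J (x - int k) * cnj (J (z - int k))) = (if x = z then 1 else 0)"
begin

text \<open>The finite projection is compared with \<open>ker\<close> by splitting the point mass at \<open>x\<close> into a part
  in the range of the projection, a part in its kernel and an exponentially small remainder.\<close>

lemma PN_estimate:
  "\<exists>D q. 0 < q \<and> q < 1 \<and> (\<forall>N. x \<in> {- int N..<int N} \<longrightarrow> y \<in> {- int N..<int N} \<longrightarrow>
     norm (PN N y x - ker y x) \<le> D * (4 * real N + 1) * q ^ N)"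
proof -
  define q where "q = sqrt s"
  have q: "0 < q" "q < 1" and qs: "q ^ (2 * n) = s ^ n" for n
    using s by (auto simp: q_def power_mult)
  define CJ where "CJ = C\<^sup>2 / (1 - s)"
  have CJ0: "CJ \<ge> 0" using s by (simp add: CJ_def)
  \<comment> \<open>The power of s in the denominator compensates that the bound for J decays in its
    argument, x + 1 + k or x - k, and not in k itself. It makes D depend on x but not on N.\<close>
  define D where "D = CJ * C\<^sup>2 / s ^ (nat \<bar>x\<bar> + nat \<bar>x + 1\<bar>)"
  define t1 where "t1 z k l = J (x + 1 + int k) * (c (int l) * cnj (h (z + 1 + int k + int l)))" for z k l
  define t2 where "t2 z k l = J (x - int k) * (cnj (h (int l)) * c (int k + int l - z))" for z k l
  have J1: "norm (J n) \<le> CJ * s ^ k / s ^ (nat \<bar>x\<bar> + nat \<bar>x + 1\<bar>)"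
    if "k \<le> nat \<bar>n\<bar> + (nat \<bar>x\<bar> + nat \<bar>x + 1\<bar>)" for n k
  proof -
    have "s ^ nat \<bar>n\<bar> * s ^ (nat \<bar>x\<bar> + nat \<bar>x + 1\<bar>) \<le> s ^ k"
      unfolding power_add[symmetric] using that s by (intro power_decreasing) auto
    then have "s ^ nat \<bar>n\<bar> \<le> s ^ k / s ^ (nat \<bar>x\<bar> + nat \<bar>x + 1\<bar>)"
      using s by (simp add: field_simps)
    then have "CJ * s ^ nat \<bar>n\<bar> \<le> CJ * (s ^ k / s ^ (nat \<bar>x\<bar> + nat \<bar>x + 1\<bar>))"
      using CJ0 by (rule mult_left_mono)
    then show ?thesis using J_bound[of n] by (simp add: CJ_def)
  qed
  have sl: "C * s ^ (2 * l) \<le> C * s ^ l" for l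
    using s C by (intro mult_left_mono power_decreasing) auto
  have cb: "norm (c (int l)) \<le> C * s ^ l" and hb: "norm (h (int l)) \<le> C * s ^ l" for l
    using c_bound[of "int l"] h_bound[of "int l"] sl[of l] by auto
  have j1: "norm (J (x + 1 + int k)) \<le> CJ * s ^ k / s ^ (nat \<bar>x\<bar> + nat \<bar>x + 1\<bar>)" for k
    by (rule J1) arith
  have j2: "norm (J (x - int k)) \<le> CJ * s ^ k / s ^ (nat \<bar>x\<bar> + nat \<bar>x + 1\<bar>)" for k
    by (rule J1) arith
  have b1: "norm (t1 z k l) \<le> D * q ^ (2 * (k + l))" for z k l
  proof -
    have "norm (t1 z k l) \<le> (CJ * s ^ k / s ^ (nat \<bar>x\<bar> + nat \<bar>x + 1\<bar>)) * ((C * s ^ l) * C)"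
      unfolding t1_def norm_mult complex_mod_cnj
      using C s CJ0 by (intro mult_mono j1 cb h_le) auto
    then show ?thesis unfolding qs by (simp add: D_def power_add power2_eq_square mult_ac)
  qed
  have b2: "norm (t2 z k l) \<le> D * q ^ (2 * (k + l))" for z k l
  proof -
    have "norm (t2 z k l) \<le> (CJ * s ^ k / s ^ (nat \<bar>x\<bar> + nat \<bar>x + 1\<bar>)) * ((C * s ^ l) * C)"
      unfolding t2_def norm_mult complex_mod_cnj
      using C s CJ0 by (intro mult_mono j2 hb c_le) auto
    then show ?thesis unfolding qs by (simp add: D_def power_add power2_eq_square mult_ac)
  qed
  define D' where "D' = D / (1 - q)\<^sup>2"
  have D'0: "D' \<ge> 0" unfolding D'_def D_def using CJ0 s by simp
  \<comment> \<open>The triangular truncation k + l < N is forced from both sides: it keeps only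
    \<open>phi (k + l)\<close> of index below N, which the projection reproduces, and only c (k + l
    - z) to which \<open>conv_window\<close> applies.\<close>
  define aN where "aN N z = (\<Sum>k=0..<N. \<Sum>l=0..<N - k. t1 z k l)" for N z
  define bN where "bN N z = (\<Sum>k=0..<N. \<Sum>l=0..<N - k. t2 z k l)" for N z
  have s1: "suminf (\<lambda>l. t1 z k l) = J (x + 1 + int k) * cnj (J (z + 1 + int k))" for z k
  proof -
    have "(\<lambda>l. cnj (h (z + 1 + int k + int l) * cnj (c (int l)))) sums cnj (J (z + 1 + int k))"
      using J_sums[of "z + 1 + int k"] by (simp only: sums_cnj)
    then have "(\<lambda>l. t1 z k l) sums (J (x + 1 + int k) * cnj (J (z + 1 + int k)))"
      unfolding t1_def by (intro sums_mult) (simp add: mult.commute)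
    then show ?thesis by (rule sums_unique[symmetric])
  qed
  have s2: "suminf (\<lambda>l. t2 z k l) = J (x - int k) * cnj (J (z - int k))" for z k
  proof -
    have "(\<lambda>l. cnj (h (int l) * cnj (c (int l - (z - int k))))) sums cnj (J (z - int k))"
      using J_alt[of "z - int k"] by (simp only: sums_cnj)
    moreover have "int l - (z - int k) = int k + int l - z" for l by simp
    ultimately have "(\<lambda>l. t2 z k l) sums (J (x - int k) * cnj (J (z - int k)))"
      unfolding t2_def by (intro sums_mult) simp
    then show ?thesis by (rule sums_unique[symmetric])
  qed
  have a_est: "norm (ker z x - aN N z) \<le> D' * q ^ N" for N z
    using suminf_double_truncation[OF q b1[of z], where N = N] unfolding s1 aN_def D'_def ker_def .
  have b_est: "norm (suminf (\<lambda>k. J (x - int k) * cnj (J (z - int k))) - bN N z) \<le> D' * q ^ N" for N z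
    using suminf_double_truncation[OF q b2[of z], where N = N] unfolding s2 bN_def D'_def .
  have main: "norm (PN N y x - ker y x) \<le> D' * (4 * real N + 1) * q ^ N"
    if xW: "x \<in> {- int N..<int N}" and yW: "y \<in> {- int N..<int N}" for N
  proof -
    interpret gram_projection "{- int N..<int N}" N phi "Qinv N" by (rule gram_projection_Qinv)
    let ?W = "{- int N..<int N}"
    define err where "err z = (if z = x then 1 else 0) - aN N z - bN N z" for z
    have err: "norm (err z) \<le> 2 * D' * q ^ N" for z
    proof -
      \<comment> \<open>\<open>J_orth\<close> writes the point mass at x as two half-line sums, of
        which the first is \<open>ker z x\<close>; what remains are their truncation errors.\<close>
      have "err z = (ker z x - aN N z) + (suminf (\<lambda>k. J (x - int k) * cnj (J (z - int k))) - bN N z)"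
        unfolding err_def using J_orth[of x z] unfolding ker_def[symmetric] by (auto simp: algebra_simps)
      then have "norm (err z) \<le> norm (ker z x - aN N z) + norm (suminf (\<lambda>k. J (x - int k) * cnj (J (z - int k))) - bN N z)"
        by (simp add: norm_triangle_ineq)
      then show ?thesis using a_est[of z N] b_est[of z N] by linarith
    qed
    have Pa: "(\<Sum>z\<in>?W. P y z * aN N z) = aN N y"
    proof -
      have "(\<Sum>z\<in>?W. P y z * aN N z) =
          (\<Sum>k=0..<N. \<Sum>l=0..<N - k. J (x + 1 + int k) * c (int l) * (\<Sum>z\<in>?W. P y z * cnj (phi (k + l) z)))"
        unfolding aN_def t1_def phi_def sum_distrib_left
        by (subst sum.swap, rule sum.cong[OF refl], subst sum.swap) (simp add: mult_ac add_ac)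
      also have "\<dots> = (\<Sum>k=0..<N. \<Sum>l=0..<N - k. J (x + 1 + int k) * c (int l) * cnj (phi (k + l) y))"
        by (intro sum.cong refl) (simp add: P_reproduces)
      also have "\<dots> = aN N y"
        unfolding aN_def t1_def phi_def by (simp add: mult_ac add_ac)
      finally show ?thesis .
    qed
    have Pb: "(\<Sum>z\<in>?W. P y z * bN N z) = 0"
    proof (rule P_annihilates)
      fix j assume j: "j < N"
      have "(\<Sum>z\<in>?W. phi j z * bN N z) =
          (\<Sum>k=0..<N. \<Sum>l=0..<N - k. J (x - int k) * cnj (h (int l)) * (\<Sum>z\<in>?W. phi j z * c (int (k + l) - z)))"
        unfolding bN_def t2_def sum_distrib_left
        by (subst sum.swap, rule sum.cong[OF refl], subst sum.swap) (simp add: mult_ac add_ac)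
      also have "\<dots> = 0"
        using j by (intro sum.neutral ballI) (subst conv_window, auto)
      finally show "(\<Sum>z\<in>?W. phi j z * bN N z) = 0" .
    qed
    have "P y x = (\<Sum>z\<in>?W. P y z * (if z = x then 1 else 0))"
      using xW by (simp add: if_distrib[of "\<lambda>u. _ * u"] cong: if_cong)
    also have "\<dots> = (\<Sum>z\<in>?W. P y z * aN N z) + (\<Sum>z\<in>?W. P y z * bN N z) + (\<Sum>z\<in>?W. P y z * err z)"
      unfolding sum.distrib[symmetric] by (intro sum.cong refl) (simp add: err_def algebra_simps)
    finally have Pyx: "P y x - aN N y = (\<Sum>z\<in>?W. P y z * err z)"
      unfolding Pa Pb by simp
    have "(norm (P y x - aN N y))\<^sup>2 \<le> (\<Sum>z\<in>?W. (norm (err z))\<^sup>2)"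
      unfolding Pyx by (rule P_contractive[OF yW])
    also have "\<dots> \<le> (\<Sum>z\<in>?W. (2 * D' * q ^ N)\<^sup>2)"
      by (intro sum_mono power_mono err) auto
    also have "\<dots> = 2 * real N * (2 * D' * q ^ N)\<^sup>2" by simp
    also have "\<dots> \<le> (2 * real N)\<^sup>2 * (2 * D' * q ^ N)\<^sup>2"
    proof (rule mult_right_mono)
      show "2 * real N \<le> (2 * real N)\<^sup>2" by (cases N) (auto simp: power2_eq_square)
    qed auto
    also have "\<dots> = (2 * real N * (2 * D' * q ^ N))\<^sup>2" by (simp add: power_mult_distrib)
    finally have "norm (P y x - aN N y) \<le> 2 * real N * (2 * D' * q ^ N)"
      by (rule power2_le_imp_le) (use D'0 q in auto)
    moreover have "norm (PN N y x - ker y x) \<le> norm (P y x - aN N y) + norm (ker y x - aN N y)"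
      unfolding PN_def by (metis norm_minus_commute norm_triangle_sub norm_diff_triangle_ineq add.commute diff_add_cancel norm_diff_triangle_le order_refl)
    ultimately show ?thesis using a_est[of y N] by (simp add: algebra_simps)
  qed
  show ?thesis using q main by blast
qed

lemma eventually_in_window: "eventually (\<lambda>N. x \<in> {- int N..<int N}) sequentially"
  by (rule eventually_sequentiallyI[of "nat \<bar>x\<bar> + 1"]) auto

lemma PN_tendsto: "(\<lambda>N. PN N y x) \<longlonglongrightarrow> ker y x"
proof -
  obtain D q where q: "0 < q" "q < 1"
    and est: "\<And>N. x \<in> {- int N..<int N} \<Longrightarrow> y \<in> {- int N..<int N} \<Longrightarrow>
      norm (PN N y x - ker y x) \<le> D * (4 * real N + 1) * q ^ N"
    using PN_estimate[of x y] by blast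
  have L1: "(\<lambda>N. real N * q ^ N) \<longlonglongrightarrow> 0" using q by (intro powser_times_n_limit_0) auto
  have L2: "(\<lambda>N. q ^ N) \<longlonglongrightarrow> 0" using q by (intro LIMSEQ_power_zero) auto
  have "(\<lambda>N. D * (4 * (real N * q ^ N) + q ^ N)) \<longlonglongrightarrow> D * (4 * 0 + 0)"
    by (intro tendsto_mult tendsto_add tendsto_const L1 L2)
  then have 0: "(\<lambda>N. D * (4 * real N + 1) * q ^ N) \<longlonglongrightarrow> 0" by (simp add: algebra_simps)
  have "eventually (\<lambda>N. norm (PN N y x - ker y x) \<le> D * (4 * real N + 1) * q ^ N) sequentially"
    using eventually_in_window[of x] eventually_in_window[of y]
    by eventually_elim (rule est)
  then have "(\<lambda>N. PN N y x - ker y x) \<longlonglongrightarrow> 0"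
    by (rule Lim_null_comparison[OF _ 0])
  then show ?thesis by (simp add: LIM_zero_iff)
qed

lemma ker_bessel:
  assumes "finite F"
  shows "(\<Sum>y\<in>F. (norm (ker x y))\<^sup>2) \<le> 1"
proof (rule tendsto_upperbound)
  show "(\<lambda>N. \<Sum>y\<in>F. (norm (PN N x y))\<^sup>2) \<longlonglongrightarrow> (\<Sum>y\<in>F. (norm (ker x y))\<^sup>2)"
    by (intro tendsto_intros PN_tendsto)
  have "eventually (\<lambda>N. \<forall>y\<in>F. y \<in> {- int N..<int N}) sequentially"
    by (intro eventually_ball_finite ballI eventually_in_window assms)
  then show "eventually (\<lambda>N. (\<Sum>y\<in>F. (norm (PN N x y))\<^sup>2) \<le> 1) sequentially"
    using eventually_in_window[of x]
  proof eventually_elim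
    case (elim N)
    interpret gram_projection "{- int N..<int N}" N phi "Qinv N" by (rule gram_projection_Qinv)
    have "(\<Sum>y\<in>F. (norm (PN N x y))\<^sup>2) \<le> (\<Sum>y\<in>{- int N..<int N}. (norm (PN N x y))\<^sup>2)"
      by (rule sum_mono2) (use elim in auto)
    also have "\<dots> \<le> 1" unfolding PN_def using elim by (intro sum_norm_P_le_1)
    finally show ?case .
  qed
qed simp

lemma boxed_correlation:
  assumes "distinct ms" "set ms \<subseteq> {- int N..<int N}"
  shows "complex_of_real (\<Sum>l | l \<in> boxed N N \<and> set ms \<subseteq> range (pos l). (norm (weight N l))\<^sup>2) =
    of_real (Z N) * fdet (length ms) (\<lambda>i j. PN N (ms ! i) (ms ! j))"
proof -
  have iff: "set ms \<subseteq> range (pos l) \<longleftrightarrow> set ms \<subseteq> pos l ` {0..<N}" if "l \<in> boxed N N" for l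
  proof
    assume a: "set ms \<subseteq> range (pos l)"
    show "set ms \<subseteq> pos l ` {0..<N}"
    proof
      fix x assume x: "x \<in> set ms"
      then obtain i where i: "x = pos l i" using a by auto
      have "i < N"
      proof (rule ccontr)
        assume "\<not> i < N"
        then have "x < - int N" using that i by (auto simp: boxed_def pos_def)
        then show False using assms(2) x by auto
      qed
      then show "x \<in> pos l ` {0..<N}" using i by auto
    qed
  qed auto
  have "complex_of_real (\<Sum>l | l \<in> boxed N N \<and> set ms \<subseteq> range (pos l). (norm (weight N l))\<^sup>2) =
      (\<Sum>l | l \<in> boxed N N \<and> set ms \<subseteq> pos l ` {0..<N}. weight N l * cnj (weight N l))"
    unfolding of_real_sum
    by (intro sum.cong) (use iff in \<open>auto simp only: complex_norm_square\<close>)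
  also have "\<dots> = fdet N (gram N) * fdet (length ms) (\<lambda>i j. PN N (ms ! i) (ms ! j))"
    using finite_correlation[OF gram_projection_Qinv assms]
    unfolding weight_def PN_def gram_def[abs_def] .
  finally show ?thesis by (simp only: Z_gram)
qed

end

section \<open>Fourier series on the circle\<close>

text \<open>The plain name of this constant is ambiguous: it also belongs to \<open>Infinite_Sum\<close>.\<close>

abbreviation abssummable :: "('a \<Rightarrow> 'b::{banach, second_countable_topology}) \<Rightarrow> 'a set \<Rightarrow> bool" (infix "abssummable" 50) where
  "f abssummable A \<equiv> Infinite_Set_Sum.abs_summable_on f A"

definition circ :: "real measure" where
  "circ = density lborel (\<lambda>t. ennreal (indicator {0..2*pi} t / (2 * pi)))"

lemma sets_circ [simp, measurable_cong]: "sets circ = sets borel"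
  by (simp add: circ_def)

lemma space_circ [simp]: "space circ = UNIV"
  by (simp add: circ_def)

lemma emeasure_circ_UNIV: "emeasure circ UNIV = 1"
proof -
  have "emeasure circ UNIV = (\<integral>\<^sup>+t. ennreal (1 / (2 * pi)) * indicator {0..2*pi} t \<partial>lborel)"
    unfolding circ_def by (subst emeasure_density) (auto intro!: nn_integral_cong simp: indicator_def)
  also have "\<dots> = ennreal (1 / (2 * pi)) * ennreal (2 * pi)"
    by (simp add: nn_integral_cmult_indicator)
  also have "\<dots> = 1" by (simp flip: ennreal_mult)
  finally show ?thesis .
qed

interpretation circ: prob_space circ
  by (rule prob_spaceI) (simp add: emeasure_circ_UNIV)

lemma integral_circ:
  fixes f :: "real \<Rightarrow> 'a::{banach, second_countable_topology}"
  assumes [measurable]: "f \<in> borel_measurable borel"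
  shows "(\<integral>t. f t \<partial>circ) = (\<integral>t. indicator {0..2*pi} t *\<^sub>R f t \<partial>lborel) /\<^sub>R (2 * pi)"
proof -
  have "(\<integral>t. f t \<partial>circ) = (\<integral>t. (indicator {0..2*pi} t / (2 * pi)) *\<^sub>R f t \<partial>lborel)"
    unfolding circ_def by (rule integral_density) auto
  also have "\<dots> = (\<integral>t. (1 / (2 * pi)) *\<^sub>R (indicator {0..2*pi} t *\<^sub>R f t) \<partial>lborel)"
    by (intro Bochner_Integration.integral_cong) auto
  also have "\<dots> = (1 / (2 * pi)) *\<^sub>R (\<integral>t. indicator {0..2*pi} t *\<^sub>R f t \<partial>lborel)"
    by (rule integral_scaleR_right)
  finally show ?thesis by (simp add: field_simps)
qed

lemma borel_measurable_cis [measurable]: "cis \<in> borel_measurable borel"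
  by (intro borel_measurable_continuous_onI) (auto simp: cis_conv_exp intro!: continuous_intros)

lemma integrable_circ_bounded:
  fixes f :: "real \<Rightarrow> 'a::{banach, second_countable_topology}"
  assumes "f \<in> borel_measurable borel" "\<And>t. norm (f t) \<le> B"
  shows "integrable circ f"
  by (rule circ.integrable_const_bound[of _ B]) (use assms in auto)

lemma integral_circ_cis: "(\<integral>t. cis (of_int n * t) \<partial>circ) = (if n = 0 then 1 else 0)"
proof (cases "n = 0")
  case True
  then show ?thesis using circ.prob_space by simp
next
  case False
  let ?F = "\<lambda>t. cis (of_int n * t) / (\<i> * of_int n)"
  have "(\<integral>t. indicator {0..2*pi} t *\<^sub>R cis (of_int n * t) \<partial>lborel) = ?F (2 * pi) - ?F 0"
  proof (rule integral_FTC_atLeastAtMost)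
    fix x :: real
    show "(?F has_vector_derivative cis (of_int n * x)) (at x within {0..2*pi})"
      unfolding cis_conv_exp
      by (rule has_vector_derivative_at_within)
         (auto intro!: derivative_eq_intros has_vector_derivative_real_field simp: False field_simps)
  qed (auto intro!: continuous_intros simp: cis_conv_exp)
  also have "\<dots> = 0"
  proof -
    have "cis (of_int n * (2 * pi)) = 1"
      using cis_multiple_2pi[of "of_int n"] by (simp add: mult.commute mult.left_commute)
    then show ?thesis by simp
  qed
  finally show ?thesis using False by (subst integral_circ) auto
qed

lemma infsetsum_integral_swap:
  fixes a :: "int \<Rightarrow> complex" and e :: "int \<Rightarrow> real \<Rightarrow> complex"
  assumes a: "a abssummable UNIV"
    and e: "\<And>n. e n \<in> borel_measurable borel" "\<And>n t. norm (e n t) \<le> B"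
  shows "(\<integral>t. infsetsum (\<lambda>n. a n * e n t) UNIV \<partial>circ) = infsetsum (\<lambda>n. a n * (\<integral>t. e n t \<partial>circ)) UNIV"
proof -
  have sf: "sigma_finite_measure (count_space (UNIV :: int set))"
    by (rule sigma_finite_measure_count_space_countable) simp
  interpret P: pair_sigma_finite "count_space (UNIV :: int set)" circ
    by (intro pair_sigma_finite.intro sf circ.sigma_finite_measure_axioms)
  have B: "B \<ge> 0" using order.trans[OF norm_ge_zero e(2)[of 0 0]] .
  have m: "(\<lambda>(n, t). a n * e n t) \<in> borel_measurable (count_space UNIV \<Otimes>\<^sub>M circ)"
    by (rule measurable_pair_measure_countable1) (use e in auto)
  have "integrable (count_space UNIV \<Otimes>\<^sub>M circ) (\<lambda>(n, t). a n * e n t)"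
  proof (rule P.Fubini_integrable[OF m])
    have "integrable (count_space UNIV) (\<lambda>n. B * norm (a n))"
      using a unfolding abs_summable_on_def by (intro integrable_mult_right) (rule integrable_norm)
    then show "integrable (count_space UNIV) (\<lambda>n. \<integral>t. norm (case (n, t) of (n, t) \<Rightarrow> a n * e n t) \<partial>circ)"
    proof (rule Bochner_Integration.integrable_bound)
      show "AE n in count_space UNIV. norm (\<integral>t. norm (case (n, t) of (n, t) \<Rightarrow> a n * e n t) \<partial>circ) \<le> norm (B * norm (a n))"
      proof (rule AE_I2)
        fix n
        have "norm (\<integral>t. norm (a n * e n t) \<partial>circ) \<le> (\<integral>t. norm (norm (a n * e n t)) \<partial>circ)"
          by (rule integral_norm_bound)
        also have "\<dots> \<le> (\<integral>t. B * norm (a n) \<partial>circ)"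
        proof (rule integral_mono)
          show "integrable circ (\<lambda>t. norm (norm (a n * e n t)))"
            using e by (intro integrable_circ_bounded[where B = "norm (a n) * B"]) (auto simp: norm_mult intro!: mult_left_mono)
          show "norm (norm (a n * e n t)) \<le> B * norm (a n)" for t
            using e(2)[of n t] by (simp add: norm_mult mult.commute[of B] mult_left_mono)
        qed simp
        also have "\<dots> = B * norm (a n)" using circ.prob_space by simp
        finally show "norm (\<integral>t. norm (case (n, t) of (n, t) \<Rightarrow> a n * e n t) \<partial>circ) \<le> norm (B * norm (a n))"
          using B by simp
      qed
    qed simp
    show "AE n in count_space UNIV. integrable circ (\<lambda>t. case (n, t) of (n, t) \<Rightarrow> a n * e n t)"
    proof (rule AE_I2)
      fix n
      show "integrable circ (\<lambda>t. case (n, t) of (n, t) \<Rightarrow> a n * e n t)"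
        using e by (intro integrable_circ_bounded[where B = "norm (a n) * B"]) (auto simp: norm_mult intro!: mult_left_mono)
    qed
  qed
  from P.Fubini_integral[OF this]
  show ?thesis by (simp add: infsetsum_def)
qed

lemma borel_measurable_cnj [measurable]: "cnj \<in> borel_measurable borel"
  by (intro borel_measurable_continuous_onI continuous_intros)

definition FT :: "(int \<Rightarrow> complex) \<Rightarrow> real \<Rightarrow> complex" where
  "FT a t = infsetsum (\<lambda>n. a n * cis (of_int n * t)) UNIV"

lemma abs_summable_cis:
  "a abssummable UNIV \<Longrightarrow> (\<lambda>n. a n * cis (of_int n * t)) abssummable UNIV"
  by (subst abs_summable_on_norm_iff[symmetric]) (simp add: norm_mult)

lemma FT_bound:
  assumes "a abssummable UNIV"
  shows "norm (FT a t) \<le> infsetsum (\<lambda>n. norm (a n)) UNIV"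
  using norm_infsetsum_bound[of "\<lambda>n. a n * cis (of_int n * t)" UNIV]
  unfolding FT_def by (simp add: norm_mult)

lemma FT_measurable [measurable]: "FT a \<in> borel_measurable borel"
proof -
  interpret sigma_finite_measure "count_space (UNIV :: int set)"
    by (rule sigma_finite_measure_count_space_countable) simp
  have "(\<lambda>(t, n). a n * cis (of_int n * t)) \<in> borel_measurable (borel \<Otimes>\<^sub>M count_space UNIV)"
    by (subst measurable_pair_swap_iff) (auto intro!: measurable_pair_measure_countable1)
  then show ?thesis
    unfolding FT_def[abs_def] infsetsum_def by (rule borel_measurable_lebesgue_integral)
qed

text \<open>Only the first factor is expanded and integrated term by term; absolute summability
  justifies this directly, without completeness of the exponentials.\<close>

theorem parseval:
  assumes a: "a abssummable UNIV" and b: "b abssummable UNIV"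
  shows "(\<integral>t. FT a t * cnj (FT b t) \<partial>circ) = infsetsum (\<lambda>n. a n * cnj (b n)) UNIV"
proof -
  let ?B = "infsetsum (\<lambda>n. norm (b n)) UNIV"
  have coeff: "(\<integral>t. cis (of_int n * t) * cnj (FT b t) \<partial>circ) = cnj (b n)" for n
  proof -
    have "(\<integral>t. cis (of_int n * t) * cnj (FT b t) \<partial>circ) = cnj (\<integral>t. cis (- of_int n * t) * FT b t \<partial>circ)"
    proof -
      have "(\<lambda>t. cis (of_int n * t) * cnj (FT b t)) = (\<lambda>t. cnj (cis (- of_int n * t) * FT b t))"
        by (simp add: cis_cnj)
      then show ?thesis by (simp only: Bochner_Integration.integral_cnj)
    qed
    also have "(\<lambda>t. cis (- of_int n * t) * FT b t) = (\<lambda>t. infsetsum (\<lambda>m. b m * cis (of_int (m - n) * t)) UNIV)"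
    proof
      fix t
      have "cis (- of_int n * t) * FT b t = infsetsum (\<lambda>m. cis (- of_int n * t) * (b m * cis (of_int m * t))) UNIV"
        unfolding FT_def by (rule infsetsum_cmult_right[symmetric]) (use b abs_summable_cis in auto)
      also have "\<dots> = infsetsum (\<lambda>m. b m * cis (of_int (m - n) * t)) UNIV"
      proof (rule infsetsum_cong[OF _ refl])
        fix m
        have "cis (of_int (m - n) * t) = cis (- of_int n * t) * cis (of_int m * t)"
          by (simp add: cis_mult algebra_simps)
        then show "cis (- of_int n * t) * (b m * cis (of_int m * t)) = b m * cis (of_int (m - n) * t)"
          by simp
      qed
      finally show "cis (- of_int n * t) * FT b t = infsetsum (\<lambda>m. b m * cis (of_int (m - n) * t)) UNIV" .
    qed
    also have "(\<integral>t. infsetsum (\<lambda>m. b m * cis (of_int (m - n) * t)) UNIV \<partial>circ) =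
        infsetsum (\<lambda>m. b m * (\<integral>t. cis (of_int (m - n) * t) \<partial>circ)) UNIV"
      by (rule infsetsum_integral_swap[OF b, where B = 1]) auto
    also have "\<dots> = infsetsum (\<lambda>m. if m \<in> {n} then b m else 0) UNIV"
      unfolding integral_circ_cis by (intro infsetsum_cong) auto
    also have "\<dots> = b n"
      by (subst infsetsum_cong_neutral[where B = "{n}" and g = b]) auto
    finally show ?thesis .
  qed
  have "(\<integral>t. FT a t * cnj (FT b t) \<partial>circ) =
      (\<integral>t. infsetsum (\<lambda>n. a n * (cis (of_int n * t) * cnj (FT b t))) UNIV \<partial>circ)"
    unfolding FT_def[of a] mult.assoc[symmetric]
    by (subst infsetsum_cmult_left) (use a abs_summable_cis in auto)
  also have "\<dots> = infsetsum (\<lambda>n. a n * (\<integral>t. cis (of_int n * t) * cnj (FT b t) \<partial>circ)) UNIV"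
    by (rule infsetsum_integral_swap[OF a, where B = ?B]) (use FT_bound[OF b] in \<open>auto simp: norm_mult\<close>)
  finally show ?thesis by (simp add: coeff)
qed

lemma abs_summable_shift:
  fixes a :: "int \<Rightarrow> complex"
  assumes "a abssummable UNIV"
  shows "(\<lambda>n. a (n + k)) abssummable UNIV"
  using abs_summable_on_reindex_bij_betw[of "\<lambda>n. n + k" UNIV UNIV a] assms
  by (simp add: bij_plus_right)

lemma infsetsum_shift:
  fixes a :: "int \<Rightarrow> complex"
  shows "infsetsum (\<lambda>n. a (n + k)) UNIV = infsetsum a UNIV"
  by (rule infsetsum_reindex_bij_betw[of "\<lambda>n. n + k"]) (simp add: bij_plus_right)

lemma FT_shift:
  assumes "a abssummable UNIV"
  shows "FT (\<lambda>n. a (n + k)) t = cis (- of_int k * t) * FT a t"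
proof -
  have "FT (\<lambda>n. a (n + k)) t = infsetsum (\<lambda>n. cis (- of_int k * t) * (a (n + k) * cis (of_int (n + k) * t))) UNIV"
    unfolding FT_def by (intro infsetsum_cong) (auto simp: algebra_simps cis_mult)
  also have "\<dots> = cis (- of_int k * t) * infsetsum (\<lambda>n. a (n + k) * cis (of_int (n + k) * t)) UNIV"
    by (rule infsetsum_cmult_right) (use abs_summable_shift[OF abs_summable_cis[OF assms]] in auto)
  also have "infsetsum (\<lambda>n. a (n + k) * cis (of_int (n + k) * t)) UNIV = FT a t"
    unfolding FT_def by (rule infsetsum_shift)
  finally show ?thesis .
qed

lemma FT_translate:
  "FT (\<lambda>n. a n * cis (of_int n * s)) t = FT a (t + s)"
  unfolding FT_def by (intro infsetsum_cong) (auto simp: algebra_simps cis_mult)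

lemma FT_linear:
  assumes "a abssummable UNIV" "b abssummable UNIV"
  shows "FT (\<lambda>n. u * a n + v * b n) t = u * FT a t + v * FT b t"
proof -
  have "FT (\<lambda>n. u * a n + v * b n) t =
      infsetsum (\<lambda>n. u * (a n * cis (of_int n * t)) + v * (b n * cis (of_int n * t))) UNIV"
    unfolding FT_def by (intro infsetsum_cong) (auto simp: algebra_simps)
  also have "\<dots> = u * FT a t + v * FT b t"
    unfolding FT_def using abs_summable_cis[OF assms(1)] abs_summable_cis[OF assms(2)]
    by (subst infsetsum_add) (auto simp: infsetsum_cmult_right)
  finally show ?thesis .
qed

lemma geometric_abs_summable_int:
  fixes s :: real
  assumes "0 < s" "s < 1"
  shows "(\<lambda>n::int. s ^ nat \<bar>n\<bar>) abssummable UNIV"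
proof -
  have g: "(\<lambda>n::nat. s ^ n) abssummable UNIV" "(\<lambda>n::nat. s ^ Suc n) abssummable UNIV"
    using assms by (auto simp: abs_summable_on_nat_iff' norm_power norm_mult intro!: summable_mult summable_geometric)
  have 1: "(\<lambda>n::int. s ^ nat \<bar>n\<bar>) abssummable range int"
    by (subst abs_summable_on_reindex_iff[symmetric]) (use g in auto)
  have "inj (\<lambda>n::nat. - int (Suc n))" by (auto intro: injI)
  then have 2: "(\<lambda>n::int. s ^ nat \<bar>n\<bar>) abssummable range (\<lambda>n::nat. - int (Suc n))"
    by (subst abs_summable_on_reindex_iff[symmetric]) (use g(2) in \<open>auto simp: nat_add_distrib\<close>)
  have "x \<in> range int \<union> range (\<lambda>n::nat. - int (Suc n))" for x
    by (cases x rule: int_cases) (blast intro: rangeI)+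
  then have "UNIV = range int \<union> range (\<lambda>n::nat. - int (Suc n))" by blast
  then show ?thesis using abs_summable_on_union[OF 1 2] by simp
qed

lemma infsetsum_split_int:
  fixes f :: "int \<Rightarrow> complex"
  assumes "f abssummable UNIV"
  shows "infsetsum f {n<..} = suminf (\<lambda>k. f (n + 1 + int k))"
    and "infsetsum f UNIV = suminf (\<lambda>k. f (n + 1 + int k)) + suminf (\<lambda>k. f (n - int k))"
proof -
  have b1: "bij_betw (\<lambda>k. n + 1 + int k) UNIV {n<..}"
    by (rule bij_betw_byWitness[where f' = "\<lambda>x. nat (x - n - 1)"]) auto
  have b2: "bij_betw (\<lambda>k. n - int k) UNIV {..n}"
    by (rule bij_betw_byWitness[where f' = "\<lambda>x. nat (n - x)"]) auto
  have s: "f abssummable A" for A using assms abs_summable_on_subset by blast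
  show 1: "infsetsum f {n<..} = suminf (\<lambda>k. f (n + 1 + int k))"
    unfolding infsetsum_reindex_bij_betw[OF b1, symmetric]
    by (rule infsetsum_nat') (use abs_summable_on_reindex_bij_betw[OF b1, of f] s in simp)
  have 2: "infsetsum f {..n} = suminf (\<lambda>k. f (n - int k))"
    unfolding infsetsum_reindex_bij_betw[OF b2, symmetric]
    by (rule infsetsum_nat') (use abs_summable_on_reindex_bij_betw[OF b2, of f] s in simp)
  have "UNIV = {n<..} \<union> {..n}" "{n<..} \<inter> {..n} = {}" by auto
  then have "infsetsum f UNIV = infsetsum f {n<..} + infsetsum f {..n}"
    using infsetsum_Un_disjoint[of f "{n<..}" "{..n}"] s by auto
  then show "infsetsum f UNIV = suminf (\<lambda>k. f (n + 1 + int k)) + suminf (\<lambda>k. f (n - int k))"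
    by (simp add: 1 2)
qed

section \<open>Scaling limit of the kernel\<close>

lemma abs_summable_bounded:
  fixes a :: "int \<Rightarrow> complex"
  assumes "a abssummable UNIV"
  shows "norm (a k) \<le> infsetsum (\<lambda>n. norm (a n)) UNIV"
proof -
  have "infsetsum (\<lambda>n. norm (a n)) {k} \<le> infsetsum (\<lambda>n. norm (a n)) UNIV"
    using assms by (intro infsetsum_mono_neutral) auto
  then show ?thesis by simp
qed

lemma abs_summable_mult:
  fixes a b :: "int \<Rightarrow> complex"
  assumes a: "a abssummable UNIV" and b: "b abssummable UNIV"
  shows "(\<lambda>k. a k * b k) abssummable UNIV"
proof (rule abs_summable_on_comparison_test)
  show "(\<lambda>k. infsetsum (\<lambda>n. norm (b n)) UNIV * norm (a k)) abssummable UNIV"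
    by (intro abs_summable_on_cmult_right abs_summable_on_normI a)
  show "norm (a k * b k) \<le> norm (infsetsum (\<lambda>n. norm (b n)) UNIV * norm (a k))" for k
    using abs_summable_bounded[OF b, of k] order.trans[OF norm_ge_zero abs_summable_bounded[OF b, of k]]
    by (simp add: norm_mult mult.commute[of "norm (a k)"] mult_right_mono)
qed

lemma abs_summable_norm_sq:
  fixes a :: "int \<Rightarrow> complex"
  assumes "a abssummable UNIV"
  shows "(\<lambda>k. (norm (a k))\<^sup>2) abssummable A"
proof -
  have "(\<lambda>k. norm (a k * a k)) abssummable UNIV"
    by (intro abs_summable_on_normI abs_summable_mult assms)
  then show ?thesis
    using abs_summable_on_subset by (auto simp: norm_mult power2_eq_square)
qed

text \<open>The masses \<open>(norm (V n k))\<^sup>2\<close>, placed at k / \<alpha> n, form a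
  probability measure because q is normalized. The limit law is the distribution of g under the
  density \<open>(norm (q t))\<^sup>2\<close> on the circle, and the condition on u makes u a
  continuity point of it.\<close>

lemma energy_tail_limit:
  fixes V :: "nat \<Rightarrow> int \<Rightarrow> complex" and \<alpha> :: "nat \<Rightarrow> real" and \<gamma> g :: "real \<Rightarrow> real" and q :: "real \<Rightarrow> complex"
  assumes V: "\<And>n. V n abssummable UNIV"
    and FV: "\<And>n t. FT (V n) t = q t * cis (\<alpha> n * \<gamma> t)"
    and \<alpha>: "\<And>n. \<alpha> n > 0" "filterlim \<alpha> at_top sequentially"
    and \<gamma>: "\<And>t. (\<gamma> has_real_derivative g t) (at t)"
    and [measurable]: "g \<in> borel_measurable borel"
    and q: "continuous_on UNIV q" "\<And>t. norm (q t) \<le> B"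
    and q1: "(\<integral>t. (norm (q t))\<^sup>2 \<partial>circ) = 1"
    and u: "measure circ {t. g t = u} = 0"
  shows "(\<lambda>n. infsetsum (\<lambda>k. (norm (V n k))\<^sup>2) {\<lfloor>\<alpha> n * u\<rfloor><..}) \<longlonglongrightarrow>
    (\<integral>t. indicator {t. g t > u} t * (norm (q t))\<^sup>2 \<partial>circ)"
proof -
  have [measurable]: "q \<in> borel_measurable borel"
    by (rule borel_measurable_continuous_onI[OF q(1)])
  have \<gamma>c: "continuous_on UNIV \<gamma>"
    using \<gamma> by (auto intro!: continuous_at_imp_continuous_on DERIV_isCont)
  have [measurable]: "\<gamma> \<in> borel_measurable borel"
    by (rule borel_measurable_continuous_onI[OF \<gamma>c])
  have B0: "B \<ge> 0" using order.trans[OF norm_ge_zero q(2)] .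
  have qsq: "(norm (q t))\<^sup>2 \<le> B\<^sup>2" for t using q(2)[of t] by (intro power_mono) auto
  have int_q: "integrable circ (\<lambda>t. (norm (q t))\<^sup>2)"
    by (rule integrable_circ_bounded[where B = "B\<^sup>2"]) (use qsq in auto)

  let ?w = "\<lambda>n k. (norm (V n k))\<^sup>2"
  have total: "infsetsum (?w n) UNIV = 1" for n
  proof -
    have "complex_of_real (infsetsum (?w n) UNIV) = infsetsum (\<lambda>k. V n k * cnj (V n k)) UNIV"
      unfolding complex_norm_square[symmetric] by (rule infsetsum_of_real[symmetric])
    also have "\<dots> = (\<integral>t. FT (V n) t * cnj (FT (V n) t) \<partial>circ)"
      by (rule parseval[OF V V, symmetric])
    also have "\<dots> = (\<integral>t. complex_of_real ((norm (q t))\<^sup>2) \<partial>circ)"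
      unfolding complex_norm_square[symmetric] FV by (simp add: norm_mult)
    also have "\<dots> = complex_of_real 1" unfolding q1[symmetric] by (rule integral_complex_of_real)
    finally show ?thesis by (simp only: of_real_eq_iff)
  qed
  define p where "p n = embed_pmf (?w n)" for n
  have pmf_p: "pmf (p n) k = ?w n k" for n k
    unfolding p_def
  proof (rule pmf_embed_pmf)
    show "(\<integral>\<^sup>+k. ennreal (?w n k) \<partial>count_space UNIV) = 1"
      by (subst nn_integral_conv_infsetsum) (auto simp: total abs_summable_norm_sq[OF V])
  qed simp
  define M where "M n = distr (measure_pmf (p n)) borel (\<lambda>k. real_of_int k / \<alpha> n)" for n
  define N where "N = density circ (\<lambda>t. ennreal ((norm (q t))\<^sup>2))"
  have [simp, measurable_cong]: "sets N = sets borel" and [simp]: "space N = UNIV" by (simp_all add: N_def)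
  have int_N: "(\<integral>t. f t \<partial>N) = (\<integral>t. (norm (q t))\<^sup>2 *\<^sub>R f t \<partial>circ)"
    if [measurable]: "f \<in> borel_measurable borel" for f :: "real \<Rightarrow> 'b::{banach, second_countable_topology}"
    unfolding N_def by (rule integral_density) auto
  have "emeasure N UNIV = 1"
    unfolding N_def by (subst emeasure_density) (auto simp: nn_integral_eq_integral[OF int_q] q1)
  then interpret N: prob_space N by (intro prob_spaceI) simp
  define \<nu> where "\<nu> = distr N borel g"
  have realM: "real_distribution (M n)" for n
    unfolding M_def real_distribution_def real_distribution_axioms_def
    by (auto intro!: measure_pmf.prob_space_distr)
  have real\<nu>: "real_distribution \<nu>"
    unfolding \<nu>_def real_distribution_def real_distribution_axioms_def
    by (auto intro!: N.prob_space_distr)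

  \<comment> \<open>The factor cis (k t / \<alpha> n) translates the Fourier series by t / \<alpha>
    n, so Parseval gives an autocorrelation at this small lag.\<close>
  have charM: "char (M n) t = (\<integral>s. FT (V n) (s + t / \<alpha> n) * cnj (FT (V n) s) \<partial>circ)" for n t
  proof -
    have "char (M n) t = (\<integral>k. cis (of_int k * (t / \<alpha> n)) \<partial>measure_pmf (p n))"
      unfolding char_def M_def by (subst integral_distr) (auto simp: cis_conv_exp mult_ac)
    also have "\<dots> = (\<integral>k. pmf (p n) k *\<^sub>R cis (of_int k * (t / \<alpha> n)) \<partial>count_space UNIV)"
      unfolding measure_pmf_eq_density by (rule integral_density) auto
    also have "\<dots> = infsetsum (\<lambda>k. (V n k * cis (of_int k * (t / \<alpha> n))) * cnj (V n k)) UNIV"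
      unfolding infsetsum_def pmf_p
      by (intro Bochner_Integration.integral_cong refl) (simp add: scaleR_conv_of_real complex_norm_square mult_ac del: of_real_power)
    also have "\<dots> = (\<integral>s. FT (\<lambda>k. V n k * cis (of_int k * (t / \<alpha> n))) s * cnj (FT (V n) s) \<partial>circ)"
      by (rule parseval[symmetric, OF abs_summable_cis[OF V] V])
    finally show ?thesis unfolding FT_translate .
  qed
  have char\<nu>: "char \<nu> t = (\<integral>s. (norm (q s))\<^sup>2 *\<^sub>R cis (t * g s) \<partial>circ)" for t
    unfolding char_def \<nu>_def by (subst integral_distr) (auto simp: cis_conv_exp int_N)
  have "(\<lambda>n. char (M n) t) \<longlonglongrightarrow> char \<nu> t" for t
    unfolding charM char\<nu>
  proof (rule integral_dominated_convergence[where w = "\<lambda>_. B\<^sup>2"])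
    have inv0: "(\<lambda>n. t / \<alpha> n) \<longlonglongrightarrow> 0"
      by (rule tendsto_divide_0[OF tendsto_const filterlim_at_top_imp_at_infinity[OF \<alpha>(2)]])
    show "AE s in circ. (\<lambda>n. FT (V n) (s + t / \<alpha> n) * cnj (FT (V n) s)) \<longlonglongrightarrow> (norm (q s))\<^sup>2 *\<^sub>R cis (t * g s)"
    proof (rule AE_I2)
      fix s
      \<comment> \<open>The large factor \<alpha> n and the small lag t / \<alpha> n combine to a
        difference quotient of \<gamma>; for t = 0 the quotient is meaningless but the claim
        trivial.\<close>
      have slope: "(\<lambda>n. \<alpha> n * (\<gamma> (s + t / \<alpha> n) - \<gamma> s)) \<longlonglongrightarrow> t * g s"
      proof (cases "t = 0")
        case False
        have "((\<lambda>h. (\<gamma> (s + h) - \<gamma> s) / h) \<longlongrightarrow> g s) (at 0)" using \<gamma> by (simp add: DERIV_def)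
        moreover have "filterlim (\<lambda>n. t / \<alpha> n) (at 0) sequentially"
          using inv0 False \<alpha>(1) by (auto simp: filterlim_at less_imp_neq[THEN not_sym] intro!: always_eventually)
        ultimately have "(\<lambda>n. (\<gamma> (s + t / \<alpha> n) - \<gamma> s) / (t / \<alpha> n)) \<longlonglongrightarrow> g s"
          by (rule filterlim_compose)
        then have "(\<lambda>n. t * ((\<gamma> (s + t / \<alpha> n) - \<gamma> s) / (t / \<alpha> n))) \<longlonglongrightarrow> t * g s"
          by (intro tendsto_mult tendsto_const)
        moreover have "t * ((\<gamma> (s + t / \<alpha> n) - \<gamma> s) / (t / \<alpha> n)) = \<alpha> n * (\<gamma> (s + t / \<alpha> n) - \<gamma> s)" for n
          using False by (simp add: mult.commute)
        ultimately show ?thesis by simp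
      qed simp
      have qc: "(\<lambda>n. q (s + t / \<alpha> n)) \<longlonglongrightarrow> q s"
      proof (rule continuous_on_tendsto_compose[OF q(1)])
        show "(\<lambda>n. s + t / \<alpha> n) \<longlonglongrightarrow> s" using tendsto_add[OF tendsto_const[of s] inv0] by simp
      qed auto
      have cisc: "(\<lambda>n. cis (\<alpha> n * (\<gamma> (s + t / \<alpha> n) - \<gamma> s))) \<longlonglongrightarrow> cis (t * g s)"
      proof (rule isCont_tendsto_compose[OF _ slope])
        show "isCont cis x" for x unfolding cis_conv_exp[abs_def] by (intro continuous_intros)
      qed
      have "(\<lambda>n. (q (s + t / \<alpha> n) * cnj (q s)) * cis (\<alpha> n * (\<gamma> (s + t / \<alpha> n) - \<gamma> s))) \<longlonglongrightarrow> (q s * cnj (q s)) * cis (t * g s)"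
        by (intro tendsto_mult qc cisc tendsto_const)
      moreover have "FT (V n) (s + t / \<alpha> n) * cnj (FT (V n) s) =
          (q (s + t / \<alpha> n) * cnj (q s)) * cis (\<alpha> n * (\<gamma> (s + t / \<alpha> n) - \<gamma> s))" for n
        unfolding FV by (simp add: cis_cnj cis_mult right_diff_distrib mult_ac)
      ultimately show "(\<lambda>n. FT (V n) (s + t / \<alpha> n) * cnj (FT (V n) s)) \<longlonglongrightarrow> (norm (q s))\<^sup>2 *\<^sub>R cis (t * g s)"
        by (simp add: scaleR_conv_of_real complex_norm_square del: of_real_power)
    qed
    show "AE s in circ. norm (FT (V n) (s + t / \<alpha> n) * cnj (FT (V n) s)) \<le> B\<^sup>2" for n
      unfolding FV using q(2) B0 by (intro AE_I2) (auto simp: norm_mult power2_eq_square intro!: mult_mono)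
  qed auto
  then have "weak_conv_m M \<nu>"
    by (rule levy_continuity[OF realM real\<nu>])
  have meas\<nu>: "measure \<nu> A = (\<integral>t. indicator (g -` A) t * (norm (q t))\<^sup>2 \<partial>circ)"
    if [measurable]: "A \<in> sets borel" for A
  proof -
    have m: "g -` A \<in> sets borel" using measurable_sets[of g borel borel A] by simp
    have "measure \<nu> A = measure N (g -` A)" unfolding \<nu>_def by (subst measure_distr) auto
    also have "\<dots> = (\<integral>t. indicator (g -` A) t \<partial>N)" using m by simp
    also have "\<dots> = (\<integral>t. (norm (q t))\<^sup>2 *\<^sub>R indicator (g -` A) t \<partial>circ)" using m by (subst int_N) auto
    finally show ?thesis by (simp add: mult.commute)
  qed
  \<comment> \<open>The density is bounded by \<open>B\<^sup>2\<close>, so an atom of the limit law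
    at u would need {g = u} to have positive measure.\<close>
  have "measure \<nu> {u} \<le> (\<integral>t. indicator (g -` {u}) t * B\<^sup>2 \<partial>circ)"
    unfolding meas\<nu>[of "{u}", simplified]
  proof (rule integral_mono)
    show "integrable circ (\<lambda>t. indicator (g -` {u}) t * (norm (q t))\<^sup>2)"
      using qsq by (intro integrable_circ_bounded[where B = "B\<^sup>2"]) (auto simp: indicator_def)
    show "integrable circ (\<lambda>t. indicator (g -` {u}) t * B\<^sup>2)"
      by (intro integrable_circ_bounded[where B = "B\<^sup>2"]) (auto simp: indicator_def)
  qed (use qsq in \<open>auto intro!: mult_left_mono\<close>)
  also have "\<dots> = measure circ {t. g t = u} * B\<^sup>2"
    by (simp add: vimage_def)
  finally have "measure \<nu> {u} = 0" using u by (simp add: measure_le_0_iff)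
  interpret \<nu>: real_distribution \<nu> by (rule real\<nu>)
  have "isCont (cdf \<nu>) u" using \<open>measure \<nu> {u} = 0\<close> by (simp add: \<nu>.isCont_cdf)
  then have cdf: "(\<lambda>n. cdf (M n) u) \<longlonglongrightarrow> cdf \<nu> u"
    using \<open>weak_conv_m M \<nu>\<close> unfolding weak_conv_m_def weak_conv_def by blast
  have "infsetsum (?w n) {\<lfloor>\<alpha> n * u\<rfloor><..} = 1 - cdf (M n) u" for n
  proof -
    have "cdf (M n) u = measure (measure_pmf (p n)) {k. real_of_int k / \<alpha> n \<le> u}"
      unfolding cdf_def M_def by (subst measure_distr) (auto simp: vimage_def)
    also have "{k. real_of_int k / \<alpha> n \<le> u} = - {\<lfloor>\<alpha> n * u\<rfloor><..}"
      using \<alpha>(1)[of n] by (auto simp: field_simps le_floor_iff not_less)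
    also have "measure (measure_pmf (p n)) (- {\<lfloor>\<alpha> n * u\<rfloor><..}) = 1 - measure (measure_pmf (p n)) {\<lfloor>\<alpha> n * u\<rfloor><..}"
      using measure_pmf.prob_compl[of "{\<lfloor>\<alpha> n * u\<rfloor><..}" "p n"] by (simp add: Compl_eq_Diff_UNIV)
    finally show ?thesis
      by (simp add: measure_pmf_conv_infsetsum pmf_p)
  qed
  moreover have "(\<integral>t. indicator {t. g t > u} t * (norm (q t))\<^sup>2 \<partial>circ) = 1 - cdf \<nu> u"
  proof -
    have "measure \<nu> {u<..} = (\<integral>t. indicator {t. g t > u} t * (norm (q t))\<^sup>2 \<partial>circ)"
      by (subst meas\<nu>) (auto simp: vimage_def)
    moreover have "measure \<nu> {u<..} = 1 - measure \<nu> {..u}"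
      using \<nu>.prob_compl[of "{..u}"] by (simp add: Compl_eq_Diff_UNIV[symmetric])
    ultimately show ?thesis by (simp add: cdf_def)
  qed
  ultimately show ?thesis using tendsto_diff[OF tendsto_const[of 1] cdf] by simp
qed

text \<open>The factor 1 / sqrt 2 keeps the combined vectors normalized, as
  \<open>energy_tail_limit\<close> treats probability measures only.\<close>

lemma polarization:
  fixes A B :: complex
  defines "r \<equiv> complex_of_real (1 / sqrt 2)"
  shows "A * cnj B = of_real ((norm (r * A + r * B))\<^sup>2) + \<i> * of_real ((norm (r * A + \<i> * r * B))\<^sup>2)
    - (1 + \<i>) / 2 * (of_real ((norm A)\<^sup>2) + of_real ((norm B)\<^sup>2))"
proof -
  have r: "cnj r = r" "r * r = 1 / 2" by (simp_all add: r_def flip: of_real_mult)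
  have r2: "r * (r * x) = x / 2" for x by (simp add: mult.assoc[symmetric] r)
  show ?thesis
    unfolding complex_norm_square
    by (simp add: r algebra_simps r2 add_divide_distrib)
qed

lemma integral_circ_norm_sq:
  fixes x y :: complex and a b :: int
  assumes "a \<noteq> b"
  shows "(\<integral>t. (norm (x * cis (- of_int b * t) + y * cis (- of_int a * t)))\<^sup>2 \<partial>circ) = (norm x)\<^sup>2 + (norm y)\<^sup>2"
proof -
  have pt: "complex_of_real ((norm (x * cis (- of_int b * t) + y * cis (- of_int a * t)))\<^sup>2) =
      (of_real ((norm x)\<^sup>2 + (norm y)\<^sup>2) + x * cnj y * cis (of_int (a - b) * t)) + cnj x * y * cis (of_int (b - a) * t)" for t
  proof -
    have 1: "cis (- of_int b * t) * cnj (cis (- of_int a * t)) = cis (of_int (a - b) * t)"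
      "cis (- of_int a * t) * cnj (cis (- of_int b * t)) = cis (of_int (b - a) * t)"
      "cis (- of_int a * t) * cnj (cis (- of_int a * t)) = 1"
      "cis (- of_int b * t) * cnj (cis (- of_int b * t)) = 1"
      by (simp_all add: cis_cnj cis_mult algebra_simps)
    have "complex_of_real ((norm (x * cis (- of_int b * t) + y * cis (- of_int a * t)))\<^sup>2) =
        x * cnj x * (cis (- of_int b * t) * cnj (cis (- of_int b * t))) +
        y * cnj y * (cis (- of_int a * t) * cnj (cis (- of_int a * t))) +
        x * cnj y * (cis (- of_int b * t) * cnj (cis (- of_int a * t))) +
        cnj x * y * (cis (- of_int a * t) * cnj (cis (- of_int b * t)))"
      unfolding complex_norm_square complex_cnj_add complex_cnj_mult by (simp only: algebra_simps)
    then show ?thesis unfolding 1 by (simp only: mult_1_right complex_norm_square of_real_add)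
  qed
  have i: "integrable circ (\<lambda>t. c * cis (of_int k * t))" for c :: complex and k :: int
    by (rule integrable_circ_bounded[where B = "norm c"]) (auto simp: norm_mult)
  have "complex_of_real (\<integral>t. (norm (x * cis (- of_int b * t) + y * cis (- of_int a * t)))\<^sup>2 \<partial>circ) =
      (\<integral>t. (of_real ((norm x)\<^sup>2 + (norm y)\<^sup>2) + x * cnj y * cis (of_int (a - b) * t)) + cnj x * y * cis (of_int (b - a) * t) \<partial>circ)"
    unfolding integral_complex_of_real[symmetric] pt ..
  also have "\<dots> = of_real ((norm x)\<^sup>2 + (norm y)\<^sup>2) + x * cnj y * (\<integral>t. cis (of_int (a - b) * t) \<partial>circ)
      + cnj x * y * (\<integral>t. cis (of_int (b - a) * t) \<partial>circ)"
    using i[of "x * cnj y" "a - b"] i[of "cnj x * y" "b - a"] circ.prob_space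
    by (subst Bochner_Integration.integral_add, simp, simp, subst Bochner_Integration.integral_add) simp_all
  also have "\<dots> = of_real ((norm x)\<^sup>2 + (norm y)\<^sup>2)"
    unfolding integral_circ_cis using assms by simp
  finally show ?thesis by (simp only: of_real_eq_iff)
qed

lemma tail_kernel_limit:
  fixes J :: "nat \<Rightarrow> int \<Rightarrow> complex" and \<alpha> :: "nat \<Rightarrow> real" and \<gamma> g :: "real \<Rightarrow> real"
  assumes J: "\<And>n. J n abssummable UNIV"
    and FJ: "\<And>n t. FT (J n) t = cis (\<alpha> n * \<gamma> t)"
    and \<alpha>: "\<And>n. \<alpha> n > 0" "filterlim \<alpha> at_top sequentially"
    and \<gamma>: "\<And>t. (\<gamma> has_real_derivative g t) (at t)"
    and g [measurable]: "g \<in> borel_measurable borel"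
    and u: "measure circ {t. g t = u} = 0"
  shows "(\<lambda>n. infsetsum (\<lambda>k. J n (k + b) * cnj (J n (k + a))) {\<lfloor>\<alpha> n * u\<rfloor><..}) \<longlonglongrightarrow>
    (\<integral>t. indicator {t. g t > u} t * cis (of_int (a - b) * t) \<partial>circ)"
proof -
  let ?T = "\<lambda>n. {\<lfloor>\<alpha> n * u\<rfloor><..}" and ?ind = "\<lambda>t. indicator {t. g t > u} t"
  define V where "V x y n k = x * J n (k + b) + y * J n (k + a)" for x y n k
  define q where "q x y t = x * cis (- of_int b * t) + y * cis (- of_int a * t)" for x y t
  define E where "E x y n = infsetsum (\<lambda>k. (norm (V x y n k))\<^sup>2) (?T n)" for x y n
  define I where "I x y = (\<integral>t. ?ind t * (norm (q x y t))\<^sup>2 \<partial>circ)" for x y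
  have V: "V x y n abssummable UNIV" for x y n
    unfolding V_def by (intro abs_summable_on_add abs_summable_on_cmult_right abs_summable_shift J)
  have qc: "continuous_on UNIV (q x y)" for x y
    unfolding q_def cis_conv_exp by (intro continuous_intros)
  have [measurable]: "q x y \<in> borel_measurable borel" for x y
    by (rule borel_measurable_continuous_onI[OF qc])
  have qb: "norm (q x y t) \<le> norm x + norm y" for x y t
    unfolding q_def by (rule order.trans[OF norm_triangle_ineq]) (simp add: norm_mult)
  have lim: "E x y \<longlonglongrightarrow> I x y" if "(\<integral>t. (norm (q x y t))\<^sup>2 \<partial>circ) = 1" for x y
    unfolding E_def I_def
  proof (rule energy_tail_limit[OF V _ \<alpha> \<gamma> g qc qb that u])
    show "FT (V x y n) t = q x y t * cis (\<alpha> n * \<gamma> t)" for n t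
    proof -
      have "FT (V x y n) t = x * FT (\<lambda>k. J n (k + b)) t + y * FT (\<lambda>k. J n (k + a)) t"
        unfolding V_def by (rule FT_linear) (intro abs_summable_shift J)+
      then show ?thesis unfolding FT_shift[OF J] FJ q_def by (simp add: algebra_simps)
    qed
  qed
  show ?thesis
  proof (cases "a = b")
    \<comment> \<open>For a = b the two modes coincide, so the combinations used in polarization
      would lose their normalization; here the product is already a squared modulus.\<close>
    case True
    have "(\<integral>t. (norm (q 1 0 t))\<^sup>2 \<partial>circ) = 1" using circ.prob_space by (simp add: q_def)
    from lim[OF this] have "(\<lambda>n. complex_of_real (E 1 0 n)) \<longlonglongrightarrow> of_real (I 1 0)" by (rule tendsto_of_real)
    moreover have "complex_of_real (E 1 0 n) = infsetsum (\<lambda>k. J n (k + b) * cnj (J n (k + a))) (?T n)" for n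
      unfolding E_def
      by (subst infsetsum_of_real[symmetric])
         (use abs_summable_norm_sq[OF V] in \<open>auto simp: V_def complex_norm_square True simp del: of_real_power\<close>)
    moreover have "complex_of_real (I 1 0) = (\<integral>t. ?ind t * cis (of_int (a - b) * t) \<partial>circ)"
      unfolding I_def integral_complex_of_real[symmetric]
      by (intro Bochner_Integration.integral_cong refl) (auto simp: q_def True indicator_def)
    ultimately show ?thesis by simp
  next
    case False
    define r where "r = complex_of_real (1 / sqrt 2)"
    have r: "(norm r)\<^sup>2 = 1 / 2" "(norm (\<i> * r))\<^sup>2 = 1 / 2"
      by (simp_all add: r_def norm_mult norm_divide power_divide)
    have q1: "(\<integral>t. (norm (q x y t))\<^sup>2 \<partial>circ) = 1" if "(norm x)\<^sup>2 + (norm y)\<^sup>2 = 1" for x y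
      unfolding q_def integral_circ_norm_sq[OF False] by (rule that)
    let ?c = "(1 + \<i>) / 2"
    have L: "(\<lambda>n. complex_of_real (E r r n) + \<i> * of_real (E r (\<i> * r) n) - ?c * (of_real (E 1 0 n) + of_real (E 0 1 n)))
        \<longlonglongrightarrow> of_real (I r r) + \<i> * of_real (I r (\<i> * r)) - ?c * (of_real (I 1 0) + of_real (I 0 1))"
      by (intro tendsto_intros lim q1) (simp_all add: r)
    have 1: "complex_of_real (E r r n) + \<i> * of_real (E r (\<i> * r) n) - ?c * (of_real (E 1 0 n) + of_real (E 0 1 n)) =
        infsetsum (\<lambda>k. J n (k + b) * cnj (J n (k + a))) (?T n)" for n
    proof -
      have s: "(\<lambda>k. complex_of_real ((norm (V x y n k))\<^sup>2)) abssummable ?T n" for x y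
        using abs_summable_norm_sq[OF V] by (simp del: of_real_power)
      have e: "complex_of_real (E x y n) = infsetsum (\<lambda>k. of_real ((norm (V x y n k))\<^sup>2)) (?T n)" for x y
        unfolding E_def by (rule infsetsum_of_real[symmetric])
      have "infsetsum (\<lambda>k. J n (k + b) * cnj (J n (k + a))) (?T n) =
          infsetsum (\<lambda>k. (of_real ((norm (V r r n k))\<^sup>2) + \<i> * of_real ((norm (V r (\<i> * r) n k))\<^sup>2)) -
            ?c * (of_real ((norm (V 1 0 n k))\<^sup>2) + of_real ((norm (V 0 1 n k))\<^sup>2))) (?T n)"
        by (rule infsetsum_cong[OF _ refl], subst polarization) (simp add: V_def r_def mult_ac del: of_real_power)
      also have "\<dots> = (infsetsum (\<lambda>k. of_real ((norm (V r r n k))\<^sup>2)) (?T n) + \<i> * infsetsum (\<lambda>k. of_real ((norm (V r (\<i> * r) n k))\<^sup>2)) (?T n)) -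
            ?c * (infsetsum (\<lambda>k. of_real ((norm (V 1 0 n k))\<^sup>2)) (?T n) + infsetsum (\<lambda>k. of_real ((norm (V 0 1 n k))\<^sup>2)) (?T n))"
        by (simp only: infsetsum_diff infsetsum_add infsetsum_cmult_right s abs_summable_on_add abs_summable_on_cmult_right)
      finally show ?thesis by (simp only: e)
    qed
    have 2: "complex_of_real (I r r) + \<i> * of_real (I r (\<i> * r)) - ?c * (of_real (I 1 0) + of_real (I 0 1)) =
        (\<integral>t. ?ind t * cis (of_int (a - b) * t) \<partial>circ)"
    proof -
      have s: "integrable circ (\<lambda>t. complex_of_real (?ind t * (norm (q x y t))\<^sup>2))" for x y
        by (rule integrable_circ_bounded[where B = "(norm x + norm y)\<^sup>2"])
           (use qb in \<open>auto simp: indicator_def norm_power power_mono\<close>)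
      have e: "complex_of_real (I x y) = (\<integral>t. complex_of_real (?ind t * (norm (q x y t))\<^sup>2) \<partial>circ)" for x y
        unfolding I_def by (rule integral_complex_of_real[symmetric])
      have "(\<integral>t. ?ind t * cis (of_int (a - b) * t) \<partial>circ) =
          (\<integral>t. (complex_of_real (?ind t * (norm (q r r t))\<^sup>2) + \<i> * of_real (?ind t * (norm (q r (\<i> * r) t))\<^sup>2)) -
            ?c * (of_real (?ind t * (norm (q 1 0 t))\<^sup>2) + of_real (?ind t * (norm (q 0 1 t))\<^sup>2)) \<partial>circ)"
      proof (intro Bochner_Integration.integral_cong refl)
        fix t
        have "cis (of_int (a - b) * t) = cis (- of_int b * t) * cnj (cis (- of_int a * t))"
          by (simp add: cis_cnj cis_mult algebra_simps)
        also have "\<dots> = (of_real ((norm (q r r t))\<^sup>2) + \<i> * of_real ((norm (q r (\<i> * r) t))\<^sup>2)) -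
            ?c * (of_real ((norm (q 1 0 t))\<^sup>2) + of_real ((norm (q 0 1 t))\<^sup>2))"
          by (subst polarization) (simp add: q_def r_def mult_ac del: of_real_power)
        finally show "?ind t * cis (of_int (a - b) * t) =
           (complex_of_real (?ind t * (norm (q r r t))\<^sup>2) + \<i> * of_real (?ind t * (norm (q r (\<i> * r) t))\<^sup>2)) -
            ?c * (of_real (?ind t * (norm (q 1 0 t))\<^sup>2) + of_real (?ind t * (norm (q 0 1 t))\<^sup>2))"
          by (simp add: indicator_def)
      qed
      also have "\<dots> = ((\<integral>t. complex_of_real (?ind t * (norm (q r r t))\<^sup>2) \<partial>circ) + \<i> * (\<integral>t. of_real (?ind t * (norm (q r (\<i> * r) t))\<^sup>2) \<partial>circ)) -
            ?c * ((\<integral>t. of_real (?ind t * (norm (q 1 0 t))\<^sup>2) \<partial>circ) + (\<integral>t. of_real (?ind t * (norm (q 0 1 t))\<^sup>2) \<partial>circ))"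
        by (simp only: Bochner_Integration.integral_diff Bochner_Integration.integral_add integral_mult_right_zero
              s Bochner_Integration.integrable_add integrable_mult_right)
      finally show ?thesis by (simp only: e)
    qed
    show ?thesis using L unfolding 1 2 .
  qed
qed

section \<open>Correlation functions of the Schur process\<close>

context inverse_pair
begin

lemma power_nat_abs_summable:
  assumes "\<And>n. norm (a n) \<le> K * s ^ nat \<bar>n\<bar>"
  shows "(a :: int \<Rightarrow> complex) abssummable UNIV"
proof (rule abs_summable_on_comparison_test)
  show "(\<lambda>n. K * s ^ nat \<bar>n\<bar>) abssummable UNIV"
    by (intro abs_summable_on_cmult_right geometric_abs_summable_int s)
  show "norm (a n) \<le> norm (K * s ^ nat \<bar>n\<bar>)" for n
    using order.trans[OF assms[of n] abs_ge_self] by simp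
qed

lemma J_summable: "J abssummable UNIV"
  by (rule power_nat_abs_summable[OF J_bound])

lemma h_summable: "h abssummable UNIV"
proof (rule power_nat_abs_summable)
  show "norm (h n) \<le> C * s ^ nat \<bar>n\<bar>" for n
  proof (cases "n \<ge> 0")
    case True
    have "norm (h n) \<le> C * s ^ (2 * nat n)" by (rule h_bound[OF True])
    also have "\<dots> \<le> C * s ^ nat n" using s C by (intro mult_left_mono power_decreasing) auto
    finally show ?thesis using True by simp
  qed (use s C in \<open>simp add: h_neg\<close>)
qed

lemma c_nat_summable: "(\<lambda>l::nat. c (int l)) abssummable UNIV"
proof (rule abs_summable_on_comparison_test)
  show "(\<lambda>l::nat. C * s ^ l) abssummable UNIV"
    using s C by (auto simp: abs_summable_on_nat_iff' norm_mult norm_power intro!: summable_mult summable_geometric)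
  show "norm (c (int l)) \<le> norm (C * s ^ l)" for l
  proof -
    have "norm (c (int l)) \<le> C * s ^ (2 * l)" using c_bound[of "int l"] by simp
    also have "\<dots> \<le> C * s ^ l" using s C by (intro mult_left_mono power_decreasing) auto
    finally show ?thesis by simp
  qed
qed

text \<open>With H(z) the series of h, summing the double series over n before l turns each
  translate of h into a power of cnj z times H, which leaves H(z) times the conjugate of the series
  of c. The bound of \<open>J_term_bound\<close> allows the exchange.\<close>

lemma FT_J:
  "FT J t = suminf (\<lambda>n. h (int n) * cis t ^ n) * cnj (suminf (\<lambda>n. c (int n) * cis t ^ n))"
proof -
  define f where "f n l = h (n + int l) * cnj (c (int l)) * cis (of_int n * t)" for n l
  have prod: "(\<lambda>(n, l). (C\<^sup>2 * s ^ nat \<bar>n\<bar>) * s ^ l) abssummable (UNIV :: int set) \<times> (UNIV :: nat set)"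
  proof -
    have g: "(\<lambda>l::nat. s ^ l) abssummable UNIV"
      using s by (auto simp: abs_summable_on_nat_iff' norm_power intro!: summable_geometric)
    have "infsetsum (\<lambda>l. norm ((C\<^sup>2 * s ^ nat \<bar>n\<bar>) * s ^ l)) UNIV = s ^ nat \<bar>n\<bar> * (C\<^sup>2 * infsetsum (\<lambda>l::nat. s ^ l) UNIV)" for n :: int
      using g s C by (simp add: infsetsum_cmult_right norm_mult norm_power)
    then have "(\<lambda>n. infsetsum (\<lambda>l. norm ((C\<^sup>2 * s ^ nat \<bar>n\<bar>) * s ^ l)) UNIV) abssummable UNIV"
      by (simp only:) (intro abs_summable_on_cmult_left geometric_abs_summable_int s)
    then show ?thesis
      using g by (subst abs_summable_on_Sigma_iff) (auto intro!: abs_summable_on_cmult_right)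
  qed
  have sum2: "(\<lambda>(n, l). f n l) abssummable (UNIV :: int set) \<times> (UNIV :: nat set)"
  proof (rule abs_summable_on_comparison_test[OF prod])
    show "norm (case x of (n, l) \<Rightarrow> f n l) \<le> norm (case x of (n, l) \<Rightarrow> C\<^sup>2 * s ^ nat \<bar>n\<bar> * s ^ l)" for x
    proof (cases x)
      case (Pair n l)
      have "norm (f n l) \<le> C\<^sup>2 * s ^ nat \<bar>n\<bar> * s ^ l"
        using J_term_bound[of n l] by (simp add: f_def norm_mult)
      then show ?thesis using Pair by (simp add: order.trans[OF _ abs_ge_self])
    qed
  qed
  have inner: "J n * cis (of_int n * t) = infsetsum (f n) UNIV" for n
  proof -
    have a: "(\<lambda>l. h (n + int l) * cnj (c (int l))) abssummable UNIV"
      using J_term_summable[of n] by (simp add: abs_summable_on_nat_iff')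
    have "J n = infsetsum (\<lambda>l. h (n + int l) * cnj (c (int l))) UNIV"
      unfolding J_def by (rule infsetsum_nat'[OF a, symmetric])
    then show ?thesis unfolding f_def by (simp add: infsetsum_cmult_left a)
  qed
  have outer: "infsetsum (\<lambda>n. f n l) UNIV = cnj (c (int l) * cis t ^ l) * FT h t" for l
  proof -
    have "infsetsum (\<lambda>n. f n l) UNIV = infsetsum (\<lambda>n. cnj (c (int l)) * (h (n + int l) * cis (of_int n * t))) UNIV"
      by (simp add: f_def mult_ac)
    also have "\<dots> = cnj (c (int l)) * FT (\<lambda>n. h (n + int l)) t"
      unfolding FT_def by (rule infsetsum_cmult_right) (use abs_summable_cis abs_summable_shift h_summable in blast)
    also have "\<dots> = cnj (c (int l) * cis t ^ l) * FT h t"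
    proof -
      have "cis (- of_int (int l) * t) = cnj (cis t ^ l)" by (simp add: Complex.DeMoivre cis_cnj)
      then show ?thesis by (simp only: FT_shift[OF h_summable] complex_cnj_mult mult.assoc)
    qed
    finally show ?thesis .
  qed
  have cs: "(\<lambda>l. c (int l) * cis t ^ l) abssummable UNIV"
    by (subst abs_summable_on_norm_iff[symmetric]) (use c_nat_summable in \<open>simp add: norm_mult norm_power\<close>)
  then have cs': "(\<lambda>l. cnj (c (int l) * cis t ^ l)) abssummable UNIV"
    by (subst abs_summable_on_norm_iff[symmetric]) (simp only: complex_mod_cnj abs_summable_on_norm_iff)
  have csum: "infsetsum (\<lambda>l. cnj (c (int l) * cis t ^ l)) UNIV = cnj (suminf (\<lambda>n. c (int n) * cis t ^ n))"
  proof -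
    have "(\<lambda>l. c (int l) * cis t ^ l) sums suminf (\<lambda>n. c (int n) * cis t ^ n)"
      by (rule summable_sums, rule summable_norm_cancel) (use cs in \<open>simp add: abs_summable_on_nat_iff'\<close>)
    then have "(\<lambda>l. cnj (c (int l) * cis t ^ l)) sums cnj (suminf (\<lambda>n. c (int n) * cis t ^ n))"
      by (simp only: sums_cnj)
    then show ?thesis unfolding infsetsum_nat'[OF cs'] by (rule sums_unique[symmetric])
  qed
  have hsum: "FT h t = suminf (\<lambda>n. h (int n) * cis t ^ n)"
    unfolding FT_def infsetsum_split_int(2)[OF abs_summable_cis[OF h_summable, of t], where n = "-1"]
    by (simp add: h_neg Complex.DeMoivre)
  have "FT J t = infsetsum (\<lambda>n. infsetsum (f n) UNIV) UNIV"
    unfolding FT_def by (simp add: inner)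
  also have "\<dots> = infsetsum (\<lambda>l. infsetsum (\<lambda>n. f n l) UNIV) UNIV"
    by (rule infsetsum_swap) (use sum2 in auto)
  also have "\<dots> = infsetsum (\<lambda>l. cnj (c (int l) * cis t ^ l)) UNIV * FT h t"
    unfolding outer by (rule infsetsum_cmult_left) (use cs' in simp)
  finally show ?thesis unfolding csum hsum by (rule trans[OF _ mult.commute])
qed

text \<open>By Parseval the inner product of two translates of J is an integral of
  \<open>FT J\<close> times its conjugate against an exponential. Unimodularity removes the symbol
  and leaves the orthogonality of the exponentials.\<close>

lemma J_orthI:
  assumes "\<And>t. norm (FT J t) = 1"
  shows "unimodular_pair h c C s"
proof
  fix x z
  have pr: "(\<lambda>n. J (n + x) * cnj (J (n + z))) abssummable UNIV"
  proof (rule abs_summable_on_comparison_test)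
    show "(\<lambda>n. (C\<^sup>2 / (1 - s)) * norm (J (n + x))) abssummable UNIV"
      by (intro abs_summable_on_cmult_right abs_summable_on_normI abs_summable_shift J_summable)
    show "norm (J (n + x) * cnj (J (n + z))) \<le> norm ((C\<^sup>2 / (1 - s)) * norm (J (n + x)))" for n
    proof -
      have "norm (J (n + z)) \<le> C\<^sup>2 / (1 - s) * s ^ nat \<bar>n + z\<bar>" by (rule J_bound)
      also have "\<dots> \<le> C\<^sup>2 / (1 - s) * 1"
        using s by (intro mult_left_mono power_le_one) auto
      finally have "norm (J (n + x)) * norm (J (n + z)) \<le> norm (J (n + x)) * (C\<^sup>2 / (1 - s))"
        by (intro mult_left_mono) auto
      then show ?thesis using s by (simp add: norm_mult mult.commute)
    qed
  qed
  have "infsetsum (\<lambda>n. J (n + x) * cnj (J (n + z))) UNIV =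
      (\<integral>t. FT (\<lambda>n. J (n + x)) t * cnj (FT (\<lambda>n. J (n + z)) t) \<partial>circ)"
    by (rule parseval[symmetric]; intro abs_summable_shift J_summable)
  also have "\<dots> = (\<integral>t. cis (of_int (z - x) * t) \<partial>circ)"
  proof (intro Bochner_Integration.integral_cong refl)
    fix t
    have "FT J t * cnj (FT J t) = 1" using assms[of t] by (simp add: complex_norm_square[symmetric])
    then have "FT (\<lambda>n. J (n + x)) t * cnj (FT (\<lambda>n. J (n + z)) t) = cis (- of_int x * t) * cnj (cis (- of_int z * t)) * 1"
      unfolding FT_shift[OF J_summable] complex_cnj_mult by (metis mult.assoc mult.left_commute)
    then show "FT (\<lambda>n. J (n + x)) t * cnj (FT (\<lambda>n. J (n + z)) t) = cis (of_int (z - x) * t)"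
      by (simp add: cis_cnj cis_mult algebra_simps)
  qed
  also have "\<dots> = (if x = z then 1 else 0)" unfolding integral_circ_cis by simp
  finally show "suminf (\<lambda>k. J (x + 1 + int k) * cnj (J (z + 1 + int k))) +
      suminf (\<lambda>k. J (x - int k) * cnj (J (z - int k))) = (if x = z then 1 else 0)"
    unfolding infsetsum_split_int(2)[OF pr, of 0] by (simp add: add_ac)
qed

end

context unimodular_pair
begin

text \<open>A shift by X only moves the starting point of the summation, so the kernel near \<alpha>
  u becomes a tail sum to which \<open>tail_kernel_limit\<close> applies.\<close>

lemma ker_shift:
  "ker (y + X) (x + X) = infsetsum (\<lambda>k. J (k + x) * cnj (J (k + y))) {X<..}"
proof -
  have pr: "(\<lambda>n. J (n + x) * cnj (J (n + y))) abssummable UNIV"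
  proof (rule abs_summable_on_comparison_test)
    show "(\<lambda>n. (C\<^sup>2 / (1 - s)) * norm (J (n + x))) abssummable UNIV"
      by (intro abs_summable_on_cmult_right abs_summable_on_normI abs_summable_shift J_summable)
    show "norm (J (n + x) * cnj (J (n + y))) \<le> norm ((C\<^sup>2 / (1 - s)) * norm (J (n + x)))" for n
    proof -
      have "norm (J (n + y)) \<le> C\<^sup>2 / (1 - s) * s ^ nat \<bar>n + y\<bar>" by (rule J_bound)
      also have "\<dots> \<le> C\<^sup>2 / (1 - s) * 1"
        using s by (intro mult_left_mono power_le_one) auto
      finally have "norm (J (n + x)) * norm (J (n + y)) \<le> norm (J (n + x)) * (C\<^sup>2 / (1 - s))"
        by (intro mult_left_mono) auto
      then show ?thesis using s by (simp add: norm_mult mult.commute)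
    qed
  qed
  show ?thesis
    unfolding infsetsum_split_int(1)[OF pr, of X] ker_def by (simp add: add_ac)
qed

end

section \<open>From boxes to the Schur measure on all partitions\<close>

lemma partition_conf_pos: "partition_conf l = range (pos l)"
  by (auto simp: partition_conf_def pos_def image_def algebra_simps)

lemma boxed_subset_partitions: "boxed N N \<subseteq> partitions"
proof
  fix l assume l: "l \<in> boxed N N"
  then have "{i. l i \<noteq> 0} \<subseteq> {..<N}" by (auto simp: boxed_def not_less[symmetric])
  then show "l \<in> partitions" using l finite_subset by (auto simp: boxed_def partitions_def)
qed

lemma partitions_eventually_boxed:
  assumes "l \<in> partitions"
  shows "eventually (\<lambda>N. l \<in> boxed N N) sequentially"
proof -
  have "finite {i. l i \<noteq> 0}" "antimono l" using assms by (auto simp: partitions_def)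
  then obtain m where m: "{i. l i \<noteq> 0} \<subseteq> {..<m}" using finite_nat_bounded by blast
  have "l i = 0" if "i \<ge> m" for i using m that by (meson leD lessThan_iff mem_Collect_eq subsetD)
  then show ?thesis
    using \<open>antimono l\<close> by (intro eventually_sequentiallyI[of "max m (l 0)"]) (auto simp: boxed_def)
qed

lemma filterlim_boxed: "filterlim (\<lambda>N. boxed N N) (finite_subsets_at_top partitions) sequentially"
  unfolding filterlim_finite_subsets_at_top
proof (intro allI impI)
  fix X :: "(nat \<Rightarrow> nat) set" assume X: "finite X \<and> X \<subseteq> partitions"
  then have "eventually (\<lambda>N. \<forall>l\<in>X. l \<in> boxed N N) sequentially"
    by (intro eventually_ball_finite) (auto intro: partitions_eventually_boxed)
  then show "eventually (\<lambda>N. finite (boxed N N) \<and> X \<subseteq> boxed N N \<and> boxed N N \<subseteq> partitions) sequentially"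
    by eventually_elim (auto simp: finite_boxed boxed_subset_partitions[THEN subsetD])
qed

locale schur_kernel = unimodular_pair "spec_h \<sigma>" c C s for \<sigma> c C s +
  assumes spec: "specialization \<sigma>"
begin

definition w where "w l = (cmod (\<sigma> (schur l)))\<^sup>2"

lemma w_weight: "l \<in> boxed N N \<Longrightarrow> w l = (norm (weight N l))\<^sup>2"
proof -
  assume l: "l \<in> boxed N N"
  then have "\<sigma> (schur l) = fdet N (\<lambda>i j. spec_h \<sigma> (int (l i) - int i + int j))"
    using boxed_subset_partitions by (intro spec_schur[OF spec]) (auto simp: boxed_def)
  also have "\<dots> = weight N l"
    unfolding weight_def phi_def pos_def by (simp add: algebra_simps)
  finally show ?thesis by (simp add: w_def)
qed

text \<open>Every finite set of partitions fits in some box, so its weight is at most a bounded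
  \<open>Z N\<close>. Hence the normalizing \<open>infsum\<close> in \<open>schur_measure\<close> is
  the true total weight and not the default value 0.\<close>

lemma w_summable: "w summable_on partitions"
proof -
  obtain B where B: "\<And>N. Z N \<le> B" using Z_bounded by blast
  show ?thesis
  proof (rule nonneg_bdd_above_summable_on)
    show "bdd_above (sum w ` {F. F \<subseteq> partitions \<and> finite F})"
    proof (rule bdd_aboveI2)
      fix F assume F: "F \<in> {F. F \<subseteq> partitions \<and> finite F}"
      then have "eventually (\<lambda>N. \<forall>l\<in>F. l \<in> boxed N N) sequentially"
        by (intro eventually_ball_finite) (auto intro: partitions_eventually_boxed)
      then obtain N where "F \<subseteq> boxed N N" unfolding eventually_sequentially by blast
      then have "sum w F \<le> sum w (boxed N N)"
        by (intro sum_mono2 finite_boxed) (auto simp: w_def)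
      also have "\<dots> = Z N" unfolding Z_def by (intro sum.cong refl w_weight)
      also have "\<dots> \<le> B" by (rule B)
      finally show "sum w F \<le> B" .
    qed
  qed (simp add: w_def)
qed

lemma boxed_sum_tendsto:
  assumes "f summable_on partitions"
  shows "(\<lambda>N. sum f (boxed N N)) \<longlonglongrightarrow> infsum (f :: _ \<Rightarrow> real) partitions"
proof -
  have "(sum f \<longlongrightarrow> infsum f partitions) (finite_subsets_at_top partitions)"
    using has_sum_infsum[OF assms] by (simp add: has_sum_def)
  then show ?thesis by (rule filterlim_compose[OF _ filterlim_boxed])
qed

definition Zinf where "Zinf = infsum w partitions"

lemma Z_tendsto: "Z \<longlonglongrightarrow> Zinf"
proof -
  have "Z = (\<lambda>N. sum w (boxed N N))"
    unfolding Z_def by (intro ext sum.cong refl w_weight[symmetric])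
  then show ?thesis using boxed_sum_tendsto[OF w_summable] by (simp add: Zinf_def)
qed

lemma Zinf_ge_1: "Zinf \<ge> 1"
  by (rule tendsto_lowerbound[OF Z_tendsto]) (auto simp: Z_ge_1)

lemma emeasure_schur_measure:
  assumes "A \<subseteq> partitions"
  shows "emeasure (schur_measure \<sigma>) A = ennreal (infsum w A / Zinf)"
proof -
  have sA: "w summable_on A" using w_summable assms by (rule summable_on_subset_banach)
  have aA: "w abssummable A"
  proof -
    have "(\<lambda>l. norm (w l)) = w" by (auto simp: w_def)
    then show ?thesis using sA by (subst abs_summable_equivalent[symmetric]) simp
  qed
  have "emeasure (schur_measure \<sigma>) A = (\<integral>\<^sup>+l. ennreal (w l / Zinf) * indicator A l \<partial>count_space partitions)"
    unfolding schur_measure_def point_measure_def w_def[symmetric] Zinf_def[symmetric]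
    using assms by (subst emeasure_density) auto
  also have "\<dots> = (\<integral>\<^sup>+l. ennreal (w l / Zinf) * indicator A l * indicator partitions l \<partial>count_space UNIV)"
    by (rule nn_integral_count_space_indicator) simp
  also have "\<dots> = (\<integral>\<^sup>+l. ennreal (w l / Zinf) * indicator A l \<partial>count_space UNIV)"
    by (intro nn_integral_cong) (use assms in \<open>auto simp: indicator_def\<close>)
  also have "\<dots> = (\<integral>\<^sup>+l. ennreal (w l / Zinf) \<partial>count_space A)"
    by (rule nn_integral_count_space_indicator[symmetric]) simp
  also have "\<dots> = ennreal (infsetsum (\<lambda>l. w l / Zinf) A)"
  proof (rule nn_integral_conv_infsetsum)
    show "(\<lambda>l. w l / Zinf) abssummable A"
      unfolding divide_inverse by (intro abs_summable_on_cmult_left aA)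
  qed (use Zinf_ge_1 in \<open>simp add: w_def\<close>)
  also have "infsetsum (\<lambda>l. w l / Zinf) A = infsetsum w A / Zinf"
    unfolding divide_inverse by (rule infsetsum_cmult_left) (use aA in simp)
  also have "infsetsum w A = infsum w A" by (rule infsetsum_infsum[OF aA])
  finally show ?thesis .
qed

lemma prob_space_schur_measure: "prob_space (schur_measure \<sigma>)"
proof (rule prob_spaceI)
  have "space (schur_measure \<sigma>) = partitions" by (simp add: schur_measure_def space_point_measure)
  then show "emeasure (schur_measure \<sigma>) (space (schur_measure \<sigma>)) = 1"
    using emeasure_schur_measure[of partitions] Zinf_ge_1 by (simp add: Zinf_def)
qed

text \<open>The identity \<open>boxed_correlation\<close>, still multiplied by \<open>Z N\<close>,
  is passed to the limit on both sides; finally the limit \<open>Zinf\<close> >= 1 is divided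
  out.\<close>

theorem schur_correlation:
  assumes "distinct ms"
  shows "complex_of_real (measure (schur_measure \<sigma>) {l \<in> partitions. set ms \<subseteq> partition_conf l}) =
    fdet (length ms) (\<lambda>i j. ker (ms ! i) (ms ! j))"
proof -
  let ?A = "{l \<in> partitions. set ms \<subseteq> partition_conf l}"
  have ms: "complex_of_real (measure (schur_measure \<sigma>) ?A) = of_real (infsum w ?A) / of_real Zinf"
    using emeasure_schur_measure[of ?A] Zinf_ge_1
    by (simp add: measure_def w_def infsum_nonneg)
  define v where "v l = (if set ms \<subseteq> partition_conf l then w l else 0)" for l
  have v: "v summable_on partitions" "infsum v partitions = infsum w ?A"
  proof -
    have "w summable_on ?A" using w_summable by (rule summable_on_subset_banach) auto
    moreover have "(v summable_on partitions) = (w summable_on ?A)"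
      by (rule summable_on_cong_neutral) (auto simp: v_def)
    ultimately show "v summable_on partitions" by simp
    show "infsum v partitions = infsum w ?A"
      by (rule infsum_cong_neutral) (auto simp: v_def)
  qed
  have L: "(\<lambda>N. complex_of_real (sum v (boxed N N))) \<longlonglongrightarrow> of_real (infsum w ?A)"
    using tendsto_of_real[OF boxed_sum_tendsto[OF v(1)]] unfolding v(2) .
  have R: "(\<lambda>N. of_real (Z N) * fdet (length ms) (\<lambda>i j. PN N (ms ! i) (ms ! j))) \<longlonglongrightarrow>
      of_real Zinf * fdet (length ms) (\<lambda>i j. ker (ms ! i) (ms ! j))"
    by (intro tendsto_mult tendsto_of_real Z_tendsto tendsto_fdet PN_tendsto)
  have "eventually (\<lambda>N. \<forall>x\<in>set ms. x \<in> {- int N..<int N}) sequentially"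
    by (intro eventually_ball_finite ballI eventually_in_window) simp
  then have ev: "eventually (\<lambda>N. complex_of_real (sum v (boxed N N)) =
      of_real (Z N) * fdet (length ms) (\<lambda>i j. PN N (ms ! i) (ms ! j))) sequentially"
  proof eventually_elim
    case (elim N)
    have "sum v (boxed N N) = (\<Sum>l | l \<in> boxed N N \<and> set ms \<subseteq> range (pos l). (norm (weight N l))\<^sup>2)"
      unfolding v_def partition_conf_pos
      by (subst sum.inter_filter[symmetric]) (auto simp: finite_boxed w_weight intro!: sum.cong)
    moreover have "set ms \<subseteq> {- int N..<int N}" using elim by blast
    ultimately show ?case by (simp only: boxed_correlation[OF assms])
  qed
  have "(\<lambda>N. complex_of_real (sum v (boxed N N))) \<longlonglongrightarrow>
      of_real Zinf * fdet (length ms) (\<lambda>i j. ker (ms ! i) (ms ! j))"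
    by (rule iffD2[OF tendsto_cong[OF ev] R])
  from LIMSEQ_unique[OF L this] show ?thesis unfolding ms using Zinf_ge_1 by simp
qed

end

text \<open>Newton's recursion makes the numbers \<sigma>(h_n) the coefficients of exp A, and c
  those of exp (-A). The symbol is therefore exp(A) cnj(exp(-A)) = exp(A - cnj A), a pure phase
  equal to twice the imaginary part of A.\<close>

theorem schur_kernel_exists:
  assumes \<sigma>: "specialization \<sigma>" and R: "1 < R" "ereal R \<le> fps_conv_radius A"
    and A: "\<And>k. fps_nth A k = (if k = 0 then 0 else \<sigma> (power_sum k) / of_nat k)"
  obtains c C s where "schur_kernel \<sigma> c C s"
    "\<And>t. FT (inverse_pair.J (spec_h \<sigma>) c) t = cis (2 * Im (eval_fps A (cis t)))"
proof -
  let ?h = "\<lambda>n. \<sigma> (hsym n)"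
  have h0: "?h 0 = 1" using \<sigma> by (simp add: hsym_0 specialization_def)
  have newton: "of_nat n * ?h n = (\<Sum>k=1..n. of_nat k * fps_nth A k * ?h (n - k))" for n
    unfolding spec_newton[OF \<sigma>] by (intro sum.cong refl) (auto simp: A)
  have A0: "fps_nth A 0 = 0" by (simp add: A)
  show ?thesis
  proof (rule exp_newton_coefficients[OF R A0 h0 newton])
  fix c :: "nat \<Rightarrow> complex" and C s :: real
  assume s: "0 < s" "s < 1" "0 < C"
    and b: "\<And>n. norm (?h n) \<le> C * s ^ (2 * n)" "\<And>n. norm (c n) \<le> C * s ^ (2 * n)" and c0: "c 0 = 1"
    and conv: "\<And>n. n > 0 \<Longrightarrow> (\<Sum>k=0..n. c k * ?h (n - k)) = 0"
    and H: "\<And>z. norm z = 1 \<Longrightarrow> (\<lambda>n. ?h n * z ^ n) sums exp (eval_fps A z)"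
    and M: "\<And>z. norm z = 1 \<Longrightarrow> (\<lambda>n. c n * z ^ n) sums exp (- eval_fps A z)"
  define c' where "c' n = (if n < 0 then 0 else c (nat n))" for n :: int
  have hn: "spec_h \<sigma> (int n - int k) = ?h (n - k)" if "k \<le> n" for n k
    using that by (simp add: spec_h_def nat_diff_distrib)
  interpret inverse_pair "spec_h \<sigma>" c' C s
  proof
    show "(\<Sum>k=0..n. c' (int k) * spec_h \<sigma> (int n - int k)) = 0" if "n > 0" for n
      using conv[OF that] by (simp add: c'_def hn)
  qed (use s b c0 h0 in \<open>auto simp: spec_h_def c'_def\<close>)
  have F: "FT J t = cis (2 * Im (eval_fps A (cis t)))" for t
  proof -
    let ?a = "eval_fps A (cis t)"
    have "suminf (\<lambda>n. spec_h \<sigma> (int n) * cis t ^ n) = exp ?a"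
      using sums_unique[OF H[of "cis t"]] by (simp add: spec_h_def)
    moreover have "suminf (\<lambda>n. c' (int n) * cis t ^ n) = exp (- ?a)"
      using sums_unique[OF M[of "cis t"]] by (simp add: c'_def)
    ultimately have "FT J t = exp (?a - cnj ?a)"
      unfolding FT_J by (simp add: exp_cnj exp_diff exp_minus divide_inverse)
    also have "?a - cnj ?a = \<i> * of_real (2 * Im ?a)"
      by (simp add: complex_eq_iff)
    finally show ?thesis by (simp add: cis_conv_exp)
  qed
  interpret unimodular_pair "spec_h \<sigma>" c' C s
    by (rule J_orthI) (simp add: F)
  have "schur_kernel \<sigma> c' C s" by unfold_locales (rule \<sigma>)
  then show ?thesis using F by (rule that)
  qed
qed

section \<open>The kernels of the limit processes\<close>

lemma integral_periodic_shift:
  fixes F :: "real \<Rightarrow> complex"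
  assumes F: "F \<in> borel_measurable borel" "\<And>t. norm (F t) \<le> B" and per: "\<And>t. F (t + 2 * pi) = F t"
  shows "(LINT t|lborel. indicator {c..c + 2 * pi} t *\<^sub>R F t) = (LINT t|lborel. indicator {0..2 * pi} t *\<^sub>R F t)"
proof -
  note [measurable] = F(1)
  have int: "integrable lborel (\<lambda>t. indicator {a..b} t *\<^sub>R F t)" for a b
  proof (rule Bochner_Integration.integrable_bound)
    show "integrable lborel (\<lambda>t. B * indicator {a..b} t)"
      by (intro integrable_mult_right integrable_real_indicator) (auto simp: emeasure_lborel_Icc_eq)
    show "AE t in lborel. norm (indicator {a..b} t *\<^sub>R F t) \<le> norm (B * indicator {a..b} t)"
      by (intro AE_I2) (auto simp: indicator_def intro: order.trans[OF F(2) abs_ge_self])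
  qed measurable
  define k where "k = \<lfloor>c / (2 * pi)\<rfloor>"
  define d where "d = c - 2 * pi * of_int k"
  have d: "0 \<le> d" "d \<le> 2 * pi"
  proof -
    have "of_int k \<le> c / (2 * pi)" "c / (2 * pi) \<le> of_int k + 1" unfolding k_def by linarith+
    then show "0 \<le> d" "d \<le> 2 * pi" by (auto simp: d_def field_simps)
  qed
  have perN: "F (t + 2 * pi * of_nat n) = F t" for t and n :: nat
  proof (induction n)
    case (Suc n)
    have "F (t + 2 * pi * of_nat (Suc n)) = F ((t + 2 * pi * of_nat n) + 2 * pi)" by (simp add: algebra_simps)
    then show ?case using per Suc by simp
  qed simp
  have perZ: "F (t + 2 * pi * of_int j) = F t" for t j
  proof (cases "j \<ge> 0")
    case True
    then show ?thesis using perN[of t "nat j"] by simp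
  next
    case False
    then show ?thesis using perN[of "t + 2 * pi * of_int j" "nat (- j)"] by (simp add: algebra_simps)
  qed
  have trans: "(LINT t|lborel. indicator {a + 2 * pi * of_int j..b + 2 * pi * of_int j} t *\<^sub>R F t) =
      (LINT t|lborel. indicator {a..b} t *\<^sub>R F t)" for a b j
    by (subst lborel_integral_real_affine[where c = 1 and t = "2 * pi * of_int j"])
       (auto simp: indicator_def perZ add.commute intro!: Bochner_Integration.integral_cong)
  have split: "(LINT t|lborel. indicator {a..b} t *\<^sub>R F t) =
      (LINT t|lborel. indicator {a..x} t *\<^sub>R F t) + (LINT t|lborel. indicator {x..b} t *\<^sub>R F t)"
    if "a \<le> x" "x \<le> b" for a b x
  proof -
    have "(LINT t|lborel. indicator {a..b} t *\<^sub>R F t) =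
        (LINT t|lborel. indicator {a..x} t *\<^sub>R F t + indicator {x..b} t *\<^sub>R F t)"
    proof (rule integral_cong_AE)
      show "AE t in lborel. indicator {a..b} t *\<^sub>R F t = indicator {a..x} t *\<^sub>R F t + indicator {x..b} t *\<^sub>R F t"
        using AE_lborel_singleton[of x] by eventually_elim (use that in \<open>auto simp: indicator_def\<close>)
    qed auto
    then show ?thesis by (simp add: Bochner_Integration.integral_add[OF int int])
  qed
  have c: "c = d + 2 * pi * of_int k" by (simp add: d_def)
  have "(LINT t|lborel. indicator {c..c + 2 * pi} t *\<^sub>R F t) = (LINT t|lborel. indicator {d..d + 2 * pi} t *\<^sub>R F t)"
    using trans[of d k "d + 2 * pi"] by (simp add: c add_ac)
  also have "\<dots> = (LINT t|lborel. indicator {d..2 * pi} t *\<^sub>R F t) + (LINT t|lborel. indicator {2 * pi..d + 2 * pi} t *\<^sub>R F t)"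
    by (rule split) (use d in auto)
  also have "(LINT t|lborel. indicator {2 * pi..d + 2 * pi} t *\<^sub>R F t) = (LINT t|lborel. indicator {0..d} t *\<^sub>R F t)"
    using trans[of 0 1 d] by simp
  also have "(LINT t|lborel. indicator {d..2 * pi} t *\<^sub>R F t) + (LINT t|lborel. indicator {0..d} t *\<^sub>R F t) =
      (LINT t|lborel. indicator {0..2 * pi} t *\<^sub>R F t)"
    using split[of 0 d "2 * pi"] d by (simp add: add.commute)
  finally show ?thesis .
qed

lemma cis_add_2pi: "cis (t + 2 * pi) = cis t"
  by (simp add: cis.code)

lemma cis_arc_measurable [measurable]: "cis ` {a..b} \<in> sets borel"
proof -
  have "compact (cis ` {a..b})"
    unfolding cis_conv_exp[abs_def] by (intro compact_continuous_image continuous_intros) auto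
  then show ?thesis by (intro borel_closed compact_imp_closed)
qed

text \<open>The period of integration is moved to start at \<phi>. There the parameters of the arc
  are the interval {\<phi>..\<psi>}, except at the two ends of the period, where \<open>cis\<close>
  takes the same value; these are null sets, so the full circle is covered as well.\<close>

lemma arc_integral:
  assumes "\<phi> \<le> \<psi>" "\<psi> \<le> \<phi> + 2 * pi"
  shows "(\<integral>t. indicator (cis ` {\<phi>..\<psi>}) (cis t) * cis (of_int d * t) \<partial>circ) =
    (if d = 0 then of_real ((\<psi> - \<phi>) / (2 * pi))
     else (cis (of_int d * \<psi>) - cis (of_int d * \<phi>)) / (2 * pi * \<i> * of_int d))"
proof -
  let ?F = "\<lambda>t. indicator (cis ` {\<phi>..\<psi>}) (cis t) * cis (of_int d * t) :: complex"
  have m: "?F \<in> borel_measurable borel" by measurable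
  have per: "?F (t + 2 * pi) = ?F t" for t
  proof -
    have "cis (of_int d * (t + 2 * pi)) = cis (of_int d * t) * cis (2 * pi * of_int d)"
      by (simp add: cis_mult algebra_simps)
    also have "cis (2 * pi * of_int d) = 1" by (rule cis_multiple_2pi) simp
    finally show ?thesis by (simp add: cis_add_2pi)
  qed
  have inj: "cis t \<in> cis ` {\<phi>..\<psi>} \<longleftrightarrow> t \<in> {\<phi>..\<psi>}" if t: "\<phi> < t" "t < \<phi> + 2 * pi" for t
  proof
    assume "cis t \<in> cis ` {\<phi>..\<psi>}"
    then obtain s where s: "cis t = cis s" "\<phi> \<le> s" "s \<le> \<psi>" by auto
    then obtain n :: int where n: "t = s + 2 * pi * of_int n"
      using sin_cos_eq_iff[of t s] by (auto simp: complex_eq_iff)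
    have "\<bar>t - s\<bar> < 2 * pi" using t s assms by linarith
    then have "\<bar>of_int n\<bar> * (2 * pi) < 1 * (2 * pi)" using n by (simp add: abs_mult mult.commute)
    then have "\<bar>of_int n :: real\<bar> < 1" by (rule mult_right_less_imp_less) simp
    then have "n = 0" by linarith
    then show "t \<in> {\<phi>..\<psi>}" using n s by simp
  qed auto
  have "(\<integral>t. ?F t \<partial>circ) = (LINT t|lborel. indicator {0..2*pi} t *\<^sub>R ?F t) /\<^sub>R (2 * pi)"
    by (rule integral_circ[OF m])
  also have "(LINT t|lborel. indicator {0..2*pi} t *\<^sub>R ?F t) = (LINT t|lborel. indicator {\<phi>..\<phi> + 2 * pi} t *\<^sub>R ?F t)"
    by (rule integral_periodic_shift[OF m _ per, symmetric, where B = 1]) (auto simp: indicator_def norm_mult)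
  also have "\<dots> = (LINT t|lborel. indicator {\<phi>..\<psi>} t *\<^sub>R cis (of_int d * t))"
  proof (rule integral_cong_AE)
    show "AE t in lborel. indicator {\<phi>..\<phi> + 2 * pi} t *\<^sub>R ?F t = indicator {\<phi>..\<psi>} t *\<^sub>R cis (of_int d * t)"
      using AE_lborel_singleton[of \<phi>] AE_lborel_singleton[of "\<phi> + 2 * pi"]
    proof eventually_elim
      case (elim t)
      show ?case
      proof (cases "\<phi> < t \<and> t < \<phi> + 2 * pi")
        case True
        then have "(cis t \<in> cis ` {\<phi>..\<psi>}) = (t \<in> {\<phi>..\<psi>})" by (intro inj) auto
        then show ?thesis using True by (simp add: indicator_def)
      next
        case False
        then show ?thesis using elim assms by (auto simp: indicator_def)
      qed
    qed
  qed (use m in auto)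
  also have "\<dots> /\<^sub>R (2 * pi) = (if d = 0 then of_real ((\<psi> - \<phi>) / (2 * pi))
     else (cis (of_int d * \<psi>) - cis (of_int d * \<phi>)) / (2 * pi * \<i> * of_int d))"
  proof (cases "d = 0")
    case True
    have "(LINT t|lborel. indicator {\<phi>..\<psi>} t *\<^sub>R (1::complex)) = of_real (\<psi> - \<phi>)"
      using assms by (simp add: scaleR_conv_of_real)
    then show ?thesis using True by (simp add: scaleR_conv_of_real field_simps)
  next
    case False
    let ?A = "\<lambda>t. cis (of_int d * t) / (\<i> * of_int d)"
    have "(LINT t|lborel. indicator {\<phi>..\<psi>} t *\<^sub>R cis (of_int d * t)) = ?A \<psi> - ?A \<phi>"
    proof (rule integral_FTC_atLeastAtMost[OF assms(1)])
      fix x :: real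
      show "(?A has_vector_derivative cis (of_int d * x)) (at x within {\<phi>..\<psi>})"
        unfolding cis_conv_exp
        by (rule has_vector_derivative_at_within)
           (auto intro!: derivative_eq_intros has_vector_derivative_real_field simp: False field_simps)
    qed (auto intro!: continuous_intros simp: cis_conv_exp)
    then show ?thesis using False by (simp add: scaleR_conv_of_real field_simps)
  qed
  finally show ?thesis .
qed

text \<open>The limit kernel is a Fourier coefficient of the indicator of A. It thus depends on the
  set alone and not on its decomposition into arcs, and it is measurable in u through the
  integral.\<close>

lemma S_kernel_eq_integral:
  assumes "arcs A L \<phi> \<psi>"
  shows "S_kernel L \<phi> \<psi> x y = (\<integral>t. indicator A (cis t) * cis (of_int (y - x) * t) \<partial>circ)"
proof -
  let ?arc = "\<lambda>k. cis ` {\<phi> k..\<psi> k}"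
  have le: "\<phi> k \<le> \<psi> k" "\<psi> k \<le> \<phi> k + 2 * pi" if "k \<in> {1..L}" for k
    using assms that by (auto simp: arcs_def)
  have A: "A = (\<Union>k\<in>{1..L}. ?arc k)" and dis: "disjoint_family_on ?arc {1..L}"
    using assms by (auto simp: arcs_def)
  have ind: "indicator A z = (\<Sum>k\<in>{1..L}. indicator (?arc k) z :: complex)" for z
    unfolding A by (rule indicator_UN_disjoint[OF _ dis]) simp
  have "(\<integral>t. indicator A (cis t) * cis (of_int (y - x) * t) \<partial>circ) =
      (\<integral>t. (\<Sum>k\<in>{1..L}. indicator (?arc k) (cis t) * cis (of_int (y - x) * t)) \<partial>circ)"
    by (simp add: ind sum_distrib_right)
  also have "\<dots> = (\<Sum>k\<in>{1..L}. \<integral>t. indicator (?arc k) (cis t) * cis (of_int (y - x) * t) \<partial>circ)"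
    by (rule Bochner_Integration.integral_sum, rule integrable_circ_bounded[where B = 1])
       (auto simp: norm_mult indicator_def)
  also have "\<dots> = S_kernel L \<phi> \<psi> x y"
  proof (cases "x = y")
    case True
    have "(\<integral>t. indicator (?arc k) (cis t) * cis (of_int (y - x) * t) \<partial>circ) = of_real ((\<psi> k - \<phi> k) / (2 * pi))"
      if k: "k \<in> {1..L}" for k
      using arc_integral[OF le[OF k], of "y - x"] True by simp
    then show ?thesis unfolding S_kernel_def using True by simp
  next
    case False
    define D where "D = complex_of_int (y - x)"
    have D: "D \<noteq> 0" "complex_of_int (x - y) = - D" using False by (simp_all add: D_def)
    have nz: "(y - x = 0) = False" using False by simp
    have e: "cis (of_int (y - x) * s) = exp (\<i> * s * D)" for s :: real
      by (simp add: cis_conv_exp D_def mult_ac)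
    have "(\<integral>t. indicator (?arc k) (cis t) * cis (of_int (y - x) * t) \<partial>circ) =
        (exp (\<i> * \<phi> k * D) - exp (\<i> * \<psi> k * D)) / (2 * \<i> * pi * - D)" if k: "k \<in> {1..L}" for k
    proof -
      have "(\<integral>t. indicator (?arc k) (cis t) * cis (of_int (y - x) * t) \<partial>circ) =
          (exp (\<i> * \<psi> k * D) - exp (\<i> * \<phi> k * D)) / (2 * pi * \<i> * D)"
        using arc_integral[OF le[OF k], of "y - x"] unfolding nz if_False e D_def .
      then show ?thesis using D(1) by (simp add: field_simps)
    qed
    then show ?thesis unfolding S_kernel_def D(2) D_def[symmetric] using False by simp
  qed
  finally show ?thesis ..
qed

section \<open>Covariance bounds\<close>

lemma conf_cylinder_measurable: "finite A \<Longrightarrow> {X. A \<subseteq> X} \<in> sets conf_algebra"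
proof -
  assume A: "finite A"
  have "{X. A \<subseteq> X} = {X. X \<inter> A = A}" by auto
  then have "{X. A \<subseteq> X} \<in> {{X. X \<inter> W = S} | W S. finite W}" using A by blast
  then show ?thesis unfolding conf_algebra_def by (auto intro!: sigma_sets.Basic)
qed

lemma space_conf_algebra [simp]: "space conf_algebra = UNIV"
  by (simp add: conf_algebra_def space_measure_of_conv)

lemma finite_shift: "finite m \<Longrightarrow> finite (shift m x)"
  by (simp add: shift_def)

lemma c_pat_mult: "c_pat A X * c_pat B X = c_pat (A \<union> B) X"
  by (auto simp: c_pat_def)

text \<open>Isolates what the variance estimate takes from the Schur process: determinantal
  correlations and kernel rows of norm at most one, uniformly in \<alpha>.\<close>

locale bessel_process = prob_space P for P :: "int set measure" +
  fixes K :: "int \<Rightarrow> int \<Rightarrow> complex"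
  assumes sets_P: "sets P = sets conf_algebra"
    and corr: "\<And>ms. distinct ms \<Longrightarrow>
      complex_of_real (prob {X. set ms \<subseteq> X}) = fdet (length ms) (\<lambda>i j. K (ms ! i) (ms ! j))"
    and bessel: "\<And>F x. finite F \<Longrightarrow> (\<Sum>y\<in>F. (norm (K x y))\<^sup>2) \<le> 1"
begin

lemma space_P [simp]: "space P = UNIV"
  using sets_eq_imp_space_eq[OF sets_P] by simp

lemma c_pat_measurable [measurable]: "finite A \<Longrightarrow> c_pat A \<in> borel_measurable P"
proof -
  assume "finite A"
  then have "{X. A \<subseteq> X} \<in> sets P" using conf_cylinder_measurable by (simp add: sets_P)
  moreover have "c_pat A = indicator {X. A \<subseteq> X}" by (auto simp: c_pat_def indicator_def)
  ultimately show ?thesis by simp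
qed

lemma c_pat_integrable: "finite A \<Longrightarrow> integrable P (c_pat A)"
  by (rule integrable_const_bound[of _ 1]) (auto simp: c_pat_def)

lemma expectation_c_pat: "finite A \<Longrightarrow> expectation (c_pat A) = prob {X. A \<subseteq> X}"
proof -
  assume "finite A"
  then have "{X. A \<subseteq> X} \<in> sets P" using conf_cylinder_measurable by (simp add: sets_P)
  moreover have "c_pat A = indicator {X. A \<subseteq> X}" by (auto simp: c_pat_def indicator_def)
  ultimately show ?thesis by simp
qed

lemma norm_K_le_1: "norm (K x y) \<le> 1"
  using bessel[of "{y}" x] by (simp add: abs_square_le_1)

lemma sum_norm_K: "finite F \<Longrightarrow> (\<Sum>y\<in>F. norm (K x y)) \<le> sqrt (card F)"
proof -
  assume F: "finite F"
  have "(\<Sum>y\<in>F. norm (K x y) * 1)\<^sup>2 \<le> (\<Sum>y\<in>F. (norm (K x y))\<^sup>2) * (\<Sum>y\<in>F. 1\<^sup>2)"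
    by (rule Cauchy_Schwarz_ineq_sum)
  also have "\<dots> \<le> 1 * real (card F)" using bessel[OF F] by (intro mult_mono) auto
  finally show ?thesis by (intro real_le_rsqrt) simp
qed

text \<open>Zeroing the upper right block of the kernel matrix of a union of two disjoint patterns
  factorizes its determinant; this bounds the covariance by the entries of that block.\<close>

lemma covariance_bound:
  assumes "distinct ms" "distinct ms'"
  shows "\<bar>prob {X. set ms \<union> set ms' \<subseteq> X} - prob {X. set ms \<subseteq> X} * prob {X. set ms' \<subseteq> X}\<bar> \<le>
    (\<Sum>x\<in>set ms. \<Sum>y\<in>set ms'. fact (length ms + length ms') * norm (K x y) + (if x = y then 1 else 0))"
\<comment> \<open>For overlapping patterns the concatenated list has repetitions, so its determinant
  is not the joint probability. The trivial bound 1 is used instead and paid for by a term with x =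
  y.\<close>
proof (cases "set ms \<inter> set ms' = {}")
  case False
  then obtain z where z: "z \<in> set ms" "z \<in> set ms'" by auto
  have "\<bar>prob {X. set ms \<union> set ms' \<subseteq> X} - prob {X. set ms \<subseteq> X} * prob {X. set ms' \<subseteq> X}\<bar> \<le> 1"
  proof -
    have p: "0 \<le> prob A" "prob A \<le> 1" for A by auto
    have "prob {X. set ms \<subseteq> X} * prob {X. set ms' \<subseteq> X} \<le> 1 * 1" by (intro mult_mono) (use p in auto)
    moreover have "0 \<le> prob {X. set ms \<subseteq> X} * prob {X. set ms' \<subseteq> X}" by simp
    ultimately show ?thesis using p[of "{X. set ms \<union> set ms' \<subseteq> X}"] by linarith
  qed
  also have "1 \<le> (\<Sum>y\<in>set ms'. fact (length ms + length ms') * norm (K z y) + (if z = y then 1 else 0))"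
  proof -
    have "1 \<le> fact (length ms + length ms') * norm (K z z) + (if z = z then 1 else (0::real))" by simp
    also have "\<dots> \<le> (\<Sum>y\<in>set ms'. fact (length ms + length ms') * norm (K z y) + (if z = y then 1 else 0))"
      by (rule member_le_sum[of z "set ms'" "\<lambda>y. fact (length ms + length ms') * norm (K z y) + (if z = y then 1 else 0)"])
         (use z in auto)
    finally show ?thesis .
  qed
  also have "\<dots> \<le> (\<Sum>x\<in>set ms. \<Sum>y\<in>set ms'. fact (length ms + length ms') * norm (K x y) + (if x = y then 1 else 0))"
    by (rule member_le_sum[of z "set ms" "\<lambda>x. \<Sum>y\<in>set ms'. fact (length ms + length ms') * norm (K x y) + (if x = y then 1 else 0)"])
       (use z in \<open>auto intro!: sum_nonneg\<close>)
  finally show ?thesis .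
next
  case True
  let ?n = "length ms" and ?n' = "length ms'"
  define F where "F i j = K ((ms @ ms') ! i) ((ms @ ms') ! j)" for i j
  define G where "G i j = (if i < ?n \<and> ?n \<le> j then 0 else F i j)" for i j
  have u: "complex_of_real (prob {X. set ms \<union> set ms' \<subseteq> X}) = fdet (?n + ?n') F"
    using corr[of "ms @ ms'"] assms True by (simp add: F_def[abs_def])
  have "fdet (?n + ?n') G = fdet ?n G * fdet ?n' (\<lambda>i j. G (?n + i) (?n + j))"
    by (rule fdet_block_diagonal) (simp add: G_def)
  also have "fdet ?n G = complex_of_real (prob {X. set ms \<subseteq> X})"
    unfolding corr[OF assms(1)] by (rule fdet_cong) (simp add: G_def F_def nth_append)
  also have "fdet ?n' (\<lambda>i j. G (?n + i) (?n + j)) = complex_of_real (prob {X. set ms' \<subseteq> X})"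
    unfolding corr[OF assms(2)] by (rule fdet_cong) (simp add: G_def F_def nth_append)
  finally have v: "fdet (?n + ?n') G = of_real (prob {X. set ms \<subseteq> X} * prob {X. set ms' \<subseteq> X})" by simp
  have "\<bar>prob {X. set ms \<union> set ms' \<subseteq> X} - prob {X. set ms \<subseteq> X} * prob {X. set ms' \<subseteq> X}\<bar> =
      norm (fdet (?n + ?n') F - fdet (?n + ?n') G)"
    unfolding u[symmetric] v by (simp only: of_real_diff[symmetric] norm_of_real)
  also have "\<dots> \<le> fact (?n + ?n') * (\<Sum>i=0..<?n + ?n'. \<Sum>j=0..<?n + ?n'. norm (F i j - G i j))"
    by (rule norm_fdet_diff_le) (auto simp: F_def G_def norm_K_le_1)
  also have "(\<Sum>i=0..<?n + ?n'. \<Sum>j=0..<?n + ?n'. norm (F i j - G i j)) =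
      (\<Sum>i=0..<?n. \<Sum>j=?n..<?n + ?n'. norm (F i j))"
  proof (rule sum.mono_neutral_cong_right)
    show "\<forall>i\<in>{0..<?n + ?n'} - {0..<?n}. (\<Sum>j=0..<?n + ?n'. norm (F i j - G i j)) = 0"
      by (auto simp: G_def)
    fix i assume i: "i \<in> {0..<?n}"
    show "(\<Sum>j=0..<?n + ?n'. norm (F i j - G i j)) = (\<Sum>j=?n..<?n + ?n'. norm (F i j))"
      by (rule sum.mono_neutral_cong_right) (use i in \<open>auto simp: G_def\<close>)
  qed auto
  also have "\<dots> = (\<Sum>i=0..<?n. \<Sum>j=0..<?n'. norm (K (ms ! i) (ms' ! j)))"
  proof (rule sum.cong[OF refl])
    fix i assume i: "i \<in> {0..<?n}"
    show "(\<Sum>j=?n..<?n + ?n'. norm (F i j)) = (\<Sum>j=0..<?n'. norm (K (ms ! i) (ms' ! j)))"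
      by (rule sum.reindex_bij_witness[of _ "\<lambda>j. j + ?n" "\<lambda>j. j - ?n"])
         (use i in \<open>auto simp: F_def nth_append\<close>)
  qed
  also have "\<dots> = (\<Sum>x\<in>set ms. \<Sum>y\<in>set ms'. norm (K x y))"
  proof -
    have b: "bij_betw ((!) ms) {0..<?n} (set ms)" "bij_betw ((!) ms') {0..<?n'} (set ms')"
      using assms by (auto intro!: bij_betw_nth simp: lessThan_atLeast0)
    show ?thesis
      unfolding sum.reindex_bij_betw[OF b(1), symmetric] sum.reindex_bij_betw[OF b(2), symmetric] ..
  qed
  also have "fact (?n + ?n') * (\<Sum>x\<in>set ms. \<Sum>y\<in>set ms'. norm (K x y)) \<le>
      (\<Sum>x\<in>set ms. \<Sum>y\<in>set ms'. fact (?n + ?n') * norm (K x y) + (if x = y then 1 else 0))"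
    unfolding sum_distrib_left by (intro sum_mono) simp
  finally show ?thesis .
qed

lemma variance_linear_statistic:
  assumes m: "finite m" and S: "finite S" and f: "\<And>x. x \<in> S \<Longrightarrow> \<bar>f x\<bar> \<le> B"
  shows "variance (\<lambda>X. \<Sum>x\<in>S. f x * c_pat (shift m x) X) \<le>
    B\<^sup>2 * (card S * ((card m)\<^sup>2 * (fact (2 * card m) * sqrt (card S) + 1)))"
proof (cases "S = {}")
  case True
  then show ?thesis by simp
next
  case False
  then have B: "B \<ge> 0" using f by (meson abs_ge_zero all_not_in_conv order_trans)
  define pp where "pp A = prob {X. A \<subseteq> X}" for A
  have ecp: "expectation (c_pat A) = pp A" if "finite A" for A
    unfolding pp_def by (rule expectation_c_pat[OF that])
  define Y where "Y X = (\<Sum>x\<in>S. f x * c_pat (shift m x) X)" for X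
  define cov where "cov x y = pp (shift m x \<union> shift m y) - pp (shift m x) * pp (shift m y)" for x y
  have fs: "finite (shift m x)" for x using m by (rule finite_shift)
  have EY: "expectation Y = (\<Sum>x\<in>S. f x * pp (shift m x))"
    unfolding Y_def by (subst Bochner_Integration.integral_sum) (auto simp: c_pat_integrable fs ecp)
  have Y2: "(Y X)\<^sup>2 = (\<Sum>x\<in>S. \<Sum>y\<in>S. (f x * f y) * c_pat (shift m x \<union> shift m y) X)" for X
    unfolding Y_def power2_eq_square sum_product c_pat_mult[symmetric] by (simp add: mult_ac)
  have iY2: "integrable P (\<lambda>X. (Y X)\<^sup>2)"
    unfolding Y2 by (auto simp: c_pat_integrable fs)
  have iY: "integrable P Y"
    unfolding Y_def by (auto simp: c_pat_integrable fs)
  have EY2: "expectation (\<lambda>X. (Y X)\<^sup>2) = (\<Sum>x\<in>S. \<Sum>y\<in>S. (f x * f y) * pp (shift m x \<union> shift m y))"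
    unfolding Y2
    by (subst Bochner_Integration.integral_sum, simp add: c_pat_integrable fs,
        intro sum.cong refl, subst Bochner_Integration.integral_sum)
       (auto simp: c_pat_integrable fs ecp)
  have "variance Y = expectation (\<lambda>X. (Y X)\<^sup>2) - (expectation Y)\<^sup>2"
    by (rule variance_eq[OF iY iY2])
  also have "\<dots> = (\<Sum>x\<in>S. \<Sum>y\<in>S. (f x * f y) * cov x y)"
    unfolding EY2 EY unfolding power2_eq_square sum_product sum_subtractf[symmetric]
    by (intro sum.cong refl) (simp add: cov_def algebra_simps)
  also have "\<dots> \<le> (\<Sum>x\<in>S. \<Sum>y\<in>S. B\<^sup>2 * \<bar>cov x y\<bar>)"
  proof (intro sum_mono)
    fix x y assume xy: "x \<in> S" "y \<in> S"
    have "(f x * f y) * cov x y \<le> \<bar>f x\<bar> * \<bar>f y\<bar> * \<bar>cov x y\<bar>"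
      by (metis abs_ge_self abs_mult)
    also have "\<dots> \<le> B * B * \<bar>cov x y\<bar>"
      using f[OF xy(1)] f[OF xy(2)] B by (intro mult_right_mono mult_mono) auto
    finally show "(f x * f y) * cov x y \<le> B\<^sup>2 * \<bar>cov x y\<bar>" by (simp add: power2_eq_square)
  qed
  also have "\<dots> = B\<^sup>2 * (\<Sum>x\<in>S. \<Sum>y\<in>S. \<bar>cov x y\<bar>)"
    by (simp add: sum_distrib_left)
  also have "(\<Sum>x\<in>S. \<Sum>y\<in>S. \<bar>cov x y\<bar>) \<le> (\<Sum>x\<in>S. (card m)\<^sup>2 * (fact (2 * card m) * sqrt (card S) + 1))"
  proof (rule sum_mono)
    fix x assume "x \<in> S"
    obtain ms where ms: "set ms = m" "distinct ms" using finite_distinct_list[OF m] by blast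
    have len: "length ms = card m" using distinct_card[OF ms(2)] ms(1) by simp
    let ?ms = "\<lambda>x. map (\<lambda>a. a + x) ms"
    have d: "distinct (?ms x)" "set (?ms x) = shift m x" for x
      using ms by (auto simp: distinct_map inj_on_def shift_def)
    have "\<bar>cov x y\<bar> \<le> (\<Sum>a\<in>m. \<Sum>b\<in>m. fact (2 * card m) * norm (K (a + x) (b + y)) + (if a + x = b + y then 1 else 0))" for y
    proof -
      have "\<bar>cov x y\<bar> \<le> (\<Sum>a\<in>shift m x. \<Sum>b\<in>shift m y. fact (2 * card m) * norm (K a b) + (if a = b then 1 else 0))"
        using covariance_bound[OF d(1) d(1), of x y] unfolding d(2) cov_def pp_def length_map len mult_2 .
      also have "\<dots> = (\<Sum>a\<in>m. \<Sum>b\<in>m. fact (2 * card m) * norm (K (a + x) (b + y)) + (if a + x = b + y then 1 else 0))"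
        unfolding shift_def by (subst sum.reindex, simp add: inj_on_def, subst sum.reindex) (simp_all add: inj_on_def)
      finally show ?thesis .
    qed
    then have "(\<Sum>y\<in>S. \<bar>cov x y\<bar>) \<le>
        (\<Sum>y\<in>S. \<Sum>a\<in>m. \<Sum>b\<in>m. fact (2 * card m) * norm (K (a + x) (b + y)) + (if a + x = b + y then 1 else 0))"
      by (rule sum_mono)
    also have "\<dots> = (\<Sum>a\<in>m. \<Sum>b\<in>m. \<Sum>y\<in>S. fact (2 * card m) * norm (K (a + x) (b + y)) + (if a + x = b + y then 1 else 0))"
      by (subst sum.swap, rule sum.cong[OF refl], rule sum.swap)
    \<comment> \<open>For fixed a and b the sum over y runs along a piece of one row of K, where
      Cauchy-Schwarz gives the square root of the length; the coincidence a + x = b + y happens for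
      at most one y.\<close>
    also have "\<dots> \<le> (\<Sum>a\<in>m. \<Sum>b\<in>m. fact (2 * card m) * sqrt (card S) + 1)"
    proof (intro sum_mono)
      fix a b
      have "(\<Sum>y\<in>S. norm (K (a + x) (b + y))) = (\<Sum>z\<in>(\<lambda>y. b + y) ` S. norm (K (a + x) z))"
        by (subst sum.reindex) (auto simp: inj_on_def)
      also have "\<dots> \<le> sqrt (card ((\<lambda>y. b + y) ` S))" using S by (intro sum_norm_K) simp
      also have "card ((\<lambda>y. b + y) ` S) = card S" by (intro card_image) (auto simp: inj_on_def)
      finally have 1: "(\<Sum>y\<in>S. norm (K (a + x) (b + y))) \<le> sqrt (card S)" .
      have "(\<Sum>y\<in>S. if a + x = b + y then 1 else (0::real)) = (\<Sum>y\<in>S. if y = a + x - b then 1 else 0)"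
        by (intro sum.cong) auto
      also have "\<dots> \<le> 1" using S by simp
      finally have 2: "(\<Sum>y\<in>S. if a + x = b + y then 1 else (0::real)) \<le> 1" .
      show "(\<Sum>y\<in>S. fact (2 * card m) * norm (K (a + x) (b + y)) + (if a + x = b + y then 1 else 0)) \<le>
          fact (2 * card m) * sqrt (card S) + 1"
        unfolding sum.distrib sum_distrib_left[symmetric] by (intro add_mono mult_left_mono 1 2) simp
    qed
    also have "\<dots> = (card m)\<^sup>2 * (fact (2 * card m) * sqrt (card S) + 1)"
      by (simp add: power2_eq_square)
    finally show "(\<Sum>y\<in>S. \<bar>cov x y\<bar>) \<le> (card m)\<^sup>2 * (fact (2 * card m) * sqrt (card S) + 1)" .
  qed
  finally show ?thesis using B unfolding Y_def by (simp add: mult_left_mono)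
qed

end

section \<open>The Schur process of an analytic specialization\<close>

definition psum_fps :: "(series \<Rightarrow> complex) \<Rightarrow> real \<Rightarrow> complex fps" where
  "psum_fps \<rho> \<alpha> = Abs_fps (\<lambda>k. if k = 0 then 0 else of_real \<alpha> * \<rho> (power_sum k) / of_nat k)"

definition psum_series :: "(series \<Rightarrow> complex) \<Rightarrow> complex \<Rightarrow> complex" where
  "psum_series \<rho> z = suminf (\<lambda>k. \<rho> (power_sum (Suc k)) / of_nat (Suc k) * z ^ Suc k)"

text \<open>The neighbourhood of the circle contains a real point beyond 1 at which the series
  converges, so the radius of convergence exceeds 1. One R serves all \<alpha>, since scaling
  preserves convergence.\<close>

lemma psum_conv_radius:
  assumes "analytic_near_circle \<rho>"
  obtains R where "1 < R" "\<And>\<alpha>. ereal R \<le> fps_conv_radius (psum_fps \<rho> \<alpha>)"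
proof -
  obtain U where U: "open U" "sphere 0 1 \<subseteq> U"
    "\<forall>z\<in>U. summable (\<lambda>k. \<rho> (power_sum (Suc k)) / of_nat (Suc k) * z ^ Suc k)"
    using assms unfolding analytic_near_circle_def by (elim exE conjE) (rule that)
  have "1 \<in> U" using U(2) by auto
  then obtain e where e: "e > 0" "ball 1 e \<subseteq> U"
    using openE[OF U(1)] by metis
  define R where "R = 1 + e / 2"
  have "complex_of_real R \<in> ball 1 e" using e(1) by (simp add: R_def dist_norm)
  then have s: "summable (\<lambda>k. \<rho> (power_sum (Suc k)) / of_nat (Suc k) * of_real R ^ Suc k)"
    using subsetD[OF e(2)] by (intro bspec[OF U(3)])
  have "ereal R \<le> fps_conv_radius (psum_fps \<rho> \<alpha>)" for \<alpha>
  proof -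
    have "summable (\<lambda>k. fps_nth (psum_fps \<rho> \<alpha>) (Suc k) * of_real R ^ Suc k)"
      using summable_mult[OF s, of "of_real \<alpha>"] by (simp add: psum_fps_def mult_ac)
    then have "summable (\<lambda>k. fps_nth (psum_fps \<rho> \<alpha>) k * of_real R ^ k)"
      by (subst (asm) summable_Suc_iff)
    then have "ereal (norm (complex_of_real R)) \<le> fps_conv_radius (psum_fps \<rho> \<alpha>)"
      unfolding fps_conv_radius_def by (rule conv_radius_geI)
    moreover have "norm (complex_of_real R) = R" unfolding norm_of_real using e(1) by (simp add: R_def)
    ultimately show ?thesis by simp
  qed
  then show ?thesis using that[of R] e(1) by (simp add: R_def)
qed

lemma eval_psum_fps:
  assumes "ereal (norm z) < fps_conv_radius (psum_fps \<rho> 1)" "ereal (norm z) < fps_conv_radius (psum_fps \<rho> \<alpha>)"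
  shows "eval_fps (psum_fps \<rho> \<alpha>) z = of_real \<alpha> * psum_series \<rho> z"
    and "(\<lambda>k. \<rho> (power_sum (Suc k)) / of_nat (Suc k) * z ^ Suc k) sums psum_series \<rho> z"
proof -
  have "summable (\<lambda>n. fps_nth (psum_fps \<rho> 1) n * z ^ n)" by (rule summable_fps[OF assms(1)])
  then have "summable (\<lambda>n. fps_nth (psum_fps \<rho> 1) (Suc n) * z ^ Suc n)" by (subst summable_Suc_iff)
  then have s: "summable (\<lambda>k. \<rho> (power_sum (Suc k)) / of_nat (Suc k) * z ^ Suc k)"
    by (simp add: psum_fps_def)
  then show "(\<lambda>k. \<rho> (power_sum (Suc k)) / of_nat (Suc k) * z ^ Suc k) sums psum_series \<rho> z"
    unfolding psum_series_def by (rule summable_sums)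
  have "summable (\<lambda>n. fps_nth (psum_fps \<rho> \<alpha>) n * z ^ n)" by (rule summable_fps[OF assms(2)])
  from suminf_split_head[OF this]
  have "eval_fps (psum_fps \<rho> \<alpha>) z = suminf (\<lambda>n. fps_nth (psum_fps \<rho> \<alpha>) (Suc n) * z ^ Suc n)"
    by (simp add: eval_fps_def psum_fps_def)
  also have "\<dots> = suminf (\<lambda>k. of_real \<alpha> * (\<rho> (power_sum (Suc k)) / of_nat (Suc k) * z ^ Suc k))"
    by (simp add: psum_fps_def mult_ac)
  also have "\<dots> = of_real \<alpha> * psum_series \<rho> z"
    unfolding psum_series_def by (rule suminf_mult[OF s])
  finally show "eval_fps (psum_fps \<rho> \<alpha>) z = of_real \<alpha> * psum_series \<rho> z" .
qed

text \<open>On the circle G is a series minus its conjugate, hence twice i times its imaginary part.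
  By the chain rule the derivative of G(e^(it)) is i z G'(z), whose imaginary part is the real part
  of z G'(z).\<close>

lemma zG'_derivative:
  assumes "analytic_near_circle \<rho>"
  shows "((\<lambda>t. 2 * Im (psum_series \<rho> (cis t))) has_real_derivative zG' \<rho> (cis t)) (at t)"
    and "continuous_on UNIV (\<lambda>t. zG' \<rho> (cis t))"
proof -
  obtain R where R: "1 < R" "\<And>\<alpha>. ereal R \<le> fps_conv_radius (psum_fps \<rho> \<alpha>)"
    using psum_conv_radius[OF assms] by blast
  let ?P = "psum_fps \<rho> 1"
  define Pb where "Pb = Abs_fps (\<lambda>k. cnj (fps_nth ?P k))"
  have Pb: "ereal R \<le> fps_conv_radius Pb"
  proof -
    have "fps_conv_radius Pb = conv_radius (\<lambda>k. norm (fps_nth Pb k))"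
      unfolding fps_conv_radius_def by simp
    also have "\<dots> = conv_radius (\<lambda>k. norm (fps_nth ?P k))" by (simp add: Pb_def)
    also have "\<dots> = fps_conv_radius ?P" unfolding fps_conv_radius_def by simp
    finally show ?thesis using R(2)[of 1] by simp
  qed
  \<comment> \<open>An annulus around the circle in which the series in z and the one in 1/z both
    converge.\<close>
  define V where "V = {z::complex. 1 / R < norm z \<and> norm z < R}"
  have V: "open V" unfolding V_def by (intro open_Collect_conj open_Collect_less continuous_intros)
  have V0: "z \<noteq> 0" "norm (inverse z) < R" if "z \<in> V" for z
  proof -
    have z: "1 / R < norm z" "0 < 1 / R" using that R(1) by (auto simp: V_def)
    then show "z \<noteq> 0" by auto
    have "inverse (norm z) < inverse (1 / R)" by (rule less_imp_inverse_less[OF z])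
    then show "norm (inverse z) < R" by (simp add: norm_inverse)
  qed
  have lt: "ereal (norm z) < fps_conv_radius (psum_fps \<rho> \<alpha>)" if "norm z < R" for z \<alpha>
    by (rule less_le_trans[OF _ R(2)]) (use that in simp)
  have ltb: "ereal (norm z) < fps_conv_radius Pb" if "norm z < R" for z
    by (rule less_le_trans[OF _ Pb]) (use that in simp)
  have G: "G_fun \<rho> z = eval_fps ?P z - eval_fps Pb (inverse z)" if z: "z \<in> V" for z
  proof -
    have 1: "eval_fps ?P z = psum_series \<rho> z"
      using eval_psum_fps(1)[of z \<rho> 1] lt[of z] z by (simp add: V_def)
    from suminf_split_head[OF summable_fps[OF ltb[OF V0(2)[OF z]]]]
    have "eval_fps Pb (inverse z) = suminf (\<lambda>n. fps_nth Pb (Suc n) * inverse z ^ Suc n)"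
      by (simp add: eval_fps_def Pb_def psum_fps_def)
    then have 2: "eval_fps Pb (inverse z) = suminf (\<lambda>k. cnj (\<rho> (power_sum (Suc k))) / of_nat (Suc k) * inverse z ^ Suc k)"
      by (simp add: Pb_def psum_fps_def)
    show ?thesis unfolding 1 2 G_fun_def psum_series_def ..
  qed
  have hol: "G_fun \<rho> holomorphic_on V"
  proof (rule holomorphic_transform)
    have "eval_fps Pb holomorphic_on inverse ` V"
      by (rule holomorphic_on_eval_fps) (use V0 ltb in \<open>auto simp: eball_def\<close>)
    moreover have "inverse holomorphic_on V" by (intro holomorphic_intros) (use V0 in auto)
    ultimately have "(\<lambda>z. eval_fps Pb (inverse z)) holomorphic_on V"
      using holomorphic_on_compose[of inverse V "eval_fps Pb"] by (simp add: o_def)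
    moreover have "eval_fps ?P holomorphic_on V"
      by (rule holomorphic_on_eval_fps) (use lt in \<open>auto simp: eball_def V_def\<close>)
    ultimately show "(\<lambda>z. eval_fps ?P z - eval_fps Pb (inverse z)) holomorphic_on V"
      by (intro holomorphic_on_diff)
  qed (simp add: G)
  have cisV: "cis t \<in> V" for t using R(1) by (simp add: V_def)
  have Im_G: "Im (G_fun \<rho> (cis t)) = 2 * Im (psum_series \<rho> (cis t))" for t
  proof -
    have "(\<lambda>k. \<rho> (power_sum (Suc k)) / of_nat (Suc k) * cis t ^ Suc k) sums psum_series \<rho> (cis t)"
    proof -
      have n: "norm (cis t) < R" using R(1) by simp
      show ?thesis by (rule eval_psum_fps(2)[OF lt[OF n] lt[OF n, of 1]])
    qed
    then have "(\<lambda>k. cnj (\<rho> (power_sum (Suc k)) / of_nat (Suc k) * cis t ^ Suc k)) sums cnj (psum_series \<rho> (cis t))"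
      by (simp only: sums_cnj)
    moreover have "cnj (\<rho> (power_sum (Suc k)) / of_nat (Suc k) * cis t ^ Suc k) =
        cnj (\<rho> (power_sum (Suc k))) / of_nat (Suc k) * inverse (cis t) ^ Suc k" for k
      by (simp add: cis_cnj cis_inverse del: of_nat_Suc power_Suc)
    ultimately have "G_fun \<rho> (cis t) = psum_series \<rho> (cis t) - cnj (psum_series \<rho> (cis t))"
      unfolding G_fun_def psum_series_def[symmetric] by (simp only: sums_iff)
    then show ?thesis by simp
  qed
  show "((\<lambda>t. 2 * Im (psum_series \<rho> (cis t))) has_real_derivative zG' \<rho> (cis t)) (at t)"
  proof -
    have c: "(cis has_vector_derivative \<i> * cis t) (at t)"
      unfolding cis_conv_exp
      by (auto intro!: derivative_eq_intros has_vector_derivative_real_field)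
    have d: "(G_fun \<rho> has_field_derivative deriv (G_fun \<rho>) (cis t)) (at (cis t))"
      by (rule holomorphic_derivI[OF hol V cisV])
    have "((G_fun \<rho> \<circ> cis) has_vector_derivative (\<i> * cis t) * deriv (G_fun \<rho>) (cis t)) (at t)"
      by (rule field_vector_diff_chain_at[OF c d])
    from bounded_linear.has_vector_derivative[OF bounded_linear_Im this]
    have "((\<lambda>t. Im (G_fun \<rho> (cis t))) has_vector_derivative zG' \<rho> (cis t)) (at t)"
      by (simp add: o_def zG'_def mult.assoc)
    then show ?thesis
      unfolding Im_G has_real_derivative_iff_has_vector_derivative .
  qed
  have "continuous_on V (deriv (G_fun \<rho>))"
    by (rule holomorphic_on_imp_continuous_on[OF holomorphic_deriv[OF hol V]])
  then have "continuous_on UNIV (\<lambda>t. deriv (G_fun \<rho>) (cis t))"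
    by (rule continuous_on_compose2[of V _ _ cis]) (use cisV in \<open>auto simp: cis_conv_exp intro!: continuous_intros\<close>)
  moreover have "continuous_on UNIV cis"
    unfolding cis_conv_exp[abs_def] by (intro continuous_intros)
  ultimately show "continuous_on UNIV (\<lambda>t. zG' \<rho> (cis t))"
    unfolding zG'_def by (intro continuous_intros)
qed

text \<open>The parameter \<alpha> enters the kernel only through J, and J only through the phase of
  its Fourier series. In this form the kernels along a sequence of \<alpha> can be compared.\<close>

lemma schur_process_kernel:
  assumes \<sigma>: "specialization \<sigma>" and an: "analytic_near_circle \<rho>"
    and p: "\<And>k. k \<ge> 1 \<Longrightarrow> \<sigma> (power_sum k) = of_real \<alpha> * \<rho> (power_sum k)"
  obtains J K where "J abssummable UNIV"
    "\<And>t. FT J t = cis (\<alpha> * (2 * Im (psum_series \<rho> (cis t))))"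
    "\<And>a b X. K (a + X) (b + X) = infsetsum (\<lambda>k. J (k + b) * cnj (J (k + a))) {X<..}"
    "bessel_process (schur_process \<sigma>) K"
proof -
  obtain R where R: "1 < R" "\<And>\<alpha>. ereal R \<le> fps_conv_radius (psum_fps \<rho> \<alpha>)"
    using psum_conv_radius[OF an] by blast
  have nth: "fps_nth (psum_fps \<rho> \<alpha>) k = (if k = 0 then 0 else \<sigma> (power_sum k) / of_nat k)" for k
    using p[of k] by (simp add: psum_fps_def)
  show ?thesis
  proof (rule schur_kernel_exists[OF \<sigma> R(1) R(2)[of \<alpha>] nth])
  fix c C s assume sk: "schur_kernel \<sigma> c C s"
    and F: "\<And>t. FT (inverse_pair.J (spec_h \<sigma>) c) t = cis (2 * Im (eval_fps (psum_fps \<rho> \<alpha>) (cis t)))"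
  interpret schur_kernel \<sigma> c C s by (rule sk)
  have ev: "eval_fps (psum_fps \<rho> \<alpha>) (cis t) = of_real \<alpha> * psum_series \<rho> (cis t)" for t
    by (rule eval_psum_fps(1)) (use R(1) in \<open>auto intro!: less_le_trans[OF _ R(2)]\<close>)
  interpret S: prob_space "schur_measure \<sigma>" by (rule prob_space_schur_measure)
  have m: "partition_conf \<in> measurable (schur_measure \<sigma>) conf_algebra"
    by (simp add: schur_measure_def)
  have sp: "space (schur_measure \<sigma>) = partitions"
    by (simp add: schur_measure_def space_point_measure)
  have bp: "bessel_process (schur_process \<sigma>) ker"
    unfolding bessel_process_def bessel_process_axioms_def
  proof (intro conjI allI impI)
    show "prob_space (schur_process \<sigma>)"
      unfolding schur_process_def by (rule S.prob_space_distr[OF m])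
    show "sets (schur_process \<sigma>) = sets conf_algebra" by (simp add: schur_process_def)
    show "(\<Sum>y\<in>F. (norm (ker x y))\<^sup>2) \<le> 1" if "finite F" for F x by (rule ker_bessel[OF that])
    fix ms :: "int list" assume ms: "distinct ms"
    have "measure (schur_process \<sigma>) {X. set ms \<subseteq> X} =
        measure (schur_measure \<sigma>) (partition_conf -` {X. set ms \<subseteq> X} \<inter> space (schur_measure \<sigma>))"
      unfolding schur_process_def by (rule measure_distr[OF m]) (simp add: conf_cylinder_measurable)
    also have "partition_conf -` {X. set ms \<subseteq> X} \<inter> space (schur_measure \<sigma>) = {l \<in> partitions. set ms \<subseteq> partition_conf l}"
      by (auto simp: sp)
    finally show "complex_of_real (measure (schur_process \<sigma>) {X. set ms \<subseteq> X}) =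
        fdet (length ms) (\<lambda>i j. ker (ms ! i) (ms ! j))"
      using schur_correlation[OF ms] by simp
  qed
  show ?thesis
  proof (rule that[OF J_summable _ ker_shift bp])
    show "FT J t = cis (\<alpha> * (2 * Im (psum_series \<rho> (cis t))))" for t
      unfolding F ev by (simp add: mult_ac)
  qed
  qed
qed

section \<open>Linear statistics\<close>

lemma AE_lborel_countable: "countable (A :: real set) \<Longrightarrow> AE u in lborel. u \<notin> A"
  by (intro AE_not_in countable_imp_null_set_lborel)

text \<open>The normalized sum is written as an integral over \<open>u\<close> of a step function, in which \<open>x\<close> is
  replaced by the integer part of \<open>\<alpha> u\<close>.\<close>

definition step_density :: "real \<Rightarrow> real \<Rightarrow> real \<Rightarrow> (real \<Rightarrow> real) \<Rightarrow> (int \<Rightarrow> real) \<Rightarrow> real \<Rightarrow> real" where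
  "step_density a b \<alpha> f p u =
    (if \<alpha> * a \<le> of_int \<lfloor>\<alpha> * u\<rfloor> \<and> of_int \<lfloor>\<alpha> * u\<rfloor> \<le> \<alpha> * b
     then f (of_int \<lfloor>\<alpha> * u\<rfloor> / \<alpha>) * p \<lfloor>\<alpha> * u\<rfloor> else 0)"

lemma finite_int_window: "finite {x::int. c \<le> real_of_int x \<and> real_of_int x \<le> d}"
  by (rule finite_subset[of _ "{\<lceil>c\<rceil>..\<lfloor>d\<rfloor>}"]) (auto simp: ceiling_le_iff le_floor_iff)

lemma card_int_window: "real (card {x::int. c \<le> real_of_int x \<and> real_of_int x \<le> d}) \<le> \<bar>d - c\<bar> + 1"
proof -
  have "card {x::int. c \<le> real_of_int x \<and> real_of_int x \<le> d} \<le> card {\<lceil>c\<rceil>..\<lfloor>d\<rfloor>}"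
    by (rule card_mono) (auto simp: ceiling_le_iff le_floor_iff)
  also have "\<dots> = nat (\<lfloor>d\<rfloor> - \<lceil>c\<rceil> + 1)" by simp
  finally have "real (card {x::int. c \<le> real_of_int x \<and> real_of_int x \<le> d}) \<le> real (nat (\<lfloor>d\<rfloor> - \<lceil>c\<rceil> + 1))"
    by simp
  also have "\<dots> \<le> \<bar>d - c\<bar> + 1" by linarith
  finally show ?thesis .
qed

lemma step_density_measurable [measurable]: "step_density a b \<alpha> f p \<in> borel_measurable borel"
proof -
  have "(\<lambda>u::real. \<lfloor>\<alpha> * u\<rfloor>) \<in> measurable borel (count_space UNIV)" by measurable
  then have "(\<lambda>x. if \<alpha> * a \<le> real_of_int x \<and> real_of_int x \<le> \<alpha> * b then f (of_int x / \<alpha>) * p x else 0) \<circ> (\<lambda>u. \<lfloor>\<alpha> * u\<rfloor>)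
      \<in> borel_measurable borel"
    by (rule measurable_comp) simp
  then show ?thesis by (simp add: step_density_def[abs_def] o_def)
qed

lemma integral_step_density:
  assumes \<alpha>: "\<alpha> > 0"
  shows "(\<integral>u. step_density a b \<alpha> f p u \<partial>lborel) =
    1 / \<alpha> * (\<Sum>x\<in>{x::int. \<alpha> * a \<le> real_of_int x \<and> real_of_int x \<le> \<alpha> * b}. f (of_int x / \<alpha>) * p x)"
proof -
  let ?S = "{x::int. \<alpha> * a \<le> real_of_int x \<and> real_of_int x \<le> \<alpha> * b}"
  let ?I = "\<lambda>x. {real_of_int x / \<alpha>..<(real_of_int x + 1) / \<alpha>}"
  have fl: "u \<in> ?I x \<longleftrightarrow> \<lfloor>\<alpha> * u\<rfloor> = x" for u x
    using \<alpha> by (auto simp: floor_eq_iff field_simps)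
  have "step_density a b \<alpha> f p u = (\<Sum>x\<in>?S. (f (of_int x / \<alpha>) * p x) * indicator (?I x) u)" for u
  proof -
    have "(\<Sum>x\<in>?S. (f (of_int x / \<alpha>) * p x) * indicator (?I x) u) =
        (\<Sum>x\<in>?S. if x = \<lfloor>\<alpha> * u\<rfloor> then f (of_int x / \<alpha>) * p x else 0)"
    proof (intro sum.cong refl)
      fix x
      have "indicator (?I x) u = (if x = \<lfloor>\<alpha> * u\<rfloor> then 1 else 0 :: real)"
        unfolding indicator_def fl by auto
      then show "(f (of_int x / \<alpha>) * p x) * indicator (?I x) u = (if x = \<lfloor>\<alpha> * u\<rfloor> then f (of_int x / \<alpha>) * p x else 0)"
        by (simp only: mult_1_right mult_zero_right split: if_split) simp
    qed
    also have "\<dots> = step_density a b \<alpha> f p u"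
      using finite_int_window[of "\<alpha> * a" "\<alpha> * b"] by (simp add: step_density_def)
    finally show ?thesis ..
  qed
  then have "(\<integral>u. step_density a b \<alpha> f p u \<partial>lborel) =
      (\<integral>u. (\<Sum>x\<in>?S. (f (of_int x / \<alpha>) * p x) * indicator (?I x) u) \<partial>lborel)" by simp
  also have "\<dots> = (\<Sum>x\<in>?S. \<integral>u. (f (of_int x / \<alpha>) * p x) * indicator (?I x) u \<partial>lborel)"
    by (rule Bochner_Integration.integral_sum)
       (intro integrable_mult_right integrable_real_indicator; use \<alpha> in \<open>simp add: emeasure_lborel_Ico divide_right_mono\<close>)
  also have "\<dots> = (\<Sum>x\<in>?S. (f (of_int x / \<alpha>) * p x) * (1 / \<alpha>))"
  proof (intro sum.cong refl)
    fix x
    have "measure lborel (?I x) = 1 / \<alpha>"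
      using \<alpha> by (simp add: measure_lborel_Ico divide_right_mono diff_divide_distrib[symmetric])
    then show "(\<integral>u. (f (of_int x / \<alpha>) * p x) * indicator (?I x) u \<partial>lborel) = (f (of_int x / \<alpha>) * p x) * (1 / \<alpha>)"
      by simp
  qed
  finally show ?thesis by (simp add: sum_distrib_left sum_divide_distrib mult.commute)
qed

text \<open>Rounding moves u by at most 1 / \<alpha> <= 1, so the support lies in {a..b + 1} for
  every \<alpha>; this is the dominating function for the limit.\<close>

lemma step_density_bound:
  assumes \<alpha>: "\<alpha> \<ge> 1" and f: "\<And>u. a \<le> u \<Longrightarrow> u \<le> b \<Longrightarrow> \<bar>f u\<bar> \<le> B" and B: "B \<ge> 0" and p: "\<And>x. \<bar>p x\<bar> \<le> 1"
  shows "norm (step_density a b \<alpha> f p u) \<le> B * indicator {a..b + 1} u"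
proof (cases "\<alpha> * a \<le> of_int \<lfloor>\<alpha> * u\<rfloor> \<and> of_int \<lfloor>\<alpha> * u\<rfloor> \<le> \<alpha> * b")
  case True
  let ?x = "real_of_int \<lfloor>\<alpha> * u\<rfloor>"
  have x: "a \<le> ?x / \<alpha>" "?x / \<alpha> \<le> b" using True \<alpha> by (auto simp: field_simps)
  have "?x \<le> \<alpha> * u" "\<alpha> * u \<le> ?x + 1" by linarith+
  then have "?x / \<alpha> \<le> u" "u \<le> ?x / \<alpha> + 1 / \<alpha>" using \<alpha> by (auto simp: field_simps)
  moreover have "1 / \<alpha> \<le> 1" using \<alpha> by simp
  ultimately have "u \<in> {a..b + 1}" using x by auto
  moreover have "\<bar>f (?x / \<alpha>)\<bar> * \<bar>p \<lfloor>\<alpha> * u\<rfloor>\<bar> \<le> B * 1" using f[OF x] p B by (intro mult_mono) auto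
  ultimately show ?thesis using True by (simp add: step_density_def abs_mult)
qed (use B in \<open>auto simp: step_density_def\<close>)

lemma floor_ratio_tendsto:
  fixes \<alpha> :: "nat \<Rightarrow> real"
  assumes \<alpha>: "\<And>n. \<alpha> n \<ge> 1" "filterlim \<alpha> at_top sequentially"
  shows "(\<lambda>n. of_int \<lfloor>\<alpha> n * u\<rfloor> / \<alpha> n) \<longlonglongrightarrow> u"
proof -
  have lim: "(\<lambda>n. 1 / \<alpha> n) \<longlonglongrightarrow> 0"
    by (rule tendsto_divide_0[OF tendsto_const filterlim_at_top_imp_at_infinity[OF \<alpha>(2)]])
  have bnd: "norm (of_int \<lfloor>\<alpha> n * u\<rfloor> / \<alpha> n - u) \<le> 1 / \<alpha> n" for n
  proof -
    have a: "\<alpha> n > 0" using \<alpha>(1)[of n] by simp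
    have "of_int \<lfloor>\<alpha> n * u\<rfloor> / \<alpha> n - u = (of_int \<lfloor>\<alpha> n * u\<rfloor> - \<alpha> n * u) / \<alpha> n" using a by (simp add: field_simps)
    moreover have "\<bar>of_int \<lfloor>\<alpha> n * u\<rfloor> - \<alpha> n * u\<bar> \<le> 1" by linarith
    ultimately show ?thesis using a by (simp add: divide_right_mono)
  qed
  have "(\<lambda>n. of_int \<lfloor>\<alpha> n * u\<rfloor> / \<alpha> n - u) \<longlonglongrightarrow> 0"
    by (rule Lim_null_comparison[OF always_eventually[OF allI[OF bnd]] lim])
  then show ?thesis by (simp add: LIM_zero_iff)
qed

text \<open>At the endpoints the rounded values may fall on either side of the window, so u = a and
  u = b are left out. Elsewhere the window condition is eventually constant.\<close>

lemma step_density_tendsto: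
  fixes \<alpha> :: "nat \<Rightarrow> real" and f :: "real \<Rightarrow> real"
  assumes \<alpha>: "\<And>n. \<alpha> n \<ge> 1" "filterlim \<alpha> at_top sequentially"
    and f: "continuous_on UNIV f" and u: "u \<noteq> a" "u \<noteq> b"
    and p: "a \<le> u \<Longrightarrow> u \<le> b \<Longrightarrow> (\<lambda>n. p n \<lfloor>\<alpha> n * u\<rfloor>) \<longlonglongrightarrow> e"
  shows "(\<lambda>n. step_density a b (\<alpha> n) f (p n) u) \<longlonglongrightarrow> indicator {a..b} u * (f u * e)"
proof -
  let ?r = "\<lambda>n. of_int \<lfloor>\<alpha> n * u\<rfloor> / \<alpha> n"
  have r: "?r \<longlonglongrightarrow> u" by (rule floor_ratio_tendsto[OF \<alpha>])
  have eq: "step_density a b (\<alpha> n) f (p n) u = (if a \<le> ?r n \<and> ?r n \<le> b then f (?r n) * p n \<lfloor>\<alpha> n * u\<rfloor> else 0)" for n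
    using \<alpha>(1)[of n] by (simp add: step_density_def field_simps)
  show ?thesis
  proof (cases "a < u \<and> u < b")
    case True
    have "(\<lambda>n. f (?r n) * p n \<lfloor>\<alpha> n * u\<rfloor>) \<longlonglongrightarrow> f u * e"
      by (intro tendsto_mult p continuous_on_tendsto_compose[OF f r]) (use True in auto)
    moreover have "eventually (\<lambda>n. a < ?r n) sequentially" "eventually (\<lambda>n. ?r n < b) sequentially"
      using order_tendstoD[OF r] True by auto
    then have "eventually (\<lambda>n. f (?r n) * p n \<lfloor>\<alpha> n * u\<rfloor> = step_density a b (\<alpha> n) f (p n) u) sequentially"
      by eventually_elim (simp add: eq)
    ultimately have "(\<lambda>n. step_density a b (\<alpha> n) f (p n) u) \<longlonglongrightarrow> f u * e"
      by (rule Lim_transform_eventually)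
    then show ?thesis using True by simp
  next
    case False
    then have out: "u < a \<or> b < u" using u by linarith
    have "eventually (\<lambda>n. ?r n < a \<or> b < ?r n) sequentially"
      using out
    proof
      assume "u < a"
      from order_tendstoD(2)[OF r this] show ?thesis by eventually_elim simp
    next
      assume "b < u"
      from order_tendstoD(1)[OF r this] show ?thesis by eventually_elim simp
    qed
    then have "eventually (\<lambda>n. 0 = step_density a b (\<alpha> n) f (p n) u) sequentially"
      by eventually_elim (auto simp: eq)
    then have "(\<lambda>n. step_density a b (\<alpha> n) f (p n) u) \<longlonglongrightarrow> 0"
      by (rule Lim_transform_eventually[OF tendsto_const])
    then show ?thesis using out by (auto simp: indicator_def)
  qed
qed

text \<open>The dominant term is of order c^(3/2) / \<alpha>^2 with c = O(\<alpha>).\<close>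

lemma variance_rate_tendsto:
  fixes \<alpha> :: "nat \<Rightarrow> real" and c :: "nat \<Rightarrow> real"
  assumes \<alpha>: "\<And>n. \<alpha> n \<ge> 1" "filterlim \<alpha> at_top sequentially"
    and c: "\<And>n. 0 \<le> c n" "\<And>n. c n \<le> D * \<alpha> n"
  shows "(\<lambda>n. (c n * (A * (E * sqrt (c n) + 1))) / (\<alpha> n)\<^sup>2) \<longlonglongrightarrow> 0"
proof -
  have i: "(\<lambda>n. inverse (\<alpha> n)) \<longlonglongrightarrow> 0" by (rule tendsto_inverse_0_at_top[OF \<alpha>(2)])
  have D: "D \<ge> 0" using order.trans[OF c(1) c(2)[of 0]] \<alpha>(1)[of 0] by (simp add: zero_le_mult_iff)
  have "(\<lambda>n. D * (\<bar>A\<bar> * (\<bar>E\<bar> * sqrt (D * inverse (\<alpha> n)) + inverse (\<alpha> n)))) \<longlonglongrightarrow> D * (\<bar>A\<bar> * (\<bar>E\<bar> * sqrt (D * 0) + 0))"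
    by (intro tendsto_intros i)
  then have lim: "(\<lambda>n. D * (\<bar>A\<bar> * (\<bar>E\<bar> * sqrt (D * inverse (\<alpha> n)) + inverse (\<alpha> n)))) \<longlonglongrightarrow> 0" by simp
  have bnd: "norm ((c n * (A * (E * sqrt (c n) + 1))) / (\<alpha> n)\<^sup>2) \<le> D * (\<bar>A\<bar> * (\<bar>E\<bar> * sqrt (D * inverse (\<alpha> n)) + inverse (\<alpha> n)))" for n
  proof -
    have a: "\<alpha> n > 0" using \<alpha>(1)[of n] by simp
    have "\<bar>E * sqrt (c n) + 1\<bar> \<le> \<bar>E\<bar> * sqrt (D * \<alpha> n) + 1"
    proof -
      have "\<bar>E * sqrt (c n) + 1\<bar> \<le> \<bar>E\<bar> * sqrt (c n) + 1" using c(1)[of n] by (simp add: abs_mult abs_triangle_ineq[THEN order_trans])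
      also have "\<dots> \<le> \<bar>E\<bar> * sqrt (D * \<alpha> n) + 1" using c(2)[of n] by (intro add_right_mono mult_left_mono) auto
      finally show ?thesis .
    qed
    then have "norm ((c n * (A * (E * sqrt (c n) + 1))) / (\<alpha> n)\<^sup>2) \<le> ((D * \<alpha> n) * (\<bar>A\<bar> * (\<bar>E\<bar> * sqrt (D * \<alpha> n) + 1))) / (\<alpha> n)\<^sup>2"
      using c[of n] a D by (auto simp: abs_mult intro!: divide_right_mono mult_mono)
    also have "\<dots> = D * (\<bar>A\<bar> * (\<bar>E\<bar> * (sqrt (D * \<alpha> n) / \<alpha> n) + inverse (\<alpha> n)))"
      using a by (simp add: power2_eq_square field_simps)
    also have "sqrt (D * \<alpha> n) / \<alpha> n = sqrt (D * inverse (\<alpha> n))"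
    proof -
      have "sqrt (D * \<alpha> n) / \<alpha> n = sqrt (D * \<alpha> n) / sqrt ((\<alpha> n)\<^sup>2)" using a by simp
      also have "\<dots> = sqrt ((D * \<alpha> n) / (\<alpha> n)\<^sup>2)" by (simp only: real_sqrt_divide)
      also have "(D * \<alpha> n) / (\<alpha> n)\<^sup>2 = D * inverse (\<alpha> n)"
        using a by (simp add: power2_eq_square divide_inverse)
      finally show ?thesis .
    qed
    finally show ?thesis .
  qed
  show ?thesis by (rule Lim_null_comparison[OF always_eventually[OF allI[OF bnd]] lim])
qed

lemma linear_statistic_concentration:
  fixes \<rho> :: "series \<Rightarrow> complex" and \<rho>s :: "real \<Rightarrow> series \<Rightarrow> complex"
    and L :: "real \<Rightarrow> nat" and \<phi> \<psi> :: "real \<Rightarrow> nat \<Rightarrow> real"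
    and PS :: "real \<Rightarrow> int set measure" and f :: "real \<Rightarrow> real" and m :: "int set"
    and \<epsilon> :: real and \<alpha> :: "nat \<Rightarrow> real"
  assumes an: "analytic_near_circle \<rho>"
    and sp: "\<And>\<alpha>. \<alpha> > 0 \<Longrightarrow> specialization (\<rho>s \<alpha>)"
    and psum: "\<And>\<alpha> k. \<alpha> > 0 \<Longrightarrow> k \<ge> 1 \<Longrightarrow>
           \<rho>s \<alpha> (power_sum k) = complex_of_real \<alpha> * \<rho> (power_sum k)"
    and arcs: "\<And>u. u \<in> {u_min \<rho>..u_max \<rho>} \<Longrightarrow>
           arcs {z \<in> sphere 0 1. zG' \<rho> z \<ge> u} (L u) (\<phi> u) (\<psi> u)"
    and det: "\<And>u. u \<in> {u_min \<rho>..u_max \<rho>} \<Longrightarrow>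
           determinantal (PS u) (S_kernel (L u) (\<phi> u) (\<psi> u))"
    and f: "continuous_on UNIV f" and m: "finite m" and \<epsilon>: "\<epsilon> > 0"
    and \<alpha>: "\<And>n. \<alpha> n \<ge> 1" "filterlim \<alpha> at_top sequentially"
  shows "(\<lambda>n. measure (schur_process (\<rho>s (\<alpha> n)))
            {X. \<bar>Sigma_stat \<rho> f m (\<alpha> n) X - I_lim \<rho> PS f m\<bar> > \<epsilon>}) \<longlonglongrightarrow> 0"
proof -
  let ?a = "u_min \<rho>" and ?b = "u_max \<rho>"
  define \<gamma> where "\<gamma> t = 2 * Im (psum_series \<rho> (cis t))" for t
  define g where "g t = zG' \<rho> (cis t)" for t
  define P where "P n = schur_process (\<rho>s (\<alpha> n))" for n
  have \<alpha>0: "\<alpha> n > 0" for n using \<alpha>(1)[of n] by simp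
  have \<gamma>: "(\<gamma> has_real_derivative g t) (at t)" for t
    using zG'_derivative(1)[OF an, of t] by (simp add: \<gamma>_def[abs_def] g_def)
  have g [measurable]: "g \<in> borel_measurable borel"
    using zG'_derivative(2)[OF an] by (intro borel_measurable_continuous_onI) (simp add: g_def[abs_def])
  have "\<exists>J K. J abssummable UNIV \<and> (\<forall>t. FT J t = cis (\<alpha> n * \<gamma> t)) \<and>
      (\<forall>a b X. K (a + X) (b + X) = infsetsum (\<lambda>k. J (k + b) * cnj (J (k + a))) {X<..}) \<and>
      bessel_process (P n) K" for n
  proof (rule schur_process_kernel[OF sp[OF \<alpha>0] an psum[OF \<alpha>0]])
    fix J K assume "J abssummable UNIV" "\<And>t. FT J t = cis (\<alpha> n * (2 * Im (psum_series \<rho> (cis t))))"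
      "\<And>a b X. K (a + X) (b + X) = infsetsum (\<lambda>k. J (k + b) * cnj (J (k + a))) {X<..}"
      "bessel_process (schur_process (\<rho>s (\<alpha> n))) K"
    then show ?thesis by (intro exI[of _ J] exI[of _ K]) (simp add: \<gamma>_def P_def)
  qed
  then have "\<forall>n. \<exists>J K. J abssummable UNIV \<and> (\<forall>t. FT J t = cis (\<alpha> n * \<gamma> t)) \<and>
      (\<forall>a b X. K (a + X) (b + X) = infsetsum (\<lambda>k. J (k + b) * cnj (J (k + a))) {X<..}) \<and>
      bessel_process (P n) K" by (rule allI)
  then obtain J K where JK: "\<forall>n. J n abssummable UNIV \<and> (\<forall>t. FT (J n) t = cis (\<alpha> n * \<gamma> t)) \<and>
      (\<forall>a b X. K n (a + X) (b + X) = infsetsum (\<lambda>k. J n (k + b) * cnj (J n (k + a))) {X<..}) \<and>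
      bessel_process (P n) (K n)"
    unfolding choice_iff by (elim exE) (rule that)
  have J: "J n abssummable UNIV" and FJ: "FT (J n) t = cis (\<alpha> n * \<gamma> t)"
    and K: "K n (a + X) (b + X) = infsetsum (\<lambda>k. J n (k + b) * cnj (J n (k + a))) {X<..}"
    and bp: "bessel_process (P n) (K n)" for n t a b X
    using JK by simp_all
  interpret bessel_process "P n" "K n" for n by (rule bp)

  obtain ms where ms: "set ms = m" "distinct ms" using finite_distinct_list[OF m] by blast
  define p where "p n x = measure (P n) {X. shift m x \<subseteq> X}" for n x
  have p_eq: "complex_of_real (p n x) =
      fdet (length ms) (\<lambda>i j. infsetsum (\<lambda>k. J n (k + ms ! j) * cnj (J n (k + ms ! i))) {x<..})" for n x
  proof -
    have d: "distinct (map (\<lambda>a. a + x) ms)" using ms(2) by (simp add: distinct_map inj_on_def)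
    have "set (map (\<lambda>a. a + x) ms) = shift m x" using ms(1) by (simp add: shift_def)
    then have "complex_of_real (p n x) =
        fdet (length ms) (\<lambda>i j. K n (map (\<lambda>a. a + x) ms ! i) (map (\<lambda>a. a + x) ms ! j))"
      using corr[OF d, of n] by (simp add: p_def)
    also have "\<dots> = fdet (length ms) (\<lambda>i j. infsetsum (\<lambda>k. J n (k + ms ! j) * cnj (J n (k + ms ! i))) {x<..})"
      by (rule fdet_cong) (simp add: K)
    finally show ?thesis .
  qed

  define T where "T u a b = (\<integral>t. indicator {t. g t > u} t * cis (of_int (a - b) * t) \<partial>circ)" for u a b
  \<comment> \<open>\<open>T\<close> carries the strict inequality that comes out of the limit,
    \<open>T'\<close> the weak one of the limit kernel, with the indices exchanged. Unless u is an
    atom they agree up to transposition, which the determinant ignores.\<close>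
  define T' where "T' u a b = (\<integral>t. (if u \<le> g t then cis (of_int (b - a) * t) else 0) \<partial>circ)" for u a b
  \<comment> \<open>A version of the limit expectation that is defined and measurable for all real
    u, as dominated convergence requires; it equals the expectation under \<open>PS u\<close> on the
    interval.\<close>
  define E' where "E' u = Re (fdet (length ms) (\<lambda>i j. T' u (ms ! i) (ms ! j)))" for u
  have T'_meas [measurable]: "(\<lambda>u. T' u a b) \<in> borel_measurable borel" for a b
    unfolding T'_def by (rule circ.borel_measurable_lebesgue_integral) measurable
  have E'_meas [measurable]: "E' \<in> borel_measurable borel"
    unfolding E'_def[abs_def] fdet_leibniz by measurable
  have T'_T: "T' u a b = T u b a" if u: "measure circ {t. g t = u} = 0" for u a b
  proof -
    have "AE t in circ. t \<notin> {t. g t = u}"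
      by (rule AE_not_in) (use u in \<open>simp add: null_sets_def circ.emeasure_eq_measure\<close>)
    then show ?thesis unfolding T'_def T_def
      by (intro integral_cong_AE) (auto elim!: eventually_mono simp: indicator_def)
  qed
  have p_lim: "(\<lambda>n. p n \<lfloor>\<alpha> n * u\<rfloor>) \<longlonglongrightarrow> E' u" if u: "measure circ {t. g t = u} = 0" for u
  proof -
    have "(\<lambda>n. fdet (length ms) (\<lambda>i j. infsetsum (\<lambda>k. J n (k + ms ! j) * cnj (J n (k + ms ! i))) {\<lfloor>\<alpha> n * u\<rfloor><..}))
        \<longlonglongrightarrow> fdet (length ms) (\<lambda>i j. T u (ms ! i) (ms ! j))"
      unfolding T_def by (intro tendsto_fdet tail_kernel_limit[OF J FJ \<alpha>0 \<alpha>(2) \<gamma> g u])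
    also have "fdet (length ms) (\<lambda>i j. T u (ms ! i) (ms ! j)) = fdet (length ms) (\<lambda>i j. T' u (ms ! i) (ms ! j))"
      unfolding T'_T[OF u] by (rule fdet_transpose[symmetric])
    finally have "(\<lambda>n. complex_of_real (p n \<lfloor>\<alpha> n * u\<rfloor>)) \<longlonglongrightarrow> fdet (length ms) (\<lambda>i j. T' u (ms ! i) (ms ! j))"
      unfolding p_eq .
    from tendsto_Re[OF this] show ?thesis by (simp add: E'_def)
  qed
  have E_PS: "(\<integral>X. c_pat m X \<partial>PS u) = E' u" if u: "u \<in> {?a..?b}" for u
  proof -
    have "complex_of_real (\<integral>X. c_pat m X \<partial>PS u) =
        fdet (length ms) (\<lambda>i j. S_kernel (L u) (\<phi> u) (\<psi> u) (ms ! i) (ms ! j))"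
      using det[OF u] ms unfolding determinantal_def fdet_def by auto
    also have "\<dots> = fdet (length ms) (\<lambda>i j. T' u (ms ! i) (ms ! j))"
    proof (rule fdet_cong)
      fix i j
      show "S_kernel (L u) (\<phi> u) (\<psi> u) (ms ! i) (ms ! j) = T' u (ms ! i) (ms ! j)"
        unfolding S_kernel_eq_integral[OF arcs[OF u]] T'_def
        by (intro Bochner_Integration.integral_cong refl) (auto simp: indicator_def g_def)
    qed
    finally show ?thesis unfolding E'_def by (metis Re_complex_of_real)
  qed

  have "countable {u. measure circ {t. g t = u} > 0}"
  proof -
    interpret D: real_distribution "distr circ borel g"
      unfolding real_distribution_def real_distribution_axioms_def
      by (auto intro!: circ.prob_space_distr)
    have "measure (distr circ borel g) {u} = measure circ {t. g t = u}" for u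
      by (subst measure_distr) (auto simp: vimage_def)
    then show ?thesis using D.countable_atoms by simp
  qed
  then have null: "AE u in lborel. u \<notin> {u. measure circ {t. g t = u} > 0} \<union> {?a, ?b}"
    by (intro AE_lborel_countable) simp

  obtain B where B: "B \<ge> 0" "\<And>u. ?a \<le> u \<Longrightarrow> u \<le> ?b \<Longrightarrow> \<bar>f u\<bar> \<le> B"
  proof -
    have "bounded (f ` {?a..?b})"
      by (intro compact_imp_bounded compact_continuous_image continuous_on_subset[OF f]) auto
    then obtain B where "\<And>x. x \<in> f ` {?a..?b} \<Longrightarrow> norm x \<le> B" by (auto simp: bounded_iff)
    then show ?thesis by (intro that[of "max B 0"]) (auto intro: max.coboundedI1)
  qed
  have p01: "\<bar>p n x\<bar> \<le> 1" for n x by (simp add: p_def)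

  let ?W = "\<lambda>n. {x::int. \<alpha> n * ?a \<le> real_of_int x \<and> real_of_int x \<le> \<alpha> n * ?b}"
  let ?Z = "\<lambda>n X. \<Sum>x\<in>?W n. f (real_of_int x / \<alpha> n) * c_pat (shift m x) X"
  let ?Y = "\<lambda>n. Sigma_stat \<rho> f m (\<alpha> n)"
  have Y: "?Y n X = 1 / \<alpha> n * ?Z n X" for n X by (simp add: Sigma_stat_def)
  have fs: "finite (shift m x)" for x using m by (rule finite_shift)
  have Y0_int: "integrable (P n) (?Z n)" for n
    by (intro Bochner_Integration.integrable_sum integrable_mult_right c_pat_integrable fs)
  have Y_int: "integrable (P n) (?Y n)" for n
    unfolding Y[abs_def] by (rule integrable_mult_right) (rule Y0_int)
  have EY0: "expectation n (?Z n) = (\<Sum>x\<in>?W n. f (real_of_int x / \<alpha> n) * p n x)" for n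
    by (subst Bochner_Integration.integral_sum)
       (auto intro!: integrable_mult_right c_pat_integrable fs simp: expectation_c_pat fs p_def)
  have EY: "expectation n (?Y n) = (\<integral>u. step_density ?a ?b (\<alpha> n) f (p n) u \<partial>lborel)" for n
    unfolding integral_step_density[OF \<alpha>0] EY0[symmetric] Y by simp
  have EY_lim: "(\<lambda>n. expectation n (?Y n)) \<longlonglongrightarrow> I_lim \<rho> PS f m"
  proof -
    have "(\<lambda>n. \<integral>u. step_density ?a ?b (\<alpha> n) f (p n) u \<partial>lborel) \<longlonglongrightarrow> (\<integral>u. indicator {?a..?b} u * (f u * E' u) \<partial>lborel)"
    proof (rule integral_dominated_convergence[where w = "\<lambda>u. B * indicator {?a..?b + 1} u"])
      have "f \<in> borel_measurable borel" by (rule borel_measurable_continuous_onI[OF f])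
      then show "(\<lambda>u. indicator {?a..?b} u * (f u * E' u)) \<in> borel_measurable lborel" by measurable
      show "integrable lborel (\<lambda>u. B * indicator {?a..?b + 1} u)"
        by (intro integrable_mult_right integrable_real_indicator) (auto simp: emeasure_lborel_Icc_eq)
      show "AE u in lborel. (\<lambda>n. step_density ?a ?b (\<alpha> n) f (p n) u) \<longlonglongrightarrow> indicator {?a..?b} u * (f u * E' u)"
        using null
      proof eventually_elim
        case (elim u)
        then have "measure circ {t. g t = u} = 0" by (simp add: zero_less_measure_iff measure_le_0_iff not_less)
        then show ?case
          using elim by (intro step_density_tendsto[OF \<alpha> f] p_lim) auto
      qed
      show "AE u in lborel. norm (step_density ?a ?b (\<alpha> n) f (p n) u) \<le> B * indicator {?a..?b + 1} u" for n
        by (intro AE_I2 step_density_bound \<alpha> B p01)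
    qed measurable
    moreover have "(\<integral>u. indicator {?a..?b} u * (f u * E' u) \<partial>lborel) = I_lim \<rho> PS f m"
      unfolding I_lim_def set_lebesgue_integral_def
      by (intro Bochner_Integration.integral_cong refl) (auto simp: indicator_def E_PS)
    ultimately show ?thesis by (simp add: EY)
  qed

  define V where "V n = B\<^sup>2 * ((card (?W n) * (real ((card m)\<^sup>2) * (fact (2 * card m) * sqrt (card (?W n)) + 1))) / (\<alpha> n)\<^sup>2)" for n
  have V_lim: "V \<longlonglongrightarrow> 0"
  proof -
    have "real (card (?W n)) \<le> (\<bar>?b - ?a\<bar> + 1) * \<alpha> n" for n
    proof -
      have "real (card (?W n)) \<le> \<bar>\<alpha> n * ?b - \<alpha> n * ?a\<bar> + 1" by (rule card_int_window)
      also have "\<alpha> n * ?b - \<alpha> n * ?a = (?b - ?a) * \<alpha> n" by (simp add: algebra_simps)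
      also have "\<bar>\<dots>\<bar> = \<bar>?b - ?a\<bar> * \<alpha> n" using \<alpha>0[of n] by (simp add: abs_mult)
      finally show ?thesis using \<alpha>(1)[of n] by (simp add: algebra_simps)
    qed
    then have "(\<lambda>n. (real (card (?W n)) * (real ((card m)\<^sup>2) * (fact (2 * card m) * sqrt (real (card (?W n))) + 1))) / (\<alpha> n)\<^sup>2) \<longlonglongrightarrow> 0"
      by (intro variance_rate_tendsto[OF \<alpha>]) auto
    from tendsto_mult[OF tendsto_const[of "B\<^sup>2"] this] show ?thesis unfolding V_def by simp
  qed
  have var: "variance n (?Y n) \<le> V n" for n
  proof -
    have E: "expectation n (?Y n) = 1 / \<alpha> n * expectation n (?Z n)"
      unfolding Y by (rule integral_mult_right_zero)
    have "variance n (?Y n) = expectation n (\<lambda>X. (1 / \<alpha> n)\<^sup>2 * (?Z n X - expectation n (?Z n))\<^sup>2)"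
      unfolding E unfolding Y by (simp only: right_diff_distrib[symmetric] power_mult_distrib)
    also have "\<dots> = (1 / \<alpha> n)\<^sup>2 * variance n (?Z n)" by (rule integral_mult_right_zero)
    also have "\<dots> \<le> (1 / \<alpha> n)\<^sup>2 * (B\<^sup>2 * (card (?W n) * ((card m)\<^sup>2 * (fact (2 * card m) * sqrt (card (?W n)) + 1))))"
    proof (intro mult_left_mono variance_linear_statistic[OF m finite_int_window])
      fix x assume "x \<in> ?W n"
      then show "\<bar>f (real_of_int x / \<alpha> n)\<bar> \<le> B" using \<alpha>0[of n] by (intro B(2)) (auto simp: field_simps)
    qed simp
    also have "\<dots> = V n" by (simp add: V_def power_divide)
    finally show ?thesis .
  qed
  \<comment> \<open>The tolerance is halved: the bias of the mean is eventually below \<epsilon> /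
    2, and Chebyshev's inequality controls fluctuations of at least \<epsilon> / 2.\<close>
  have "eventually (\<lambda>n. measure (P n) {X. \<bar>?Y n X - I_lim \<rho> PS f m\<bar> > \<epsilon>} \<le> V n / (\<epsilon> / 2)\<^sup>2) sequentially"
  proof -
    have "eventually (\<lambda>n. dist (expectation n (?Y n)) (I_lim \<rho> PS f m) < \<epsilon> / 2) sequentially"
      by (rule tendstoD[OF EY_lim]) (use \<epsilon> in simp)
    then show ?thesis
    proof eventually_elim
      case (elim n)
      have [measurable]: "?Y n \<in> borel_measurable (P n)" using Y_int by (rule borel_measurable_integrable)
      let ?S = "{X \<in> space (P n). \<epsilon> / 2 \<le> \<bar>?Y n X - expectation n (?Y n)\<bar>}"
      have Y2: "integrable (P n) (\<lambda>X. (?Y n X)\<^sup>2)"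
      proof -
        have bd: "\<bar>?Y n X\<bar> \<le> 1 / \<alpha> n * (\<Sum>x\<in>?W n. \<bar>f (real_of_int x / \<alpha> n)\<bar>)" for X
        proof -
          have "\<bar>?Z n X\<bar> \<le> (\<Sum>x\<in>?W n. \<bar>f (real_of_int x / \<alpha> n)\<bar>)"
            by (rule order.trans[OF sum_abs]) (auto intro!: sum_mono simp: c_pat_def)
          then show ?thesis unfolding Y abs_mult using \<alpha>0[of n] by (simp add: divide_right_mono)
        qed
        show ?thesis
        proof (rule integrable_const_bound)
          show "AE X in P n. norm ((?Y n X)\<^sup>2) \<le> (1 / \<alpha> n * (\<Sum>x\<in>?W n. \<bar>f (real_of_int x / \<alpha> n)\<bar>))\<^sup>2"
            using power_mono[OF bd abs_ge_zero, where n = 2] by (intro AE_I2) simp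
        qed measurable
      qed
      have "measure (P n) {X. \<bar>?Y n X - I_lim \<rho> PS f m\<bar> > \<epsilon>} \<le> measure (P n) ?S"
      proof (rule finite_measure_mono)
        show "{X. \<bar>?Y n X - I_lim \<rho> PS f m\<bar> > \<epsilon>} \<subseteq> ?S"
        proof
          fix X assume "X \<in> {X. \<bar>?Y n X - I_lim \<rho> PS f m\<bar> > \<epsilon>}"
          then have "\<epsilon> < \<bar>?Y n X - I_lim \<rho> PS f m\<bar>" by simp
          moreover have "\<bar>expectation n (?Y n) - I_lim \<rho> PS f m\<bar> < \<epsilon> / 2" using elim by (simp only: dist_real_def)
          ultimately have "\<epsilon> / 2 \<le> \<bar>?Y n X - expectation n (?Y n)\<bar>" by linarith
          then show "X \<in> ?S" by simp
        qed
        show "?S \<in> sets (P n)" by measurable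
      qed
      also have "\<dots> \<le> variance n (?Y n) / (\<epsilon> / 2)\<^sup>2"
        by (rule Chebyshev_inequality) (use Y2 \<epsilon> in auto)
      also have "\<dots> \<le> V n / (\<epsilon> / 2)\<^sup>2" by (rule divide_right_mono[OF var]) simp
      finally show ?case .
    qed
  qed
  then have ev: "eventually (\<lambda>n. norm (measure (P n) {X. \<bar>?Y n X - I_lim \<rho> PS f m\<bar> > \<epsilon>}) \<le> V n / (\<epsilon> / 2)\<^sup>2) sequentially"
    by simp
  have "(\<lambda>n. V n / (\<epsilon> / 2)\<^sup>2) \<longlonglongrightarrow> 0"
    using tendsto_divide[OF V_lim tendsto_const[of "(\<epsilon> / 2)\<^sup>2"]] \<epsilon> by simp
  with ev have "(\<lambda>n. measure (P n) {X. \<bar>?Y n X - I_lim \<rho> PS f m\<bar> > \<epsilon>}) \<longlonglongrightarrow> 0"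
    by (rule Lim_null_comparison)
  then show ?thesis by (simp add: P_def)
qed

theorem theorem1p3:
  fixes \<rho> :: "series \<Rightarrow> complex"
    and \<rho>s :: "real \<Rightarrow> series \<Rightarrow> complex"
    and L :: "real \<Rightarrow> nat" and \<phi> \<psi> :: "real \<Rightarrow> nat \<Rightarrow> real"
    and PS :: "real \<Rightarrow> int set measure"
    and f :: "real \<Rightarrow> real" and m :: "int set" and \<epsilon> :: real
  assumes "specialization \<rho>"
    and "analytic_near_circle \<rho>"
    and "\<And>\<alpha>. \<alpha> > 0 \<Longrightarrow> specialization (\<rho>s \<alpha>)"
    and "\<And>\<alpha> k. \<alpha> > 0 \<Longrightarrow> k \<ge> 1 \<Longrightarrow>
           \<rho>s \<alpha> (power_sum k) = complex_of_real \<alpha> * \<rho> (power_sum k)"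
    and "\<And>u. u \<in> {u_min \<rho>..u_max \<rho>} \<Longrightarrow>
           arcs {z \<in> sphere 0 1. zG' \<rho> z \<ge> u} (L u) (\<phi> u) (\<psi> u)"
    and "\<And>u. u \<in> {u_min \<rho>..u_max \<rho>} \<Longrightarrow>
           determinantal (PS u) (S_kernel (L u) (\<phi> u) (\<psi> u))"
    and "continuous_on UNIV f"
    and "finite m"
    and "\<epsilon> > 0"
  shows "((\<lambda>\<alpha>. measure (schur_process (\<rho>s \<alpha>))
            {X. \<bar>Sigma_stat \<rho> f m \<alpha> X - I_lim \<rho> PS f m\<bar> > \<epsilon>}) \<longlongrightarrow> 0) at_top"
proof (rule tendsto_at_topI_sequentially)
  fix \<alpha> :: "nat \<Rightarrow> real" assume \<alpha>: "filterlim \<alpha> at_top sequentially"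
  \<comment> \<open>Replaces the sequence by one that is at least 1 everywhere, as the uniform
    bounds demand; the two agree from some index on.\<close>
  define \<beta> where "\<beta> n = max 1 (\<alpha> n)" for n
  have ev: "eventually (\<lambda>n. \<beta> n = \<alpha> n) sequentially"
    using filterlim_at_top[THEN iffD1, OF \<alpha>, rule_format, of 1]
    by eventually_elim (simp add: \<beta>_def)
  have \<beta>: "filterlim \<beta> at_top sequentially" "\<And>n. \<beta> n \<ge> 1"
    using filterlim_cong[OF refl refl ev] \<alpha> by (blast, simp add: \<beta>_def)
  have "(\<lambda>n. measure (schur_process (\<rho>s (\<beta> n)))
            {X. \<bar>Sigma_stat \<rho> f m (\<beta> n) X - I_lim \<rho> PS f m\<bar> > \<epsilon>}) \<longlonglongrightarrow> 0"
    by (rule linear_statistic_concentration[OF assms(2-9) \<beta>(2,1)])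
  moreover have "eventually (\<lambda>n. measure (schur_process (\<rho>s (\<beta> n)))
            {X. \<bar>Sigma_stat \<rho> f m (\<beta> n) X - I_lim \<rho> PS f m\<bar> > \<epsilon>} =
      measure (schur_process (\<rho>s (\<alpha> n)))
            {X. \<bar>Sigma_stat \<rho> f m (\<alpha> n) X - I_lim \<rho> PS f m\<bar> > \<epsilon>}) sequentially"
    using ev by eventually_elim simp
  ultimately show "(\<lambda>n. measure (schur_process (\<rho>s (\<alpha> n)))
            {X. \<bar>Sigma_stat \<rho> f m (\<alpha> n) X - I_lim \<rho> PS f m\<bar> > \<epsilon>}) \<longlonglongrightarrow> 0"
    by (rule Lim_transform_eventually)
qed

end
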